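(* Let $\widehat{\mu}(n)=\pi\sqrt{n}$. For every positive integer $m$ there exist an integer $N$, real numbers $a_0,\dots,a_m$ and real numbers $C_1,C_2>0$ such that for all $n\geq N$, \[ \sum_{k=0}^m a_k\widehat{\mu}(n)^{-k}-C_1\widehat{\mu}(n)^{-m-1}<\frac{\overline{p}(n+1)}{\overline{p}(n)}<\sum_{k=0}^m a_k\widehat{\mu}(n)^{-k}+C_2\widehat{\mu}(n)^{-m-1}. \]
   Context: An overpartition of a nonnegative integer $n$ is a partition of $n$ in which the first occurrence of each distinct part may be overlined; $\overline{p}(n)$ denotes the number of overpartitions of $n$. *)

theory Defs
  imports Complex_Main "HOL-Library.Multiset"
begin

text \<open>
  An overpartition is encoded as a pair \<open>(M, S)\<close>: \<open>M\<close> is the underlying partition, as the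
  multiset of its (positive) parts, and \<open>S\<close> is the set of those distinct parts whose first
  occurrence is overlined.
\<close>

definition overpartitions :: "nat \<Rightarrow> (nat multiset \<times> nat set) set" where
  "overpartitions n =
     {(M, S). (\<forall>x\<in>#M. 0 < x) \<and> sum_mset M = n \<and> S \<subseteq> set_mset M}"

definition overpartition_count :: "nat \<Rightarrow> nat" where
  "overpartition_count n = card (overpartitions n)"

definition mu_hat :: "nat \<Rightarrow> real" where
  "mu_hat n = pi * sqrt (real n)"

lemma size_le_sum_mset:
  fixes M :: "nat multiset"
  shows "\<forall>x\<in>#M. 0 < x \<Longrightarrow> size M \<le> sum_mset M"
  by (induction M) auto

text \<open>Finiteness, so that \<open>card\<close> above is a genuine count.\<close>

lemma finite_overpartitions: "finite (overpartitions n)"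
proof (rule finite_subset)
  show "overpartitions n \<subseteq>
    (mset ` {xs. set xs \<subseteq> {..n} \<and> length xs \<le> n}) \<times> Pow {..n}"
  proof (rule subsetI, clarify)
    fix M S assume "(M, S) \<in> overpartitions n"
    then have pos: "\<forall>x\<in>#M. 0 < x" and s: "sum_mset M = n" and S: "S \<subseteq> set_mset M"
      by (auto simp: overpartitions_def)
    have le: "x \<le> n" if "x \<in># M" for x
    proof -
      obtain M' where "M = add_mset x M'" using \<open>x \<in># M\<close> by (meson multi_member_split)
      then show "x \<le> n" using s by simp
    qed
    obtain xs where xs: "M = mset xs" by (metis ex_mset)
    have "length xs \<le> n" using size_le_sum_mset[OF pos] s xs by simp
    moreover have "set xs \<subseteq> {..n}" using le xs by auto
    moreover have "S \<in> Pow {..n}" using le S by blast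
    ultimately show "M \<in> mset ` {xs. set xs \<subseteq> {..n} \<and> length xs \<le> n} \<and> S \<in> Pow {..n}"
      using xs by blast
  qed
  show "finite ((mset ` {xs. set xs \<subseteq> {..n} \<and> length xs \<le> n}) \<times> Pow {..n})"
    by (intro finite_cartesian_product finite_imageI finite_lists_length_le) auto
qed

end

theory Submission
  imports Defs "HOL-Complex_Analysis.Complex_Analysis" "HOL-Real_Asymp.Real_Asymp"
begin

text \<open>
  Circle method with a single major arc. The generating function \<open>P(q)\<close> of overpartitions is
  \<open>\<Prod> (1 + q\<^sup>k) / (1 - q\<^sup>k)\<close>, which by an identity of Gauss is \<open>1 / \<theta>\<^sub>4(q)\<close>.
  The modular transformation of \<open>\<theta>\<^sub>4\<close> is obtained for real arguments by Polya's argument (a roots-of-unity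
  filter applied to \<open>(2 cos x) ^ (2 m)\<close> with \<open>m\<close> proportional to the square of the order of the roots),
  and extended to the right half plane by analytic continuation. Hence \<open>P(exp (- \<pi> s))\<close> equals
  \<open>csqrt s / 2 * exp (\<pi> / (4 s))\<close> up to an exponentially small error when \<open>\<bar>Im s\<bar> \<le> Re s\<close>, while elsewhere
  \<open>P\<close> is exponentially smaller than on the real axis by a termwise comparison of the products.
  The saddle-point integral has an elementary primitive up to error functions, so the number of
  overpartitions of \<open>n\<close> is \<open>c (1 - 1/\<mu>) / \<mu>\<^sup>2 * exp \<mu>\<close> with a relative error that is exponentially small in
  \<open>\<mu> = \<pi> sqrt n\<close>. The quotient of two consecutive main terms is a holomorphic
  function of \<open>1/\<mu>\<close> near \<open>0\<close>, and its Taylor polynomials give the claim.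
\<close>

section \<open>The generating function\<close>

text \<open>The claim asks for every power of 1/\<mu>, so the count is needed with a relative error
  below all powers at once: hence exponential savings in every estimate, and an exact primitive at
  the saddle in place of a Laplace expansion. One asymptotic formula then serves all
  \<open>m\<close>, and its constant factor cancels in the quotient. Gauss' identity and the modular
  transformation are both limits of finite identities, which are easiest to control for real
  arguments. Complex arguments enter once, through the identity theorem, applied to the
  multiplied-out form because zeros of the dual series are not excluded a priori. The cut |Im s| =
  Re s is made so that inside it Re(1/s) is at least half of 1/Re s: the dual nome exp(-2\<pi>/s) is
  tiny and the dual series is 1 up to an exponential error. Outside, the losses in absolute value of
  the single factors add up to a geometric series. The line Re s = \<pi>/(2\<mu>) balances the
  exponents \<pi>/(4s) and \<pi>ns; the weakest saving on the way is that of the minor arc,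
  exp(-\<mu>/360).\<close>

definition bounded_overpartitions :: "nat \<Rightarrow> nat \<Rightarrow> (nat multiset \<times> nat set) set" where
  "bounded_overpartitions K n = {(M, S) \<in> overpartitions n. set_mset M \<subseteq> {..K}}"

text \<open>The number of ways in which copies of the part \<open>k\<close> can contribute \<open>i\<close> to the sum: if there is
  at least one copy, the first one may be overlined or not.\<close>

definition part_weight :: "nat \<Rightarrow> nat \<Rightarrow> nat" where
  "part_weight k i = (if i = 0 then 1 else if k dvd i then 2 else 0)"

lemma finite_bounded_overpartitions: "finite (bounded_overpartitions K n)"
  by (rule finite_subset[OF _ finite_overpartitions[of n]]) (auto simp: bounded_overpartitions_def)

lemma overpartition_part_le: "(M, S) \<in> overpartitions n \<Longrightarrow> x \<in># M \<Longrightarrow> x \<le> n"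
  by (auto simp: overpartitions_def dest!: multi_member_split)

text \<open>A part never exceeds the sum, so coefficient \<open>n\<close> of the truncated products
  is final from \<open>K = n\<close> on; this lets the infinite product be read off from the finite
  ones.\<close>

lemma bounded_overpartitions_eq: "n \<le> K \<Longrightarrow> bounded_overpartitions K n = overpartitions n"
  using overpartition_part_le by (fastforce simp: bounded_overpartitions_def)

lemma card_bounded_overpartitions_le: "card (bounded_overpartitions K n) \<le> overpartition_count n"
  unfolding overpartition_count_def
  by (rule card_mono[OF finite_overpartitions]) (auto simp: bounded_overpartitions_def)

lemma bounded_overpartitions_0: "bounded_overpartitions 0 n = (if n = 0 then {({#}, {})} else {})"
proof -
  have "M = {#}" if "\<forall>x\<in>#M. 0 < x" "set_mset M \<subseteq> {..0}" for M :: "nat multiset"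
    using that by (metis atMost_iff le_zero_eq less_irrefl multiset_nonemptyE subsetD)
  then have "a \<in> bounded_overpartitions 0 n \<longleftrightarrow> n = 0 \<and> a = ({#}, {})" for a
    by (cases a) (auto simp: bounded_overpartitions_def overpartitions_def)
  then show ?thesis by auto
qed

text \<open>Removing all copies of \<open>Suc K\<close>, say j of them with
  \<open>i = Suc K * j\<close>, leaves an overpartition with parts at most \<open>K\<close>. What is
  lost is one bit, whether \<open>Suc K\<close> was overlined, and this bit is free only if j >
  0.\<close>

lemma card_bounded_overpartitions_slice:
  assumes "i \<le> n"
  shows "card {(M, S) \<in> bounded_overpartitions (Suc K) n. Suc K * count M (Suc K) = i} =
    part_weight (Suc K) i * card (bounded_overpartitions K (n - i))" (is "card ?A = _")
proof (cases "Suc K dvd i")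
  case False
  then have "?A = {}" using dvd_triv_left by blast
  moreover have "part_weight (Suc K) i = 0" using False by (cases "i = 0") (simp_all add: part_weight_def)
  ultimately show ?thesis by (simp only: card.empty mult_0)
next
  case True
  then obtain j where j: "i = Suc K * j" by (auto simp: dvd_def)
  define B where "B = (if j = 0 then {False} else UNIV)"
  define f where "f = (\<lambda>(b, M, S). (M + replicate_mset j (Suc K), if b then insert (Suc K) S else S))"
  define g where "g = (\<lambda>(M, S). (Suc K \<in> S, filter_mset (\<lambda>x. x \<noteq> Suc K) M, S - {Suc K}))"
  have "bij_betw f (B \<times> bounded_overpartitions K (n - i)) ?A"
  proof (rule bij_betw_byWitness[where f' = g])
    have fl: "filter_mset (\<lambda>x. x \<noteq> Suc K) M = M" if "set_mset M \<subseteq> {..K}" for M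
      using that by (intro filter_mset_eq_conv[THEN iffD2]) auto
    have fr: "filter_mset (\<lambda>x. x \<noteq> Suc K) (replicate_mset j (Suc K)) = {#}"
      by (auto simp: filter_mset_eq_conv)
    show "\<forall>a\<in>B \<times> bounded_overpartitions K (n - i). g (f a) = a"
    proof
      fix a assume a: "a \<in> B \<times> bounded_overpartitions K (n - i)"
      obtain b M S where abc: "a = (b, M, S)" by (cases a)
      have M: "set_mset M \<subseteq> {..K}" and S: "S \<subseteq> set_mset M"
        using a abc by (auto simp: bounded_overpartitions_def overpartitions_def)
      then have "Suc K \<notin> S" by fastforce
      then show "g (f a) = a" using fl[OF M] fr by (auto simp: f_def g_def abc)
    qed
    have split: "filter_mset (\<lambda>x. x \<noteq> Suc K) M + replicate_mset (count M (Suc K)) (Suc K) = M" for M :: "nat multiset"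
      by (rule multiset_eqI) auto
    show "\<forall>a\<in>?A. f (g a) = a"
    proof
      fix a assume a: "a \<in> ?A"
      obtain M S where ab: "a = (M, S)" by (cases a)
      have "Suc K * count M (Suc K) = Suc K * j" using a ab j by blast
      then have "count M (Suc K) = j" by (simp only: mult_cancel1) simp
      then show "f (g a) = a" using split[of M] by (auto simp: f_def g_def ab)
    qed
    show "f ` (B \<times> bounded_overpartitions K (n - i)) \<subseteq> ?A"
    proof
      fix x assume "x \<in> f ` (B \<times> bounded_overpartitions K (n - i))"
      then obtain b M S where x: "x = f (b, M, S)" and b: "b \<in> B"
        and MS: "(M, S) \<in> bounded_overpartitions K (n - i)" by auto
      have M: "set_mset M \<subseteq> {..K}" and S: "S \<subseteq> set_mset M" and s: "sum_mset M = n - i" "\<forall>x\<in>#M. 0 < x"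
        using MS by (auto simp: bounded_overpartitions_def overpartitions_def)
      have c: "count M (Suc K) = 0" using M by (meson atMost_iff not_less_eq_eq order_refl count_eq_zero_iff subsetD)
      have sm: "sum_mset (replicate_mset j (Suc K)) = i" by (simp add: j)
      show "x \<in> ?A"
        using b M S s c assms sm
        by (auto simp: x f_def bounded_overpartitions_def overpartitions_def B_def j split: if_splits)
    qed
    show "g ` ?A \<subseteq> B \<times> bounded_overpartitions K (n - i)"
    proof
      fix x assume "x \<in> g ` ?A"
      then obtain M S where x: "x = g (M, S)" and MS: "(M, S) \<in> ?A" by auto
      have M: "set_mset M \<subseteq> {..Suc K}" and S: "S \<subseteq> set_mset M" and s: "sum_mset M = n" "\<forall>x\<in>#M. 0 < x"
        using MS by (auto simp: bounded_overpartitions_def overpartitions_def)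
      have "Suc K * count M (Suc K) = Suc K * j" using MS j by blast
      then have c: "count M (Suc K) = j" by (simp only: mult_cancel1) simp
      have "sum_mset (filter_mset (\<lambda>x. x \<noteq> Suc K) M) + i = n"
        using split[of M] s c j by (metis sum_mset.union sum_mset_replicate_mset mult.commute of_nat_id)
      moreover have "Suc K \<in> S \<Longrightarrow> j \<noteq> 0" using S c by (auto simp: count_eq_zero_iff)
      ultimately show "x \<in> B \<times> bounded_overpartitions K (n - i)"
        using M S s by (auto simp: x g_def bounded_overpartitions_def overpartitions_def B_def le_Suc_eq)
    qed
  qed
  then have "card ?A = card B * card (bounded_overpartitions K (n - i))"
    using bij_betw_same_card[of f "B \<times> bounded_overpartitions K (n - i)" ?A]
    by (simp only: card_cartesian_product)
  also have "card B = part_weight (Suc K) i"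
  proof (cases "j = 0")
    case False
    then have "i \<noteq> 0" using j by simp
    then show ?thesis using True False by (simp add: B_def part_weight_def)
  qed (simp add: B_def part_weight_def j)
  finally show ?thesis .
qed

text \<open>Sorting by the total contributed by the part \<open>Suc K\<close> gives a convolution,
  which is multiplication of the generating function by the series of
  \<open>part_weight\<close>.\<close>

lemma card_bounded_overpartitions_Suc:
  "card (bounded_overpartitions (Suc K) n) =
    (\<Sum>i\<le>n. part_weight (Suc K) i * card (bounded_overpartitions K (n - i)))"
proof -
  have le: "Suc K * count M (Suc K) \<le> n" if "(M, S) \<in> bounded_overpartitions (Suc K) n" for M S
  proof -
    have "replicate_mset (count M (Suc K)) (Suc K) \<subseteq># M"
      by (rule count_le_replicate_mset_subset_eq[THEN iffD1]) simp
    then obtain M' where "M = replicate_mset (count M (Suc K)) (Suc K) + M'"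
      unfolding mset_subset_eq_exists_conv ..
    then have "sum_mset (replicate_mset (count M (Suc K)) (Suc K)) \<le> sum_mset M"
      by (metis sum_mset.union le_add1)
    then show ?thesis using that
      by (simp add: bounded_overpartitions_def overpartitions_def algebra_simps)
  qed
  have "bounded_overpartitions (Suc K) n =
     (\<Union>i\<le>n. {(M, S) \<in> bounded_overpartitions (Suc K) n. Suc K * count M (Suc K) = i})"
    using le by auto
  then have "card (bounded_overpartitions (Suc K) n) =
     card (\<Union>i\<le>n. {(M, S) \<in> bounded_overpartitions (Suc K) n. Suc K * count M (Suc K) = i})"
    by simp
  also have "\<dots> = (\<Sum>i\<le>n. card {(M, S) \<in> bounded_overpartitions (Suc K) n. Suc K * count M (Suc K) = i})"
    by (rule card_UN_disjoint) (auto intro: finite_subset[OF _ finite_bounded_overpartitions[of "Suc K" n]])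
  also have "\<dots> = (\<Sum>i\<le>n. part_weight (Suc K) i * card (bounded_overpartitions K (n - i)))"
    by (intro sum.cong card_bounded_overpartitions_slice) auto
  finally show ?thesis .
qed

section \<open>From truncated products to the infinite product\<close>

lemma part_weight_sums:
  fixes q :: "'a::{real_normed_field,banach}"
  assumes "norm q < 1" "0 < k"
  shows "(\<lambda>i. of_nat (part_weight k i) * q ^ i) sums ((1 + q ^ k) / (1 - q ^ k))"
proof -
  have nk: "norm (q ^ k) < 1"
    using assms by (simp add: norm_power power_Suc_less_one power_less_one_iff)
  have "(\<lambda>j. 2 * (q ^ k) ^ j) sums (2 * (1 / (1 - q ^ k)))"
    by (intro sums_mult geometric_sums nk)
  from sums_diff[OF this sums_single[of 0 "\<lambda>_. 1"]]
  have "(\<lambda>j. of_nat (part_weight k (k * j)) * q ^ (k * j)) sums (2 * (1 / (1 - q ^ k)) - 1)"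
    by (rule back_subst[where P = "\<lambda>f. f sums _"])
       (use assms in \<open>auto simp: part_weight_def power_mult fun_eq_iff\<close>)
  also have "2 * (1 / (1 - q ^ k)) - 1 = (1 + q ^ k) / (1 - q ^ k)"
  proof -
    have "1 - q ^ k \<noteq> 0" using nk by (metis eq_iff_diff_eq_0 less_irrefl norm_one)
    then show ?thesis by (simp add: field_simps)
  qed
  finally have "(\<lambda>j. (\<lambda>i. of_nat (part_weight k i) * q ^ i) (k * j)) sums ((1 + q ^ k) / (1 - q ^ k))" .
  then show ?thesis
    using assms by (subst (asm) sums_mono_reindex) (auto simp: strict_mono_def part_weight_def dvd_def)
qed

lemma bounded_overpartitions_sums:
  fixes q :: "'a::{real_normed_field,banach}"
  assumes q: "norm q < 1"
  shows "summable (\<lambda>n. norm (of_nat (card (bounded_overpartitions K n)) * q ^ n)) \<and>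
    (\<lambda>n. of_nat (card (bounded_overpartitions K n)) * q ^ n) sums
      (\<Prod>k<K. (1 + q ^ Suc k) / (1 - q ^ Suc k))"
proof -
  \<comment> \<open>The Cauchy product needs absolute summability; as all coefficients are
    nonnegative, this is an induction at the real point \<open>norm q\<close>.\<close>
  have sq: "summable (\<lambda>n. norm (of_nat (card (bounded_overpartitions K n)) * q ^ n))" for K
  proof -
    have "summable (\<lambda>n. real (card (bounded_overpartitions K n)) * norm q ^ n)" for K
    proof (induction K)
      case 0
      show ?case by (rule summable_finite[of "{0}"]) (auto simp: bounded_overpartitions_0)
    next
      case (Suc K)
      have "summable (\<lambda>k. \<Sum>i\<le>k. (real (part_weight (Suc K) i) * norm q ^ i) *
          (real (card (bounded_overpartitions K (k - i))) * norm q ^ (k - i)))"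
        using Suc part_weight_sums[of "norm q" "Suc K"] q
        by (intro summable_Cauchy_product) (auto simp: sums_iff)
      also have "(\<lambda>k. \<Sum>i\<le>k. (real (part_weight (Suc K) i) * norm q ^ i) *
          (real (card (bounded_overpartitions K (k - i))) * norm q ^ (k - i))) =
          (\<lambda>n. real (card (bounded_overpartitions (Suc K) n)) * norm q ^ n)"
        by (auto simp: card_bounded_overpartitions_Suc sum_distrib_right fun_eq_iff power_add[symmetric]
            intro!: sum.cong)
      finally show ?case .
    qed
    then show ?thesis by (simp add: norm_mult norm_power)
  qed
  have sw: "summable (\<lambda>i. norm (of_nat (part_weight (Suc K) i) * q ^ i))" for K
    using part_weight_sums[of "norm q" "Suc K"] q by (simp add: norm_mult norm_power sums_iff)
  have "(\<lambda>n. of_nat (card (bounded_overpartitions K n)) * q ^ n) sums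
      (\<Prod>k<K. (1 + q ^ Suc k) / (1 - q ^ Suc k))"
  proof (induction K)
    case 0
    have "(\<lambda>n. of_nat (card (bounded_overpartitions 0 n)) * q ^ n) = (\<lambda>n. if n = 0 then 1 else 0)"
      by (auto simp: bounded_overpartitions_0)
    then show ?case using sums_single[of 0 "\<lambda>_. 1 :: 'a"] by simp
  next
    case (Suc K)
    have "(\<lambda>k. \<Sum>i\<le>k. (of_nat (part_weight (Suc K) i) * q ^ i) *
        (of_nat (card (bounded_overpartitions K (k - i))) * q ^ (k - i))) sums
        ((\<Sum>i. of_nat (part_weight (Suc K) i) * q ^ i) * (\<Sum>i. of_nat (card (bounded_overpartitions K i)) * q ^ i))"
      by (rule Cauchy_product_sums[OF sw sq])
    also have "(\<Sum>i. of_nat (part_weight (Suc K) i) * q ^ i) = (1 + q ^ Suc K) / (1 - q ^ Suc K)"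
      using part_weight_sums[OF q, of "Suc K"] by (simp add: sums_iff)
    also have "(\<Sum>i. of_nat (card (bounded_overpartitions K i)) * q ^ i) = (\<Prod>k<K. (1 + q ^ Suc k) / (1 - q ^ Suc k))"
      using Suc by (simp add: sums_iff)
    also have "(\<lambda>k. \<Sum>i\<le>k. (of_nat (part_weight (Suc K) i) * q ^ i) *
        (of_nat (card (bounded_overpartitions K (k - i))) * q ^ (k - i))) =
        (\<lambda>n. of_nat (card (bounded_overpartitions (Suc K) n)) * q ^ n)"
      by (auto simp: card_bounded_overpartitions_Suc sum_distrib_right fun_eq_iff power_add[symmetric]
          intro!: sum.cong)
    finally show ?case by (simp add: mult.commute)
  qed
  then show ?thesis using sq by blast
qed

text \<open>Each factor is 1 + 2 r^(k+1) / (1 - r^(k+1)); replacing the denominators by 1 - r leaves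
  a geometric sum in the exponent. Uniformity in \<open>K\<close> is the point: it yields
  convergence of the full series and controls the remainder in Gauss' identity.\<close>

lemma overpartition_product_le:
  fixes r :: real
  assumes "0 \<le> r" "r < 1"
  shows "(\<Prod>k<K. (1 + r ^ Suc k) / (1 - r ^ Suc k)) \<le> exp (2 / (1 - r) ^ 2)"
proof -
  have "(1 + r ^ Suc k) / (1 - r ^ Suc k) \<le> exp (2 * r ^ k / (1 - r))" for k
  proof -
    have a: "r ^ Suc k \<le> r" using assms by (simp add: mult_left_le power_le_one)
    have b: "r ^ Suc k \<le> r ^ k" using assms by (simp add: mult_left_le_one_le)
    have "(1 + r ^ Suc k) / (1 - r ^ Suc k) = 1 + 2 * r ^ Suc k / (1 - r ^ Suc k)"
      using a assms by (simp add: field_simps)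
    also have "\<dots> \<le> 1 + 2 * r ^ k / (1 - r)"
      using a b assms by (intro add_left_mono frac_le) auto
    also have "\<dots> \<le> exp (2 * r ^ k / (1 - r))" by (rule exp_ge_add_one_self)
    finally show ?thesis .
  qed
  moreover have "0 \<le> (1 + r ^ Suc k) / (1 - r ^ Suc k)" for k
    using assms by (simp add: mult_le_one power_le_one)
  ultimately have "(\<Prod>k<K. (1 + r ^ Suc k) / (1 - r ^ Suc k)) \<le> (\<Prod>k<K. exp (2 * r ^ k / (1 - r)))"
    by (intro prod_mono) auto
  also have "\<dots> = exp (2 / (1 - r) * (\<Sum>k<K. r ^ k))"
    by (simp add: exp_sum[symmetric] sum_distrib_left)
  also have "\<dots> \<le> exp (2 / (1 - r) * (1 / (1 - r)))"
  proof -
    have "(\<Sum>k<K. r ^ k) \<le> (\<Sum>k. r ^ k)"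
      by (rule sum_le_suminf) (use assms in \<open>auto intro: summable_geometric\<close>)
    then have "(\<Sum>k<K. r ^ k) \<le> 1 / (1 - r)"
      using assms by (simp add: suminf_geometric)
    then have "2 / (1 - r) * (\<Sum>k<K. r ^ k) \<le> 2 / (1 - r) * (1 / (1 - r))"
      using assms by (intro mult_left_mono) auto
    then show ?thesis by simp
  qed
  finally show ?thesis by (simp add: power2_eq_square)
qed

lemma summable_overpartition_count_real:
  fixes r :: real
  assumes r: "0 \<le> r" "r < 1"
  shows "summable (\<lambda>n. real (overpartition_count n) * r ^ n)"
proof (rule bounded_imp_summable)
  show "0 \<le> real (overpartition_count n) * r ^ n" for n using r by simp
  fix N
  \<comment> \<open>Up to index \<open>N\<close> the coefficients agree with those of the product
    truncated at \<open>N\<close>, so the partial sum is at most that product.\<close>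
  have "(\<Sum>n\<le>N. real (overpartition_count n) * r ^ n) =
      (\<Sum>n\<le>N. real (card (bounded_overpartitions N n)) * r ^ n)"
    by (intro sum.cong) (auto simp: bounded_overpartitions_eq overpartition_count_def)
  also have "\<dots> \<le> (\<Sum>n. real (card (bounded_overpartitions N n)) * r ^ n)"
    using bounded_overpartitions_sums[of r N] r
    by (intro sum_le_suminf) (auto simp: sums_iff)
  also have "\<dots> \<le> exp (2 / (1 - r) ^ 2)"
    using bounded_overpartitions_sums[of r N] overpartition_product_le[OF r, of N] r
    by (simp add: sums_iff)
  finally show "(\<Sum>n\<le>N. real (overpartition_count n) * r ^ n) \<le> exp (2 / (1 - r) ^ 2)" .
qed

lemma summable_overpartition_count:
  fixes q :: "'a::{real_normed_field,banach}"
  assumes "norm q < 1"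
  shows "summable (\<lambda>n. norm (of_nat (overpartition_count n) * q ^ n))"
  using summable_overpartition_count_real[of "norm q"] assms by (simp add: norm_mult norm_power)

definition overpartition_gf :: "'a::{real_normed_field,banach} \<Rightarrow> 'a" where
  "overpartition_gf q = (\<Sum>n. of_nat (overpartition_count n) * q ^ n)"

text \<open>Tannery's theorem: each coefficient stabilises, and all are dominated by the full
  counts, whose series converges absolutely.\<close>

lemma overpartition_product_tendsto:
  fixes q :: "'a::{real_normed_field,banach}"
  assumes q: "norm q < 1"
  shows "(\<lambda>K. \<Prod>k<K. (1 + q ^ Suc k) / (1 - q ^ Suc k)) \<longlonglongrightarrow> overpartition_gf q"
proof -
  have "(\<lambda>K. \<Sum>n. of_nat (card (bounded_overpartitions K n)) * q ^ n) \<longlonglongrightarrow> overpartition_gf q"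
    unfolding overpartition_gf_def
  proof (rule tannerys_theorem[THEN conjunct2, THEN conjunct2])
    show "(\<lambda>K. of_nat (card (bounded_overpartitions K n)) * q ^ n) \<longlonglongrightarrow> of_nat (overpartition_count n) * q ^ n" for n
      by (rule tendsto_eventually, rule eventually_sequentiallyI[of n])
         (simp add: bounded_overpartitions_eq overpartition_count_def)
    show "\<forall>\<^sub>F (n, K) in at_top \<times>\<^sub>F sequentially. norm (of_nat (card (bounded_overpartitions K n)) * q ^ n)
        \<le> norm (of_nat (overpartition_count n) * q ^ n)"
      using card_bounded_overpartitions_le
      by (intro always_eventually) (auto simp: norm_mult intro!: mult_right_mono)
    show "summable (\<lambda>n. norm (of_nat (overpartition_count n) * q ^ n))"
      by (rule summable_overpartition_count[OF q])
  qed auto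
  moreover have "(\<Sum>n. of_nat (card (bounded_overpartitions K n)) * q ^ n) =
      (\<Prod>k<K. (1 + q ^ Suc k) / (1 - q ^ Suc k))" for K
    using bounded_overpartitions_sums[OF q, of K] by (simp add: sums_iff)
  ultimately show ?thesis by simp
qed

section \<open>Gauss' identity\<close>

definition overpartition_prod :: "nat \<Rightarrow> 'a::field \<Rightarrow> 'a" where
  "overpartition_prod K q = (\<Prod>k<K. (1 + q ^ Suc k) / (1 - q ^ Suc k))"

text \<open>Each summand is the increment in s of 2 (-1)^(s+1) q^((s+1)n)
  \<open>overpartition_prod s q\<close>, because the product gains the factor (1 + q^s)/(1 - q^s).
  The bracket is what the induction step from n - 1 to n in \<open>gauss_finite\<close>
  produces.\<close>

lemma gauss_telescope:
  fixes q :: real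
  assumes q: "0 < q" "q < 1"
  shows "(\<Sum>s\<le>m. (-1) ^ s * q ^ (s * n) * (2 * overpartition_prod s q / (1 + q ^ s)) *
           ((1 - q ^ n) * q ^ s - (1 + q ^ n))) =
         2 * (-1) ^ Suc m * q ^ (Suc m * n) * overpartition_prod m q"
proof (induction m)
  case 0
  show ?case by (simp add: overpartition_prod_def)
next
  case (Suc m)
  define x where "x = q ^ Suc m"
  define c where "c = (-1) ^ Suc m * q ^ (Suc m * n)"
  define Q where "Q = overpartition_prod m q"
  have x: "0 < x" "x < 1" using q power_Suc_less_one[of q] by (simp_all add: x_def)
  have Q: "overpartition_prod (Suc m) q = Q * ((1 + x) / (1 - x))"
    by (simp add: overpartition_prod_def Q_def x_def)
  have c': "(-1) ^ Suc (Suc m) * q ^ (Suc (Suc m) * n) = - c * q ^ n"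
    by (simp add: c_def power_add algebra_simps)
  have "(\<Sum>s\<le>Suc m. (-1) ^ s * q ^ (s * n) * (2 * overpartition_prod s q / (1 + q ^ s)) *
           ((1 - q ^ n) * q ^ s - (1 + q ^ n))) =
        2 * c * Q + c * (2 * (Q * ((1 + x) / (1 - x))) / (1 + x)) * ((1 - q ^ n) * x - (1 + q ^ n))"
    using Suc by (simp add: Q x_def[symmetric] c_def Q_def mult.assoc del: power_Suc)
  also have "\<dots> = 2 * (- c * q ^ n) * (Q * ((1 + x) / (1 - x)))"
    using x by (simp add: divide_simps) (simp add: algebra_simps)
  finally show ?case unfolding c'[symmetric] Q[symmetric] by (simp add: mult.assoc)
qed

text \<open>A finite form of Gauss' identity in the style of Shanks. The coefficients
  \<open>2 * overpartition_prod s q / (1 + q ^ s)\<close> are (-1;q)_s / (q;q)_s, written so that s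
  = 0 gives 1. The term s = 0 on the right is 1 and all others carry at least q^(n+1), so the right
  side tends to 1.\<close>

lemma gauss_finite:
  fixes q :: real
  assumes q: "0 < q" "q < 1"
  shows "(1 + 2 * (\<Sum>j<n. (-1) ^ Suc j * q ^ (Suc j)\<^sup>2)) * overpartition_prod n q =
    (\<Sum>s\<le>n. (-1) ^ s * q ^ (s * Suc n) * (2 * overpartition_prod s q / (1 + q ^ s)))"
proof (induction n)
  case 0
  show ?case by (simp add: overpartition_prod_def)
next
  case (Suc n)
  define x where "x = q ^ Suc n"
  define Q where "Q = overpartition_prod n q"
  define T where "T = (\<lambda>s. (-1) ^ s * q ^ (s * Suc n) * (2 * overpartition_prod s q / (1 + q ^ s)))"
  define S where "S = 1 + 2 * (\<Sum>j<n. (-1) ^ Suc j * q ^ (Suc j)\<^sup>2)"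
  define d where "d = (-1) ^ Suc n * q ^ (Suc n * Suc n)"
  have x: "0 < x" "x < 1" using q power_Suc_less_one[of q] by (simp_all add: x_def)
  have Q: "overpartition_prod (Suc n) q = Q * ((1 + x) / (1 - x))"
    by (simp add: overpartition_prod_def Q_def x_def)
  have IH: "S * Q = (\<Sum>s\<le>n. T s)" using Suc by (simp add: S_def Q_def T_def)
  have tel: "(\<Sum>s\<le>n. T s * ((1 - x) * q ^ s - (1 + x))) = 2 * d * Q"
    using gauss_telescope[OF q, of "Suc n" n] by (simp add: T_def x_def Q_def d_def mult.assoc)
  have "(\<Sum>s\<le>n. T s * ((1 - x) * q ^ s - (1 + x))) = (1 - x) * (\<Sum>s\<le>n. T s * q ^ s) - (1 + x) * (\<Sum>s\<le>n. T s)"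
    by (simp add: sum_distrib_left sum_subtractf[symmetric] algebra_simps)
  \<comment> \<open>Raising n by one puts an extra q^s into the summand. The telescoping sum trades
    this weight for the factor (1 + x)/(1 - x) of the product, and its boundary term supplies the
    new term of the theta series.\<close>
  then have key: "(1 - x) * (\<Sum>s\<le>n. T s * q ^ s) = (1 + x) * (S * Q) + 2 * d * Q"
    using tel IH by simp
  have Tq: "(-1) ^ s * q ^ (s * Suc (Suc n)) * (2 * overpartition_prod s q / (1 + q ^ s)) = T s * q ^ s" for s
    by (simp add: T_def power_add algebra_simps)
  have TS: "T (Suc n) = d * (2 * (Q * ((1 + x) / (1 - x))) / (1 + x))"
    by (simp add: T_def d_def Q x_def)
  have "(\<Sum>s\<le>Suc n. (-1) ^ s * q ^ (s * Suc (Suc n)) * (2 * overpartition_prod s q / (1 + q ^ s))) =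
     (\<Sum>s\<le>n. T s * q ^ s) + d * (2 * (Q * ((1 + x) / (1 - x))) / (1 + x)) * x"
    unfolding Tq by (simp add: TS x_def)
  also have "\<dots> = (S + 2 * d) * (Q * ((1 + x) / (1 - x)))"
    using x key by (simp add: divide_simps) (simp add: algebra_simps)
  also have "S + 2 * d = 1 + 2 * (\<Sum>j<Suc n. (-1) ^ Suc j * q ^ (Suc j)\<^sup>2)"
    by (simp add: S_def d_def power2_eq_square algebra_simps)
  finally show ?case unfolding Q by (rule sym)
qed

lemma overpartition_gf_ge_1:
  fixes r :: real
  assumes "0 \<le> r" "r < 1"
  shows "1 \<le> overpartition_gf r"
proof (rule LIMSEQ_le_const)
  show "(\<lambda>K. \<Prod>k<K. (1 + r ^ Suc k) / (1 - r ^ Suc k)) \<longlonglongrightarrow> overpartition_gf r"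
    using assms by (intro overpartition_product_tendsto) auto
  have "1 \<le> (1 + r ^ Suc k) / (1 - r ^ Suc k)" for k
    using power_Suc_less_one[of r k] zero_le_power[of r "Suc k"] assms
    by (cases "r = 0") (auto simp: field_simps)
  then show "\<exists>N. \<forall>n\<ge>N. 1 \<le> (\<Prod>k<n. (1 + r ^ Suc k) / (1 - r ^ Suc k))"
    by (intro exI allI impI prod_ge_1) auto
qed

theorem gauss_theta_identity:
  fixes q :: real
  assumes q: "0 < q" "q < 1"
  shows "(\<lambda>j. (-1) ^ Suc j * q ^ (Suc j)\<^sup>2) sums ((1 / overpartition_gf q - 1) / 2)"
proof -
  define B where "B = exp (2 / (1 - q) ^ 2)"
  define G where "G = overpartition_gf q"
  have G: "1 \<le> G" unfolding G_def using q by (intro overpartition_gf_ge_1) auto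
  have Qlim: "(\<lambda>n. overpartition_prod n q) \<longlonglongrightarrow> G"
    unfolding overpartition_prod_def G_def using q by (intro overpartition_product_tendsto) auto
  have Qnn: "0 \<le> overpartition_prod n q" for n
    unfolding overpartition_prod_def using q by (intro prod_nonneg) (simp add: mult_le_one power_le_one)
  \<comment> \<open>The right side of \<open>gauss_finite\<close> without its term s = 0.\<close>
  define e where "e = (\<lambda>n. \<Sum>s\<in>{1..n}. (-1) ^ s * q ^ (s * Suc n) * (2 * overpartition_prod s q / (1 + q ^ s)))"
  have ebound: "norm (e n) \<le> real n * q ^ Suc n * (2 * B)" for n
  proof -
    have "norm (e n) \<le> (\<Sum>s\<in>{1..n}. q ^ Suc n * (2 * B))"
      unfolding e_def
    proof (rule sum_norm_le)
      fix s assume s: "s \<in> {1..n}"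
      have "q ^ (s * Suc n) \<le> q ^ Suc n"
        using q s mult_le_mono1[of 1 s "Suc n"] by (intro power_decreasing) auto
      moreover have "2 * overpartition_prod s q / (1 + q ^ s) \<le> 2 * B"
      proof -
        have "2 * overpartition_prod s q / (1 + q ^ s) \<le> 2 * overpartition_prod s q / 1"
          using q Qnn[of s] by (intro divide_left_mono) (auto intro: add_pos_pos)
        also have "\<dots> \<le> 2 * B"
          using overpartition_product_le[of q s] q by (simp add: B_def overpartition_prod_def)
        finally show ?thesis .
      qed
      moreover have "0 \<le> 2 * overpartition_prod s q / (1 + q ^ s)"
        using q Qnn[of s] by (intro divide_nonneg_pos) (auto intro: add_pos_pos)
      ultimately show "norm ((-1) ^ s * q ^ (s * Suc n) * (2 * overpartition_prod s q / (1 + q ^ s))) \<le> q ^ Suc n * (2 * B)"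
        unfolding norm_mult norm_power using q by (intro mult_mono) (auto simp: abs_mult)
    qed
    then show ?thesis by simp
  qed
  have "(\<lambda>n. real n * q ^ Suc n * (2 * B)) \<longlonglongrightarrow> 0"
  proof -
    have "(\<lambda>n. real n * q ^ n) \<longlonglongrightarrow> 0"
      using powser_times_n_limit_0[of q] q by simp
    from tendsto_mult[OF this tendsto_const[of "q * (2 * B)"]] show ?thesis
      by (simp add: algebra_simps)
  qed
  then have e0: "e \<longlonglongrightarrow> 0"
    by (rule Lim_null_comparison[rotated]) (use ebound in simp)
  have fin: "1 + 2 * (\<Sum>j<n. (-1) ^ Suc j * q ^ (Suc j)\<^sup>2) = (1 + e n) / overpartition_prod n q"
    if "overpartition_prod n q \<noteq> 0" for n
  proof -
    have "(\<Sum>s\<le>n. (-1) ^ s * q ^ (s * Suc n) * (2 * overpartition_prod s q / (1 + q ^ s))) = 1 + e n"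
      unfolding e_def
      by (subst sum.atMost_shift) (simp add: overpartition_prod_def sum.atLeast1_atMost_eq lessThan_Suc_atMost)
    then show ?thesis using gauss_finite[OF q, of n] that by (simp add: field_simps)
  qed
  have ev: "\<forall>\<^sub>F n in sequentially. overpartition_prod n q \<noteq> 0"
    using tendsto_imp_eventually_ne[OF Qlim] G by simp
  have "(\<lambda>n. ((1 + e n) / overpartition_prod n q - 1) / 2) \<longlonglongrightarrow> ((1 + 0) / G - 1) / 2"
    using G by (intro tendsto_intros e0 Qlim) auto
  then have "(\<lambda>n. \<Sum>j<n. (-1) ^ Suc j * q ^ (Suc j)\<^sup>2) \<longlonglongrightarrow> ((1 + 0) / G - 1) / 2"
  proof (rule Lim_transform_eventually)
    show "\<forall>\<^sub>F n in sequentially. ((1 + e n) / overpartition_prod n q - 1) / 2 = (\<Sum>j<n. (-1) ^ Suc j * q ^ (Suc j)\<^sup>2)"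
      using ev by eventually_elim (simp add: fin[symmetric])
  qed
  then show ?thesis unfolding sums_def G_def by simp
qed

section \<open>The modular transformation on the real axis\<close>

definition binom_ratio :: "nat \<Rightarrow> nat \<Rightarrow> real" where
  "binom_ratio m r = real ((2 * m) choose (m + r)) / real ((2 * m) choose m)"

lemma binom_ratio_0: "binom_ratio m 0 = 1"
  by (simp add: binom_ratio_def)

lemma binom_ratio_Suc:
  assumes "r \<le> m"
  shows "binom_ratio m (Suc r) = binom_ratio m r * ((real m - real r) / (real m + real r + 1))"
proof -
  have "Suc (m + r) * ((2 * m) choose Suc (m + r)) = (2 * m - (m + r)) * ((2 * m) choose (m + r))"
    unfolding binomial_absorption binomial_absorb_comp ..
  then have "real (Suc (m + r) * ((2 * m) choose Suc (m + r))) = real ((m - r) * ((2 * m) choose (m + r)))"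
    by (simp add: mult_2)
  then have "(real m + real r + 1) * real ((2 * m) choose Suc (m + r)) = (real m - real r) * real ((2 * m) choose (m + r))"
    using assms by (simp add: of_nat_diff algebra_simps)
  moreover have "real m + real r + 1 \<noteq> 0" by linarith
  ultimately have "real ((2 * m) choose Suc (m + r)) = (real m - real r) * real ((2 * m) choose (m + r)) / (real m + real r + 1)"
    by (metis nonzero_mult_div_cancel_left)
  then show ?thesis by (simp add: binom_ratio_def mult.commute)
qed

lemma binom_ratio_nonneg: "0 \<le> binom_ratio m r"
  by (simp add: binom_ratio_def)

text \<open>Successive ratios are 1 - (2r+1)/(m+r+1), at most exp(-(2r+1)/(m+R)), and the odd
  numbers add up to r^2. \<open>R\<close> freezes the denominator: R = r gives the bound that is
  sharp in the limit, R = m the uniform Gaussian one.\<close>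

lemma binom_ratio_le:
  assumes "r \<le> R" "R \<le> m" "0 < m"
  shows "binom_ratio m r \<le> exp (- (real r)\<^sup>2 / (real m + real R))"
  using assms
proof (induction r)
  case 0
  then show ?case by (simp add: binom_ratio_0)
next
  case (Suc r)
  have "(real m - real r) / (real m + real r + 1) = 1 + - ((2 * real r + 1) / (real m + real r + 1))"
    by (simp add: field_simps)
  also have "\<dots> \<le> exp (- ((2 * real r + 1) / (real m + real r + 1)))"
    by (rule exp_ge_add_one_self)
  also have "\<dots> \<le> exp (- ((2 * real r + 1) / (real m + real R)))"
    using Suc.prems by (simp add: divide_left_mono)
  finally have "binom_ratio m (Suc r) \<le> exp (- (real r)\<^sup>2 / (real m + real R)) * exp (- ((2 * real r + 1) / (real m + real R)))"
    using Suc unfolding binom_ratio_Suc[OF Suc_leD[OF le_trans[OF Suc.prems(1,2)]]]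
    by (intro mult_mono) auto
  also have "\<dots> = exp (- (real (Suc r))\<^sup>2 / (real m + real R))"
    by (simp add: exp_add[symmetric] power2_eq_square algebra_simps add_divide_distrib[symmetric] diff_divide_distrib[symmetric])
  finally show ?case .
qed

lemma binom_ratio_ge:
  assumes "r \<le> R" "R < m"
  shows "exp (- (real r)\<^sup>2 / (real m - real R)) \<le> binom_ratio m r"
  using assms
proof (induction r)
  case 0
  then show ?case by (simp add: binom_ratio_0)
next
  case (Suc r)
  have "(real m + real r + 1) / (real m - real r) = 1 + (2 * real r + 1) / (real m - real r)"
    using Suc.prems by (simp add: field_simps)
  also have "\<dots> \<le> exp ((2 * real r + 1) / (real m - real r))"
    by (rule exp_ge_add_one_self)
  also have "\<dots> \<le> exp ((2 * real r + 1) / (real m - real R))"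
    using Suc.prems by (simp add: divide_left_mono)
  finally have "inverse (exp ((2 * real r + 1) / (real m - real R))) \<le> inverse ((real m + real r + 1) / (real m - real r))"
    using Suc.prems by (intro le_imp_inverse_le) auto
  then have "exp (- ((2 * real r + 1) / (real m - real R))) \<le> (real m - real r) / (real m + real r + 1)"
    by (simp add: exp_minus)
  then have "exp (- (real r)\<^sup>2 / (real m - real R)) * exp (- ((2 * real r + 1) / (real m - real R))) \<le> binom_ratio m (Suc r)"
    using Suc unfolding binom_ratio_Suc[OF Suc_leD[OF le_trans[OF Suc.prems(1) less_imp_le[OF Suc.prems(2)]]]]
    by (intro mult_mono) (auto simp: binom_ratio_nonneg)
  moreover have "exp (- (real r)\<^sup>2 / (real m - real R)) * exp (- ((2 * real r + 1) / (real m - real R))) = exp (- (real (Suc r))\<^sup>2 / (real m - real R))"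
    by (simp add: exp_add[symmetric] power2_eq_square algebra_simps add_divide_distrib[symmetric] diff_divide_distrib[symmetric])
  ultimately show ?case by simp
qed

lemma binom_ratio_le_gaussian:
  assumes "0 < m"
  shows "binom_ratio m r \<le> exp (- (real r)\<^sup>2 / (2 * real m))"
proof (cases "r \<le> m")
  case True
  then show ?thesis using binom_ratio_le[OF True order_refl assms] by (simp only: mult_2)
qed (simp add: binom_ratio_def binomial_eq_0)

text \<open>Wallis' product in disguise: with a_m the central binomial coefficient over 4^m, its
  m-th partial product is 1/(a_m^2 (2m+1)).\<close>

lemma central_binomial_tendsto:
  "(\<lambda>m. 4 ^ m / (real ((2 * m) choose m) * sqrt (real m))) \<longlonglongrightarrow> sqrt pi"
proof -
  define a where "a = (\<lambda>m. real ((2 * m) choose m) / 4 ^ m)"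
  have apos: "a m > 0" for m by (simp add: a_def)
  have aS: "a (Suc m) = a m * ((2 * real m + 1) / (2 * real m + 2))" for m
  proof -
    define C' where "C' = (2 * Suc m) choose Suc m"
    define D where "D = Suc (2 * m) choose m"
    define C where "C = (2 * m) choose m"
    have "Suc (Suc (2 * m)) * D = C' * Suc m"
      using Suc_times_binomial_eq[of "Suc (2 * m)" m] by (simp add: C'_def D_def del: binomial_Suc_Suc)
    moreover have e: "Suc (2 * m) * C = D * Suc m"
      using Suc_times_binomial_eq[of "2 * m" m] binomial_symmetric[of "Suc m" "Suc (2 * m)"]
      by (simp add: C_def D_def mult_2 del: binomial_Suc_Suc)
    ultimately have "Suc m * (2 * (D * Suc m)) = Suc m * (Suc m * C')"
      by (simp add: algebra_simps)
    then have "Suc m * (2 * Suc (2 * m) * C) = Suc m * (Suc m * C')"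
      by (simp only: mult.assoc e)
    then have "real (2 * Suc (2 * m) * C) = real (Suc m * C')"
      by (simp only: mult_cancel1) simp
    then have "real C' = 2 * (2 * real m + 1) * real C / (real m + 1)"
      by (simp add: field_simps)
    moreover have "real m + 1 \<noteq> 0" by linarith
    ultimately have "real C' / 4 ^ Suc m = real C / 4 ^ m * ((2 * real m + 1) / (2 * real m + 2))"
      by (simp add: divide_simps) (simp add: algebra_simps)
    then show ?thesis by (simp only: a_def C'_def C_def)
  qed
  have w: "(\<Prod>k=1..m. (4 * real k^2) / (4 * real k^2 - 1)) = 1 / ((a m)\<^sup>2 * (2 * real m + 1))" for m
  proof (induction m)
    case 0
    show ?case by (simp add: a_def)
  next
    case (Suc m)
    have f: "4 * (real (Suc m))\<^sup>2 - 1 = (2 * real m + 1) * (2 * real m + 3)"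
       "2 * real (Suc m) + 1 = 2 * real m + 3" "4 * (real (Suc m))\<^sup>2 = (2 * real m + 2)\<^sup>2"
      by (simp_all add: power2_eq_square algebra_simps)
    have nz: "2 * real m + 1 \<noteq> 0" "2 * real m + 2 \<noteq> 0" "2 * real m + 3 \<noteq> 0" by linarith+
    have "(\<Prod>k=1..Suc m. (4 * real k^2) / (4 * real k^2 - 1)) =
        1 / ((a m)\<^sup>2 * (2 * real m + 1)) * ((2 * real m + 2)\<^sup>2 / ((2 * real m + 1) * (2 * real m + 3)))"
      using Suc f by simp
    also have "\<dots> = 1 / ((a m * ((2 * real m + 1) / (2 * real m + 2)))\<^sup>2 * (2 * real m + 3))"
      using nz apos[of m] by (simp add: power2_eq_square)
    finally show ?case unfolding aS f .
  qed
  have "(\<lambda>m. 1 / ((a m)\<^sup>2 * (2 * real m + 1))) \<longlonglongrightarrow> pi / 2"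
    using wallis unfolding w .
  moreover have "(\<lambda>m. (2 * real m + 1) / real m) \<longlonglongrightarrow> 2" by real_asymp
  ultimately have "(\<lambda>m. (1 / ((a m)\<^sup>2 * (2 * real m + 1))) * ((2 * real m + 1) / real m)) \<longlonglongrightarrow> pi / 2 * 2"
    by (rule tendsto_mult)
  from tendsto_real_sqrt[OF this]
  have "(\<lambda>m. sqrt ((1 / ((a m)\<^sup>2 * (2 * real m + 1))) * ((2 * real m + 1) / real m))) \<longlonglongrightarrow> sqrt pi"
    by simp
  moreover have "sqrt ((1 / ((a m)\<^sup>2 * (2 * real m + 1))) * ((2 * real m + 1) / real m)) =
      4 ^ m / (real ((2 * m) choose m) * sqrt (real m))" for m
  proof -
    have "2 * real m + 1 \<noteq> 0" by linarith
    then have "(1 / ((a m)\<^sup>2 * (2 * real m + 1))) * ((2 * real m + 1) / real m) = 1 / ((a m)\<^sup>2 * real m)"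
      by simp
    then have "sqrt ((1 / ((a m)\<^sup>2 * (2 * real m + 1))) * ((2 * real m + 1) / real m)) = 1 / (a m * sqrt (real m))"
      using apos[of m] by (simp add: real_sqrt_divide real_sqrt_mult)
    also have "\<dots> = 4 ^ m / (real ((2 * m) choose m) * sqrt (real m))"
      by (simp add: a_def)
    finally show ?thesis .
  qed
  ultimately show ?thesis by simp
qed

section \<open>Polya's finite identity\<close>

lemma cos_power_binomial:
  "(2 * cos x) ^ (2 * m) = real ((2 * m) choose m) + 2 * (\<Sum>j\<in>{1..m}. real ((2 * m) choose (m + j)) * cos (2 * real j * x))"
proof -
  define f where "f = (\<lambda>r. complex_of_real (real ((2 * m) choose r)) * cis ((2 * real r - 2 * real m) * x))"
  have "complex_of_real ((2 * cos x) ^ (2 * m)) = (cis x + cis (- x)) ^ (2 * m)"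
    by (simp add: complex_eq_iff cis.ctr Complex_eq flip: of_real_power of_real_mult)
  also have "\<dots> = (\<Sum>r\<le>2 * m. of_nat ((2 * m) choose r) * cis x ^ r * cis (- x) ^ (2 * m - r))"
    by (rule binomial_ring)
  also have "\<dots> = (\<Sum>r\<le>2 * m. f r)"
  proof (rule sum.cong)
    fix r assume "r \<in> {..2 * m}"
    then have "cis x ^ r * cis (- x) ^ (2 * m - r) = cis ((2 * real r - 2 * real m) * x)"
      unfolding Complex.DeMoivre cis_mult
      by (intro arg_cong[where f = cis]) (simp add: of_nat_diff algebra_simps)
    then show "of_nat ((2 * m) choose r) * cis x ^ r * cis (- x) ^ (2 * m - r) = f r"
      by (simp add: f_def mult.assoc)
  qed simp
  finally have eq: "complex_of_real ((2 * cos x) ^ (2 * m)) = (\<Sum>r\<le>2 * m. f r)" .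
  have "(2 * cos x) ^ (2 * m) = Re (complex_of_real ((2 * cos x) ^ (2 * m)))" by simp
  also have "\<dots> = (\<Sum>r\<le>2 * m. real ((2 * m) choose r) * cos ((2 * real r - 2 * real m) * x))"
    unfolding eq f_def by (simp add: Re_sum)
  also have "{..2 * m} = {..<m} \<union> {m} \<union> {m + 1..2 * m}" by auto
  also have "(\<Sum>r\<in>\<dots>. real ((2 * m) choose r) * cos ((2 * real r - 2 * real m) * x)) =
     (\<Sum>r<m. real ((2 * m) choose r) * cos ((2 * real r - 2 * real m) * x)) + real ((2 * m) choose m) +
     (\<Sum>r\<in>{m+1..2*m}. real ((2 * m) choose r) * cos ((2 * real r - 2 * real m) * x))"
    by (subst sum.union_disjoint, simp, simp, force)+ simp
  also have "(\<Sum>r\<in>{m+1..2*m}. real ((2 * m) choose r) * cos ((2 * real r - 2 * real m) * x)) =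
     (\<Sum>j\<in>{1..m}. real ((2 * m) choose (m + j)) * cos (2 * real j * x))"
    by (rule sum.reindex_bij_witness[where i = "\<lambda>j. m + j" and j = "\<lambda>r. r - m"]) (auto simp: of_nat_diff algebra_simps)
  also have "(\<Sum>r<m. real ((2 * m) choose r) * cos ((2 * real r - 2 * real m) * x)) =
     (\<Sum>j\<in>{1..m}. real ((2 * m) choose (m + j)) * cos (2 * real j * x))"
  proof (rule sum.reindex_bij_witness[where i = "\<lambda>j. m - j" and j = "\<lambda>r. m - r"])
    fix r assume "r \<in> {..<m}"
    then have "r < m" by simp
    have "(2 * m) choose (m + (m - r)) = (2 * m) choose r"
      using \<open>r < m\<close> binomial_symmetric[of r "2 * m"] by (simp add: mult_2)
    moreover have "cos (2 * real (m - r) * x) = cos ((2 * real r - 2 * real m) * x)"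
    proof -
      have "2 * real (m - r) * x = - ((2 * real r - 2 * real m) * x)"
        using \<open>r < m\<close> by (simp add: of_nat_diff algebra_simps)
      then show ?thesis by (simp only: cos_minus)
    qed
    ultimately show "real ((2 * m) choose (m + (m - r))) * cos (2 * real (m - r) * x) =
       real ((2 * m) choose r) * cos ((2 * real r - 2 * real m) * x)" by simp
  qed auto
  finally show ?thesis by simp
qed

text \<open>A roots-of-unity filter at 2L equally spaced points of (0, \<pi>). They are odd
  multiples of \<pi>/(4L): the half-step shift leaves the sign (-1)^(j/(2L)) on the surviving
  frequencies and so leads to the alternating theta series.\<close>

lemma sum_cos_odd_multiples:
  assumes "0 < L"
  shows "(\<Sum>k<2 * L. cos (2 * real j * (pi * (2 * real k + 1) / (4 * real L)))) =
    (if 2 * L dvd j then 2 * real L * (-1) ^ (j div (2 * L)) else 0)"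
proof -
  define w where "w = cis (pi * real j / real L)"
  define c where "c = cis (pi * real j / (2 * real L))"
  have e: "cis (2 * real j * (pi * (2 * real k + 1) / (4 * real L))) = c * w ^ k" for k
    using assms unfolding c_def w_def Complex.DeMoivre cis_mult by (intro arg_cong[where f = cis]) (simp add: field_simps)
  have "(\<Sum>k<2 * L. cos (2 * real j * (pi * (2 * real k + 1) / (4 * real L)))) =
     Re (\<Sum>k<2 * L. cis (2 * real j * (pi * (2 * real k + 1) / (4 * real L))))"
    by (simp add: Re_sum)
  also have "\<dots> = Re (c * (\<Sum>k<2 * L. w ^ k))"
    unfolding e by (simp add: sum_distrib_left)
  also have "\<dots> = (if 2 * L dvd j then 2 * real L * (-1) ^ (j div (2 * L)) else 0)"
  proof (cases "2 * L dvd j")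
    case True
    then obtain l where l: "j = 2 * L * l" by (auto simp: dvd_def)
    have "w = cis (2 * pi * of_int (int l))"
      unfolding w_def by (rule arg_cong[where f = cis]) (use assms l in simp)
    then have "w = 1" by (simp only: cis_multiple_2pi Ints_of_int)
    have "c = cis (real l * pi)" using assms by (simp add: c_def l mult.commute)
    then have "c = (-1) ^ l" by (simp flip: Complex.DeMoivre)
    have "complex_of_real ((-1) ^ l) = (-1) ^ l" by simp
    then have "Re ((-1) ^ l) = (-1) ^ l" by (metis Re_complex_of_real)
    then show ?thesis using \<open>c = (-1) ^ l\<close> \<open>w = 1\<close> True assms l by (simp add: mult.commute)
  next
    case False
    have "w \<noteq> 1"
    proof
      assume "w = 1"
      then have "cos (pi * real j / real L) = 1" by (metis w_def cis.sel(1) one_complex.sel(1))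
      then obtain i :: int where "pi * real j / real L = of_int i * 2 * pi"
        using cos_one_2pi_int by (metis mult.assoc)
      then have "real j = of_int i * 2 * real L" using assms by (simp add: field_simps)
      then have "real_of_int (int j) = real_of_int (i * 2 * int L)" by simp
      then have "int j = i * 2 * int L" by (simp only: of_int_eq_iff)
      then have "int (2 * L) dvd int j" by simp
      then show False using False by (simp only: int_dvd_int_iff)
    qed
    have "w ^ (2 * L) = cis (2 * pi * of_int (int j))"
      using assms unfolding w_def Complex.DeMoivre by (intro arg_cong[where f = cis]) (simp add: field_simps)
    then have "w ^ (2 * L) = 1" by (simp only: cis_multiple_2pi Ints_of_int)
    then have "(\<Sum>k<2 * L. w ^ k) = 0"
      using geometric_sum[OF \<open>w \<noteq> 1\<close>] by simp
    then show ?thesis using False by simp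
  qed
  finally show ?thesis .
qed

text \<open>Averaging \<open>cos_power_binomial\<close> over these points kills all frequencies but
  the multiples of 2L. After division by the central binomial coefficient, a discrete alternating
  theta series faces a sum of powers of cosines: the two sides of the modular transformation before
  the limit.\<close>

lemma polya_identity:
  assumes "0 < L"
  shows "(\<lambda>l. (-1) ^ Suc l * binom_ratio m (2 * L * Suc l)) sums
    ((4 ^ m / (real ((2 * m) choose m) * real L) * (\<Sum>k<L. cos (pi * (2 * real k + 1) / (4 * real L)) ^ (2 * m)) - 1) / 2)"
proof -
  define x where "x = (\<lambda>k. pi * (2 * real k + 1) / (4 * real L))"
  define B where "B = real ((2 * m) choose m)"
  have B: "B > 0" by (simp add: B_def)
  \<comment> \<open>The reflection x to \<pi> - x folds the 2L points onto the first L, which lie in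
    (0, \<pi>/2), where the bounds for powers of the cosine apply.\<close>
  have half: "(\<Sum>k<2 * L. cos (x k) ^ (2 * m)) = 2 * (\<Sum>k<L. cos (x k) ^ (2 * m))"
  proof -
    have "{..<2 * L} = {..<L} \<union> {L..<2 * L}" by auto
    then have "(\<Sum>k<2 * L. cos (x k) ^ (2 * m)) = (\<Sum>k<L. cos (x k) ^ (2 * m)) + (\<Sum>k\<in>{L..<2*L}. cos (x k) ^ (2 * m))"
      by (simp add: sum.union_disjoint ivl_disj_int)
    also have "(\<Sum>k\<in>{L..<2*L}. cos (x k) ^ (2 * m)) = (\<Sum>k<L. cos (x k) ^ (2 * m))"
    proof (rule sum.reindex_bij_witness[where i = "\<lambda>k. 2 * L - 1 - k" and j = "\<lambda>k. 2 * L - 1 - k"])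
      fix k assume "k \<in> {L..<2 * L}"
      then have "real (2 * L - 1 - k) = 2 * real L - 1 - real k"
        by (simp add: of_nat_diff)
      then have "x (2 * L - 1 - k) = pi - x k" using assms by (simp add: x_def field_simps)
      then show "cos (x (2 * L - 1 - k)) ^ (2 * m) = cos (x k) ^ (2 * m)" by simp
    qed auto
    finally show ?thesis by simp
  qed
  define h where "h = (\<lambda>j. if 2 * L dvd j then 2 * real L * (-1) ^ (j div (2 * L)) else (0::real))"
  have "4 ^ m * (2 * (\<Sum>k<L. cos (x k) ^ (2 * m))) = (\<Sum>k<2 * L. (2 * cos (x k)) ^ (2 * m))"
    unfolding half[symmetric] by (simp add: sum_distrib_left power_mult_distrib power_mult)
  also have "\<dots> = (\<Sum>k<2 * L. B + 2 * (\<Sum>j\<in>{1..m}. real ((2 * m) choose (m + j)) * cos (2 * real j * x k)))"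
    unfolding cos_power_binomial B_def ..
  also have "\<dots> = 2 * real L * B + 2 * (\<Sum>k<2*L. \<Sum>j\<in>{1..m}. real ((2 * m) choose (m + j)) * cos (2 * real j * x k))"
    by (simp add: sum.distrib sum_distrib_left)
  also have "(\<Sum>k<2*L. \<Sum>j\<in>{1..m}. real ((2 * m) choose (m + j)) * cos (2 * real j * x k)) =
     (\<Sum>j\<in>{1..m}. real ((2 * m) choose (m + j)) * h j)"
    by (subst sum.swap) (simp only: sum_distrib_left[symmetric] h_def sum_cos_odd_multiples[OF assms] x_def)
  also have "(\<Sum>j\<in>{1..m}. real ((2 * m) choose (m + j)) * h j) = B * (\<Sum>j\<in>{1..m}. binom_ratio m j * h j)"
    using B by (simp add: binom_ratio_def B_def sum_distrib_left)
  finally have eq: "4 ^ m * (2 * (\<Sum>k<L. cos (x k) ^ (2 * m))) = 2 * real L * B + 2 * (B * (\<Sum>j\<in>{1..m}. binom_ratio m j * h j))" .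
  \<comment> \<open>The value at 0 is set to 0 so that reindexing by j = 2L(l+1) skips only zeros;
    the series is finite because \<open>binom_ratio m j\<close> vanishes for j > m.\<close>
  define f where "f = (\<lambda>j. if j = 0 then 0 else binom_ratio m j * h j / (2 * real L))"
  have "f sums (\<Sum>j\<in>{1..m}. f j)"
    by (rule sums_finite) (auto simp: f_def binom_ratio_def)
  also have "(\<Sum>j\<in>{1..m}. f j) = (\<Sum>j\<in>{1..m}. binom_ratio m j * h j) / (2 * real L)"
    by (auto simp: f_def sum_divide_distrib intro!: sum.cong)
  also have "\<dots> = (4 ^ m / (B * real L) * (\<Sum>k<L. cos (x k) ^ (2 * m)) - 1) / 2"
    using eq B assms by (simp add: field_simps)
  finally have "f sums ((4 ^ m / (B * real L) * (\<Sum>k<L. cos (x k) ^ (2 * m)) - 1) / 2)" .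
  moreover have "(\<lambda>l. f (2 * L * Suc l)) sums c \<longleftrightarrow> f sums c" for c
  proof (rule sums_mono_reindex)
    show "strict_mono (\<lambda>l. 2 * L * Suc l)" using assms by (auto simp: strict_mono_def)
    fix n assume n: "n \<notin> range (\<lambda>l. 2 * L * Suc l)"
    show "f n = 0"
    proof (rule ccontr)
      assume "f n \<noteq> 0"
      then have "n \<noteq> 0" "2 * L dvd n" by (auto simp: f_def h_def split: if_splits)
      then obtain l where "n = 2 * L * l" "l \<noteq> 0" by (auto simp: dvd_def)
      then have "n = 2 * L * Suc (l - 1)" by simp
      then show False using n by blast
    qed
  qed
  moreover have "f (2 * L * Suc l) = (-1) ^ Suc l * binom_ratio m (2 * L * Suc l)" for l
  proof -
    have "2 * L * Suc l div (2 * L) = Suc l" using assms by (intro nonzero_mult_div_cancel_left) auto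
    then show ?thesis using assms by (simp add: f_def h_def del: mult_Suc_right power_Suc)
  qed
  ultimately show ?thesis by (simp add: x_def B_def)
qed

section \<open>Passage to the limit in Polya's identity\<close>

lemma sin_ge_half:
  fixes x :: real
  assumes "0 \<le> x" "x \<le> pi / 2"
  shows "x / 2 \<le> sin x"
proof -
  have "\<bar>sin x - (\<Sum>m<3. sin_coeff m * x ^ m)\<bar> \<le> inverse (fact 3) * \<bar>x\<bar> ^ 3"
    by (rule Maclaurin_sin_bound)
  then have "\<bar>sin x - x\<bar> * 6 \<le> x * x\<^sup>2"
    using assms by (simp add: sin_coeff_def eval_nat_numeral)
  also have "x * x\<^sup>2 \<le> x * 3"
  proof (intro mult_left_mono)
    \<comment> \<open>As 1.6^2 < 3, the Taylor remainder x^3/6 is at most x/2.\<close>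
    have "x \<le> 1.6" using assms pi_approx by simp
    then have "x\<^sup>2 \<le> 1.6\<^sup>2" using assms by (intro power_mono) auto
    then show "x\<^sup>2 \<le> 3" by (simp add: power2_eq_square)
  qed (use assms in auto)
  finally have "\<bar>sin x - x\<bar> \<le> x / 2" by simp
  then show ?thesis unfolding abs_le_iff by linarith
qed

text \<open>Both bounds are 1 + u \<le> exp u, applied to cos^2 = 1 - sin^2 and to 1/cos^2 = 1 +
  tan^2. For x of order 1/L and m of order L^2 they have the same limit.\<close>

lemma cos_power_bounds:
  fixes x :: real
  assumes "0 \<le> x" "x < pi / 2"
  shows "exp (- (real m * (tan x)\<^sup>2)) \<le> cos x ^ (2 * m)" "cos x ^ (2 * m) \<le> exp (- (real m * (sin x)\<^sup>2))"
proof -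
  have c: "cos x > 0" using assms by (intro cos_gt_zero_pi) auto
  have "(cos x)\<^sup>2 = 1 + - (sin x)\<^sup>2" by (simp add: cos_squared_eq)
  also have "\<dots> \<le> exp (- (sin x)\<^sup>2)" by (rule exp_ge_add_one_self)
  finally have "((cos x)\<^sup>2) ^ m \<le> exp (- (sin x)\<^sup>2) ^ m" by (intro power_mono) auto
  then show "cos x ^ (2 * m) \<le> exp (- (real m * (sin x)\<^sup>2))"
    by (simp add: power_mult exp_of_nat_mult[symmetric])
  have "inverse ((cos x)\<^sup>2) = 1 + (tan x)\<^sup>2"
    using c tan_sec[of x] by (simp add: power_inverse)
  also have "\<dots> \<le> exp ((tan x)\<^sup>2)" by (rule exp_ge_add_one_self)
  finally have "inverse (exp ((tan x)\<^sup>2)) \<le> inverse (inverse ((cos x)\<^sup>2))"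
    using c by (intro le_imp_inverse_le) auto
  then have "exp (- (tan x)\<^sup>2) \<le> (cos x)\<^sup>2"
    by (simp add: exp_minus)
  then have "exp (- (tan x)\<^sup>2) ^ m \<le> ((cos x)\<^sup>2) ^ m"
    by (intro power_mono) auto
  then show "exp (- (real m * (tan x)\<^sup>2)) \<le> cos x ^ (2 * m)"
    by (simp add: power_mult exp_of_nat_mult[symmetric])
qed

lemma summable_gaussian:
  fixes a :: real
  assumes "0 < a" "\<And>k. real k \<le> f k"
  shows "summable (\<lambda>k. exp (- (a * (f k)\<^sup>2)))"
proof (rule summable_comparison_test)
  show "summable (\<lambda>k. exp (- a) ^ k)"
    using assms by (intro summable_geometric) auto
  have "exp (- (a * (f k)\<^sup>2)) \<le> exp (- a) ^ k" for k
  proof -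
    have "real k \<le> (real k)\<^sup>2" by (simp add: power2_eq_square flip: of_nat_mult)
    also have "\<dots> \<le> (f k)\<^sup>2" using assms by (intro power_mono) auto
    finally show ?thesis using assms by (simp add: exp_of_nat_mult[symmetric] mult.commute)
  qed
  then show "\<exists>N. \<forall>k\<ge>N. norm (exp (- (a * (f k)\<^sup>2))) \<le> exp (- a) ^ k" by auto
qed

text \<open>Brings a domination that holds for all terms at once into the product-filter form
  expected by \<open>tannerys_theorem\<close>.\<close>

lemma eventually_prod_uniform:
  assumes "\<forall>\<^sub>F y in G. \<forall>x. P x y"
  shows "\<forall>\<^sub>F (x, y) in F \<times>\<^sub>F G. P x y"
  using eventually_prodI[OF eventually_True[of F] assms] by (rule eventually_mono) auto

text \<open>Limit of \<open>polya_identity\<close> with m close to c L^2. On the left (2L(l+1))^2/m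
  tends to 4(l+1)^2/c; on the right m times the square of the k-th point tends to c \<pi>^2
  (2k+1)^2/16; by Wallis the prefactor tends to sqrt(\<pi>c). The choice c = 4/(\<pi>s) turns these
  into \<pi>s(l+1)^2, \<pi>(2k+1)^2/(4s) and 2/sqrt s.\<close>

theorem theta4_modular_transformation:
  fixes s :: real
  assumes s: "0 < s"
  shows "(\<lambda>j. (-1) ^ Suc j * exp (- (pi * s * (real (Suc j))\<^sup>2))) sums
    ((2 / sqrt s * (\<Sum>k. exp (- (pi * (2 * real k + 1)\<^sup>2 / (4 * s)))) - 1) / 2)"
proof -
  define c where "c = 4 / (pi * s)"
  have c: "c > 0" using s by (simp add: c_def)
  define m where "m = (\<lambda>L. nat \<lfloor>c * (real L)\<^sup>2\<rfloor>)"
  have m1: "real (m L) \<le> c * (real L)\<^sup>2" and m2: "c * (real L)\<^sup>2 - 1 < real (m L)" for L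
  proof -
    have "0 \<le> c * (real L)\<^sup>2" using c by simp
    then show "real (m L) \<le> c * (real L)\<^sup>2" "c * (real L)\<^sup>2 - 1 < real (m L)"
      unfolding m_def by linarith+
  qed
  have mlim: "(\<lambda>L. real (m L) / (real L)\<^sup>2) \<longlonglongrightarrow> c"
  proof (rule tendsto_sandwich)
    show "(\<lambda>L. c - 1 / (real L)\<^sup>2) \<longlonglongrightarrow> c" by real_asymp
    show "(\<lambda>L. c) \<longlonglongrightarrow> c" by simp
    show "\<forall>\<^sub>F L in sequentially. c - 1 / (real L)\<^sup>2 \<le> real (m L) / (real L)\<^sup>2"
      using eventually_gt_at_top[of 0]
    proof eventually_elim
      case (elim L)
      then have "c - 1 / (real L)\<^sup>2 = (c * (real L)\<^sup>2 - 1) / (real L)\<^sup>2" by (simp add: diff_divide_distrib)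
      also have "\<dots> \<le> real (m L) / (real L)\<^sup>2" using m2[of L] by (intro divide_right_mono) auto
      finally show ?case .
    qed
    show "\<forall>\<^sub>F L in sequentially. real (m L) / (real L)\<^sup>2 \<le> c"
      using eventually_gt_at_top[of 0]
    proof eventually_elim
      case (elim L)
      then show ?case using m1[of L] by (simp add: field_simps)
    qed
  qed
  have minf: "filterlim m at_top sequentially"
  proof -
    have "filterlim (\<lambda>L. c * (real L)\<^sup>2 - 1) at_top sequentially" using c by real_asymp
    then have "filterlim (\<lambda>L. real (m L)) at_top sequentially"
      by (rule filterlim_at_top_mono) (use m2 in \<open>auto intro!: always_eventually less_imp_le\<close>)
    then show ?thesis by (simp add: filterlim_sequentially_iff_filterlim_real)
  qed
  have mpos: "\<forall>\<^sub>F L in sequentially. 0 < m L"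
    using minf by (auto simp: filterlim_at_top Suc_le_eq dest: spec[of _ 1])
  \<comment> \<open>Majorant for the left side: \<open>binom_ratio_le_gaussian\<close> has 2m in the
    denominator, which halves the limiting rate.\<close>
  define M where "M = (\<lambda>l. exp (- (pi * s / 2 * (real (Suc l))\<^sup>2)))"
  have lhs: "(\<lambda>L. \<Sum>l. (-1) ^ Suc l * binom_ratio (m L) (2 * L * Suc l)) \<longlonglongrightarrow>
      (\<Sum>l. (-1) ^ Suc l * exp (- (pi * s * (real (Suc l))\<^sup>2)))"
  proof (rule tannerys_theorem[THEN conjunct2, THEN conjunct2])
    show "summable M" unfolding M_def using s by (intro summable_gaussian) auto
    have "\<forall>\<^sub>F L in sequentially. \<forall>l. norm ((-1) ^ Suc l * binom_ratio (m L) (2 * L * Suc l)) \<le> M l"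
      using mpos
    proof eventually_elim
      case (elim L)
      show ?case
      proof
        fix l
        have "binom_ratio (m L) (2 * L * Suc l) \<le> exp (- (real (2 * L * Suc l))\<^sup>2 / (2 * real (m L)))"
          using elim by (rule binom_ratio_le_gaussian)
        also have "(pi * s / 2 * (real (Suc l))\<^sup>2) \<le> (real (2 * L * Suc l))\<^sup>2 / (2 * real (m L))"
        proof -
          have "pi * s * real (m L) \<le> pi * s * (c * (real L)\<^sup>2)"
            using s by (intro mult_left_mono m1) auto
          then have "pi * s * real (m L) \<le> 4 * (real L)\<^sup>2" using s by (simp add: c_def)
          then have "(pi * s * real (m L)) * (real (Suc l))\<^sup>2 \<le> (4 * (real L)\<^sup>2) * (real (Suc l))\<^sup>2"
            by (intro mult_right_mono) auto
          moreover have "(real (2 * L * Suc l))\<^sup>2 = (4 * (real L)\<^sup>2) * (real (Suc l))\<^sup>2"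
            by (simp only: of_nat_mult power_mult_distrib) simp
          moreover have "(pi * s / 2 * (real (Suc l))\<^sup>2) * (2 * real (m L)) = (pi * s * real (m L)) * (real (Suc l))\<^sup>2"
            by simp
          ultimately have "(pi * s / 2 * (real (Suc l))\<^sup>2) * (2 * real (m L)) \<le> (real (2 * L * Suc l))\<^sup>2"
            by simp
          then show ?thesis using elim by (simp add: pos_le_divide_eq del: of_nat_Suc)
        qed
        then have "exp (- (real (2 * L * Suc l))\<^sup>2 / (2 * real (m L))) \<le> M l" by (simp add: M_def)
        finally show "norm ((-1) ^ Suc l * binom_ratio (m L) (2 * L * Suc l)) \<le> M l"
          by (simp add: abs_mult power_abs binom_ratio_nonneg)
      qed
    qed
    then show "\<forall>\<^sub>F (l, L) in at_top \<times>\<^sub>F sequentially. norm ((-1) ^ Suc l * binom_ratio (m L) (2 * L * Suc l)) \<le> M l"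
      by (rule eventually_prod_uniform)
    fix l
    define r where "r = 2 * real (Suc l)"
    have rL: "real (2 * L * Suc l) = r * real L" for L by (simp add: r_def algebra_simps)
    have i0: "(\<lambda>L. r / real L) \<longlonglongrightarrow> 0" by real_asymp
    have "(\<lambda>L. binom_ratio (m L) (2 * L * Suc l)) \<longlonglongrightarrow> exp (- (pi * s * (real (Suc l))\<^sup>2))"
    proof (rule tendsto_sandwich)
      have "(\<lambda>L. real (m L) / (real L)\<^sup>2 - r / real L) \<longlonglongrightarrow> c - 0"
        by (intro tendsto_diff mlim i0)
      then have "\<forall>\<^sub>F L in sequentially. real (m L) / (real L)\<^sup>2 - r / real L > 0"
        using c order_tendstoD(1) by fastforce
      then have ev: "\<forall>\<^sub>F L in sequentially. 2 * L * Suc l < m L"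
        using eventually_gt_at_top[of 0]
      proof eventually_elim
        case (elim L)
        then have "r * real L < real (m L)" by (simp add: field_simps power2_eq_square)
        then have "real (2 * L * Suc l) < real (m L)" unfolding rL .
        then show ?case by (simp only: of_nat_less_iff)
      qed
      have e: "r\<^sup>2 / c = pi * s * (real (Suc l))\<^sup>2"
        using s unfolding r_def c_def power_mult_distrib by simp
      show "\<forall>\<^sub>F L in sequentially. exp (- (r\<^sup>2 / (real (m L) / (real L)\<^sup>2 - r / real L))) \<le> binom_ratio (m L) (2 * L * Suc l)"
        using ev eventually_gt_at_top[of 0]
      proof eventually_elim
        case (elim L)
        have "r\<^sup>2 / (real (m L) / (real L)\<^sup>2 - r / real L) = (real (2 * L * Suc l))\<^sup>2 / (real (m L) - real (2 * L * Suc l))"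
        proof -
          have "real (m L) / (real L)\<^sup>2 - r / real L = (real (m L) - real (2 * L * Suc l)) / (real L)\<^sup>2"
            unfolding rL using elim(2) by (simp add: power2_eq_square diff_divide_distrib)
          then show ?thesis unfolding rL by (simp add: power_mult_distrib)
        qed
        then show ?case using binom_ratio_ge[OF order_refl elim(1)]
          by (simp only: minus_divide_left[symmetric])
      qed
      show "\<forall>\<^sub>F L in sequentially. binom_ratio (m L) (2 * L * Suc l) \<le> exp (- (r\<^sup>2 / (real (m L) / (real L)\<^sup>2 + r / real L)))"
        using ev eventually_gt_at_top[of 0]
      proof eventually_elim
        case (elim L)
        have "r\<^sup>2 / (real (m L) / (real L)\<^sup>2 + r / real L) = (real (2 * L * Suc l))\<^sup>2 / (real (m L) + real (2 * L * Suc l))"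
        proof -
          have "real (m L) / (real L)\<^sup>2 + r / real L = (real (m L) + real (2 * L * Suc l)) / (real L)\<^sup>2"
            unfolding rL using elim(2) by (simp add: power2_eq_square add_divide_distrib)
          then show ?thesis unfolding rL by (simp add: power_mult_distrib)
        qed
        moreover have "2 * L * Suc l \<le> m L" "0 < m L" using elim(1) by simp_all
        ultimately show ?case using binom_ratio_le[OF order_refl, of "2 * L * Suc l" "m L"]
          by (simp only: minus_divide_left[symmetric])
      qed
      show "(\<lambda>L. exp (- (r\<^sup>2 / (real (m L) / (real L)\<^sup>2 - r / real L)))) \<longlonglongrightarrow> exp (- (pi * s * (real (Suc l))\<^sup>2))"
        using tendsto_exp[OF tendsto_minus[OF tendsto_divide[OF tendsto_const[of "r\<^sup>2"] tendsto_diff[OF mlim i0]]]] c e by simp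
      show "(\<lambda>L. exp (- (r\<^sup>2 / (real (m L) / (real L)\<^sup>2 + r / real L)))) \<longlonglongrightarrow> exp (- (pi * s * (real (Suc l))\<^sup>2))"
        using tendsto_exp[OF tendsto_minus[OF tendsto_divide[OF tendsto_const[of "r\<^sup>2"] tendsto_add[OF mlim i0]]]] c e by simp
    qed
    then show "(\<lambda>L. (-1) ^ Suc l * binom_ratio (m L) (2 * L * Suc l)) \<longlonglongrightarrow> (-1) ^ Suc l * exp (- (pi * s * (real (Suc l))\<^sup>2))"
      by (intro tendsto_mult tendsto_const)
  qed simp
  define x where "x = (\<lambda>L k. pi * (2 * real k + 1) / (4 * real L))"
  define f where "f = (\<lambda>L k. if k < L then cos (x L k) ^ (2 * m L) else 0)"
  \<comment> \<open>Majorant for the right side: sin x \<ge> x/2 costs a factor 4, and m > c L^2/2 a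
    factor 2, against the limiting rate c \<pi>^2/16.\<close>
  define M' where "M' = (\<lambda>k. exp (- (c * pi\<^sup>2 / 128 * (2 * real k + 1)\<^sup>2)))"
  have xb: "0 \<le> x L k" "x L k < pi / 2" if "k < L" for L k
  proof -
    have "2 * real k + 1 < 2 * real L" using that by linarith
    then have "pi * (2 * real k + 1) < pi / 2 * (4 * real L)" by simp
    then show "0 \<le> x L k" "x L k < pi / 2" using that by (simp_all add: x_def pos_divide_less_eq)
  qed
  have mhalf: "\<forall>\<^sub>F L in sequentially. c / 2 < real (m L) / (real L)\<^sup>2"
    using order_tendstoD(1)[OF mlim, of "c / 2"] c by simp
  have rhs: "(\<lambda>L. \<Sum>k. f L k) \<longlonglongrightarrow> (\<Sum>k. exp (- (pi * (2 * real k + 1)\<^sup>2 / (4 * s))))"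
  proof (rule tannerys_theorem[THEN conjunct2, THEN conjunct2])
    show "summable M'" unfolding M'_def using c by (intro summable_gaussian) auto
    have "\<forall>\<^sub>F L in sequentially. \<forall>k. norm (f L k) \<le> M' k"
      using mhalf eventually_gt_at_top[of 0]
    proof eventually_elim
      case (elim L)
      show ?case
      proof
        fix k
        show "norm (f L k) \<le> M' k"
        proof (cases "k < L")
          case True
          note xx = xb[OF True]
          have "cos (x L k) \<ge> 0" using xx by (intro cos_ge_zero) auto
          then have "norm (f L k) = cos (x L k) ^ (2 * m L)" using True by (simp add: f_def)
          also have "\<dots> \<le> exp (- (real (m L) * (sin (x L k))\<^sup>2))"
            using xx by (intro cos_power_bounds) auto
          also have "c * pi\<^sup>2 / 128 * (2 * real k + 1)\<^sup>2 \<le> real (m L) * (sin (x L k))\<^sup>2"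
          proof -
            have "(x L k / 2)\<^sup>2 \<le> (sin (x L k))\<^sup>2"
              using xx sin_ge_half[of "x L k"] by (intro power_mono) auto
            then have "(c / 2 * (real L)\<^sup>2) * (x L k / 2)\<^sup>2 \<le> real (m L) * (sin (x L k))\<^sup>2"
              using elim c by (intro mult_mono) (auto simp: field_simps)
            moreover have "(c / 2 * (real L)\<^sup>2) * (x L k / 2)\<^sup>2 = c * pi\<^sup>2 / 128 * (2 * real k + 1)\<^sup>2"
              using elim by (simp add: x_def power_divide power_mult_distrib)
            ultimately show ?thesis by (simp only:)
          qed
          then have "exp (- (real (m L) * (sin (x L k))\<^sup>2)) \<le> M' k" by (simp add: M'_def)
          finally show ?thesis .
        qed (simp add: f_def M'_def)
      qed
    qed
    then show "\<forall>\<^sub>F (k, L) in at_top \<times>\<^sub>F sequentially. norm (f L k) \<le> M' k"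
      by (rule eventually_prod_uniform)
    fix k
    define a where "a = pi * (2 * real k + 1) / 4"
    have xa: "x L k = a / real L" for L by (simp add: x_def a_def)
    have e: "c * a\<^sup>2 = pi * (2 * real k + 1)\<^sup>2 / (4 * s)"
      using s by (simp add: c_def a_def power_divide power_mult_distrib) (simp add: power2_eq_square)
    have s1: "(\<lambda>L. real L * sin (a / real L)) \<longlonglongrightarrow> a" by real_asymp
    have t1: "(\<lambda>L. real L * tan (a / real L)) \<longlonglongrightarrow> a" by real_asymp
    show "(\<lambda>L. f L k) \<longlonglongrightarrow> exp (- (pi * (2 * real k + 1)\<^sup>2 / (4 * s)))"
    proof (rule tendsto_sandwich)
      show "\<forall>\<^sub>F L in sequentially. exp (- (real (m L) / (real L)\<^sup>2 * (real L * tan (a / real L))\<^sup>2)) \<le> f L k"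
        using eventually_gt_at_top[of k]
      proof eventually_elim
        case (elim L)
        then show ?case using cos_power_bounds(1)[OF xb[OF elim], of "m L"]
          by (simp add: f_def xa[symmetric] power_mult_distrib)
      qed
      show "\<forall>\<^sub>F L in sequentially. f L k \<le> exp (- (real (m L) / (real L)\<^sup>2 * (real L * sin (a / real L))\<^sup>2))"
        using eventually_gt_at_top[of k]
      proof eventually_elim
        case (elim L)
        then show ?case using cos_power_bounds(2)[OF xb[OF elim], of "m L"]
          by (simp add: f_def xa[symmetric] power_mult_distrib)
      qed
      show "(\<lambda>L. exp (- (real (m L) / (real L)\<^sup>2 * (real L * tan (a / real L))\<^sup>2))) \<longlonglongrightarrow> exp (- (pi * (2 * real k + 1)\<^sup>2 / (4 * s)))"
        unfolding e[symmetric] by (intro tendsto_intros mlim t1)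
      show "(\<lambda>L. exp (- (real (m L) / (real L)\<^sup>2 * (real L * sin (a / real L))\<^sup>2))) \<longlonglongrightarrow> exp (- (pi * (2 * real k + 1)\<^sup>2 / (4 * s)))"
        unfolding e[symmetric] by (intro tendsto_intros mlim s1)
    qed
  qed simp
  have pre: "(\<lambda>L. 4 ^ m L / (real ((2 * m L) choose m L) * real L)) \<longlonglongrightarrow> 2 / sqrt s"
  proof -
    have "(\<lambda>L. 4 ^ m L / (real ((2 * m L) choose m L) * sqrt (real (m L))) * sqrt (real (m L) / (real L)\<^sup>2)) \<longlonglongrightarrow> sqrt pi * sqrt c"
      by (intro tendsto_mult tendsto_real_sqrt mlim filterlim_compose[OF central_binomial_tendsto minf])
    moreover have "sqrt pi * sqrt c = 2 / sqrt s"
      by (simp add: c_def real_sqrt_divide real_sqrt_mult)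
    ultimately have "(\<lambda>L. 4 ^ m L / (real ((2 * m L) choose m L) * sqrt (real (m L))) * sqrt (real (m L) / (real L)\<^sup>2)) \<longlonglongrightarrow> 2 / sqrt s"
      by simp
    then show ?thesis
    proof (rule Lim_transform_eventually)
      show "\<forall>\<^sub>F L in sequentially. 4 ^ m L / (real ((2 * m L) choose m L) * sqrt (real (m L))) * sqrt (real (m L) / (real L)\<^sup>2) =
         4 ^ m L / (real ((2 * m L) choose m L) * real L)"
        using mpos by eventually_elim (simp add: real_sqrt_divide)
    qed
  qed
  have "(\<lambda>L. \<Sum>l. (-1) ^ Suc l * binom_ratio (m L) (2 * L * Suc l)) \<longlonglongrightarrow>
     (2 / sqrt s * (\<Sum>k. exp (- (pi * (2 * real k + 1)\<^sup>2 / (4 * s)))) - 1) / 2"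
  proof (rule Lim_transform_eventually)
    show "(\<lambda>L. (4 ^ m L / (real ((2 * m L) choose m L) * real L) * (\<Sum>k. f L k) - 1) / 2) \<longlonglongrightarrow>
       (2 / sqrt s * (\<Sum>k. exp (- (pi * (2 * real k + 1)\<^sup>2 / (4 * s)))) - 1) / 2"
      by (intro tendsto_intros pre rhs) auto
    show "\<forall>\<^sub>F L in sequentially. (4 ^ m L / (real ((2 * m L) choose m L) * real L) * (\<Sum>k. f L k) - 1) / 2 =
       (\<Sum>l. (-1) ^ Suc l * binom_ratio (m L) (2 * L * Suc l))"
      using eventually_gt_at_top[of 0]
    proof eventually_elim
      case (elim L)
      have "(\<Sum>k. f L k) = (\<Sum>k<L. f L k)" by (rule suminf_finite) (auto simp: f_def)
      also have "\<dots> = (\<Sum>k<L. cos (x L k) ^ (2 * m L))" by (simp add: f_def)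
      finally show ?case using polya_identity[OF elim, of "m L"] by (simp only: sums_iff x_def)
    qed
  qed
  then have "(\<Sum>l. (-1) ^ Suc l * exp (- (pi * s * (real (Suc l))\<^sup>2))) =
     (2 / sqrt s * (\<Sum>k. exp (- (pi * (2 * real k + 1)\<^sup>2 / (4 * s)))) - 1) / 2"
    using lhs LIMSEQ_unique by blast
  moreover have "summable (\<lambda>l. (-1) ^ Suc l * exp (- (pi * s * (real (Suc l))\<^sup>2)))"
  proof (rule summable_norm_cancel)
    have "summable (\<lambda>l. exp (- (pi * s * (real (Suc l))\<^sup>2)))"
      using s by (intro summable_gaussian) auto
    then show "summable (\<lambda>l. norm ((-1) ^ Suc l * exp (- (pi * s * (real (Suc l))\<^sup>2))))"
      by (simp add: abs_mult power_abs)
  qed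
  ultimately show ?thesis by (simp only: sums_iff)
qed

section \<open>The minor arc\<close>

text \<open>Put d = |x| - Re x. Then |1 + x|^2 falls short of (1 + |x|)^2 \<le> 4 by exactly 2d, a
  relative loss of at least d/2 and of d/4 after the root, while |1 - x| \<ge> 1 - |x|.\<close>

lemma norm_cayley_le:
  fixes x :: complex
  assumes "norm x < 1"
  shows "norm ((1 + x) / (1 - x)) \<le> (1 + norm x) / (1 - norm x) * exp (- ((norm x - Re x) / 4))"
proof -
  define r where "r = norm x"
  define d where "d = r - Re x"
  have r: "0 \<le> r" "r < 1" using assms by (auto simp: r_def)
  have d: "0 \<le> d" using complex_Re_le_cmod[of x] by (simp add: d_def r_def)
  have "(norm (1 + x))\<^sup>2 = (1 + r)\<^sup>2 - 2 * d"
  proof -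
    have "(norm (1 + x))\<^sup>2 = (1 + Re x)\<^sup>2 + (Im x)\<^sup>2" by (simp add: cmod_power2)
    moreover have "r\<^sup>2 = (Re x)\<^sup>2 + (Im x)\<^sup>2" by (simp add: r_def cmod_power2)
    ultimately show ?thesis by (simp add: d_def power2_sum)
  qed
  also have "\<dots> \<le> (1 + r)\<^sup>2 * (1 + - (d / 2))"
  proof -
    have "(1 + r)\<^sup>2 \<le> 2\<^sup>2" using r by (intro power_mono) auto
    then have "(1 + r)\<^sup>2 * (d / 2) \<le> 2\<^sup>2 * (d / 2)" using d by (intro mult_right_mono) auto
    then show ?thesis by (simp add: algebra_simps)
  qed
  also have "\<dots> \<le> (1 + r)\<^sup>2 * exp (- (d / 2))"
    by (intro mult_left_mono exp_ge_add_one_self) auto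
  also have "exp (- (d / 2)) = (exp (- (d / 4)))\<^sup>2"
    by (simp add: power2_eq_square exp_add[symmetric])
  finally have "(norm (1 + x))\<^sup>2 \<le> ((1 + r) * exp (- (d / 4)))\<^sup>2"
    by (simp add: power_mult_distrib)
  then have "norm (1 + x) \<le> (1 + r) * exp (- (d / 4))"
    by (rule power2_le_imp_le) (use r in auto)
  moreover have "1 - r \<le> norm (1 - x)"
    using norm_triangle_ineq2[of 1 x] by (simp add: r_def)
  ultimately have "norm ((1 + x) / (1 - x)) \<le> ((1 + r) * exp (- (d / 4))) / (1 - r)"
    unfolding norm_divide using r by (intro frac_le) auto
  then show ?thesis by (simp add: d_def r_def)
qed

text \<open>The losses |q|^k - Re(q^k) of the single factors sum to a difference of two geometric
  series, so the total saving is explicit.\<close>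

lemma norm_overpartition_gf_le:
  fixes q :: complex
  assumes q: "norm q < 1"
  shows "norm (overpartition_gf q) \<le>
    overpartition_gf (norm q) * exp (- ((norm q / (1 - norm q) - Re (q / (1 - q))) / 4))"
proof (rule LIMSEQ_le)
  define r where "r = norm q"
  have r: "0 \<le> r" "r < 1" using q by (auto simp: r_def)
  show "(\<lambda>K. norm (\<Prod>k<K. (1 + q ^ Suc k) / (1 - q ^ Suc k))) \<longlonglongrightarrow> norm (overpartition_gf q)"
    by (intro tendsto_norm overpartition_product_tendsto q)
  have geo: "(\<lambda>k. z ^ Suc k) sums (z / (1 - z))" if "norm z < 1" for z :: "'a::{real_normed_field,banach}"
    using sums_mult[OF geometric_sums[OF that], of z] by simp
  have "(\<lambda>k. (r ^ Suc k - Re (q ^ Suc k)) / 4) sums ((r / (1 - r) - Re (q / (1 - q))) / 4)"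
    using geo[of r] geo[OF q] r by (intro sums_divide sums_diff sums_Re) auto
  then have S: "(\<lambda>K. \<Sum>k<K. (r ^ Suc k - Re (q ^ Suc k)) / 4) \<longlonglongrightarrow> (r / (1 - r) - Re (q / (1 - q))) / 4"
    by (simp only: sums_def)
  have "(\<lambda>K. (\<Prod>k<K. (1 + r ^ Suc k) / (1 - r ^ Suc k)) * exp (- (\<Sum>k<K. (r ^ Suc k - Re (q ^ Suc k)) / 4))) \<longlonglongrightarrow>
     overpartition_gf r * exp (- ((r / (1 - r) - Re (q / (1 - q))) / 4))"
    using r by (intro tendsto_mult tendsto_exp tendsto_minus S overpartition_product_tendsto) auto
  then show "(\<lambda>K. (\<Prod>k<K. (1 + norm q ^ Suc k) / (1 - norm q ^ Suc k)) * exp (- (\<Sum>k<K. (norm q ^ Suc k - Re (q ^ Suc k)) / 4))) \<longlonglongrightarrow>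
     overpartition_gf (norm q) * exp (- ((norm q / (1 - norm q) - Re (q / (1 - q))) / 4))"
    unfolding r_def .
  have "norm (\<Prod>k<K. (1 + q ^ Suc k) / (1 - q ^ Suc k)) \<le>
     (\<Prod>k<K. (1 + norm q ^ Suc k) / (1 - norm q ^ Suc k)) * exp (- (\<Sum>k<K. (norm q ^ Suc k - Re (q ^ Suc k)) / 4))" for K
  proof -
    have "norm (\<Prod>k<K. (1 + q ^ Suc k) / (1 - q ^ Suc k)) \<le>
       (\<Prod>k<K. (1 + norm q ^ Suc k) / (1 - norm q ^ Suc k) * exp (- ((norm q ^ Suc k - Re (q ^ Suc k)) / 4)))"
      unfolding prod_norm[symmetric]
    proof (intro prod_mono conjI norm_ge_zero)
      fix k
      have "norm (q ^ Suc k) < 1" using q power_Suc_less_one[of "norm q" k]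
        by (cases "q = 0") (simp_all add: norm_mult norm_power)
      from norm_cayley_le[OF this]
      show "norm ((1 + q ^ Suc k) / (1 - q ^ Suc k)) \<le>
        (1 + norm q ^ Suc k) / (1 - norm q ^ Suc k) * exp (- ((norm q ^ Suc k - Re (q ^ Suc k)) / 4))"
        by (simp only: norm_power)
    qed
    also have "\<dots> = (\<Prod>k<K. (1 + norm q ^ Suc k) / (1 - norm q ^ Suc k)) * exp (- (\<Sum>k<K. (norm q ^ Suc k - Re (q ^ Suc k)) / 4))"
      by (simp only: prod.distrib exp_sum[OF finite_lessThan, symmetric] sum_negf)
    finally show ?thesis .
  qed
  then show "\<exists>N. \<forall>K\<ge>N. norm (\<Prod>k<K. (1 + q ^ Suc k) / (1 - q ^ Suc k)) \<le>
     (\<Prod>k<K. (1 + norm q ^ Suc k) / (1 - norm q ^ Suc k)) * exp (- (\<Sum>k<K. (norm q ^ Suc k - Re (q ^ Suc k)) / 4))"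
    by blast
qed

text \<open>With a = 1 - |q| and b = |q| - Re q one has |1 - q|^2 = a^2 + 2b. The closed form shows
  that the deficit is of order 1/a as soon as b is at least of order a^2.\<close>

lemma geometric_deficit:
  fixes q :: complex
  assumes "norm q < 1"
  shows "norm q / (1 - norm q) - Re (q / (1 - q)) =
    (norm q - Re q) * (1 + norm q) / ((1 - norm q) * ((1 - norm q)\<^sup>2 + 2 * (norm q - Re q)))"
proof -
  define r where "r = norm q"
  define a where "a = 1 - r"
  define b where "b = r - Re q"
  have a: "a > 0" using assms by (simp add: a_def r_def)
  have b: "b \<ge> 0" using complex_Re_le_cmod[of q] by (simp add: b_def r_def)
  have r2: "r\<^sup>2 = (Re q)\<^sup>2 + (Im q)\<^sup>2" by (simp add: r_def cmod_power2)
  have den: "(cmod (1 - q))\<^sup>2 = a\<^sup>2 + 2 * b"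
  proof -
    have "(cmod (1 - q))\<^sup>2 = (1 - Re q)\<^sup>2 + (Im q)\<^sup>2" by (simp add: cmod_power2)
    then show ?thesis using r2 by (simp add: a_def b_def power2_diff)
  qed
  have num: "Re (q * cnj (1 - q)) = r * a - b"
    using r2 by (simp add: a_def b_def power2_eq_square algebra_simps)
  have "Re (q / (1 - q)) = (r * a - b) / (a\<^sup>2 + 2 * b)"
    using num den by (simp add: complex_div_cnj[of q] Re_divide_of_real del: complex_cnj_diff)
  moreover have "r / a - (r * a - b) / (a\<^sup>2 + 2 * b) = b * (1 + r) / (a * (a\<^sup>2 + 2 * b))"
  proof -
    have c: "a\<^sup>2 + 2 * b > 0" using a b by (simp add: add_pos_nonneg)
    have "r / a - (r * a - b) / (a\<^sup>2 + 2 * b) = (r * (a\<^sup>2 + 2 * b) - (r * a - b) * a) / (a * (a\<^sup>2 + 2 * b))"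
      using a c by (subst diff_frac_eq) auto
    also have "r * (a\<^sup>2 + 2 * b) - (r * a - b) * a = b * (1 + r)"
      by (simp add: a_def power2_eq_square algebra_simps)
    finally show ?thesis .
  qed
  ultimately have "r / a - Re (q / (1 - q)) = b * (1 + r) / (a * (a\<^sup>2 + 2 * b))"
    by simp
  then show ?thesis by (simp add: a_def b_def r_def)
qed

lemma one_minus_cos_ge:
  fixes y :: real
  assumes "\<bar>y\<bar> \<le> pi"
  shows "y\<^sup>2 / 8 \<le> 1 - cos y"
proof -
  have "cos y = 1 - 2 * (sin (\<bar>y\<bar> / 2))\<^sup>2"
    using cos_double_sin[of "\<bar>y\<bar> / 2"] by simp
  moreover have "(\<bar>y\<bar> / 4)\<^sup>2 \<le> (sin (\<bar>y\<bar> / 2))\<^sup>2"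
    using sin_ge_half[of "\<bar>y\<bar> / 2"] assms by (intro power_mono) auto
  ultimately show ?thesis by (simp add: power_divide)
qed

text \<open>Here a \<le> \<pi>\<sigma>, and |t| \<ge> \<sigma> with r \<ge> 1/2 gives b = r(1 - cos
  \<pi>t) \<ge> (\<pi>\<sigma>)^2/16. Hence a^2 + 2b \<le> 18b and the deficit is at least 1/(18a).
  The factor 1/4 from \<open>norm_cayley_le\<close> turns 18 into 72.\<close>

lemma minor_arc_bound:
  fixes \<sigma> t :: real
  assumes \<sigma>: "0 < \<sigma>" "\<sigma> \<le> 1 / 8" and t: "\<sigma> \<le> \<bar>t\<bar>" "\<bar>t\<bar> \<le> 1"
  shows "norm (overpartition_gf (exp (- (complex_of_real pi * Complex \<sigma> t)))) \<le>
    overpartition_gf (exp (- (pi * \<sigma>))) * exp (- (1 / (72 * pi * \<sigma>)))"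
proof -
  define q where "q = exp (- (complex_of_real pi * Complex \<sigma> t))"
  define r where "r = exp (- (pi * \<sigma>))"
  define a where "a = 1 - r"
  define b where "b = r - Re q"
  have nq: "norm q = r" by (simp add: q_def r_def)
  have r: "0 < r" "r < 1" using \<sigma> by (auto simp: r_def)
  have a1: "a \<le> pi * \<sigma>" using exp_ge_add_one_self[of "- (pi * \<sigma>)"] by (simp add: a_def r_def)
  have "pi * \<sigma> \<le> 4 * (1 / 8)" using \<sigma> pi_less_4 by (intro mult_mono) auto
  then have rhalf: "1 / 2 \<le> r" using a1 by (simp add: a_def)
  have a0: "0 < a" using r by (simp add: a_def)
  have "Re q = r * cos (pi * t)" by (simp add: q_def r_def Re_exp)
  then have "b = r * (1 - cos (pi * t))" by (simp add: b_def algebra_simps)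
  moreover have "1 / 2 * ((pi * \<sigma>)\<^sup>2 / 8) \<le> r * (1 - cos (pi * t))"
  proof (intro mult_mono rhalf)
    have "(pi * \<sigma>)\<^sup>2 \<le> (pi * \<bar>t\<bar>)\<^sup>2" using \<sigma> t by (intro power_mono mult_left_mono) auto
    also have "\<dots> = (pi * t)\<^sup>2" by (simp add: power_mult_distrib)
    finally have "(pi * \<sigma>)\<^sup>2 / 8 \<le> (pi * t)\<^sup>2 / 8" by simp
    also have "\<dots> \<le> 1 - cos (pi * t)" using t by (intro one_minus_cos_ge) (simp add: abs_mult)
    finally show "(pi * \<sigma>)\<^sup>2 / 8 \<le> 1 - cos (pi * t)" .
  qed (use r in auto)
  ultimately have b1: "(pi * \<sigma>)\<^sup>2 \<le> 16 * b" by simp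
  have "0 < (pi * \<sigma>)\<^sup>2" using \<sigma> by simp
  then have b0: "0 < b" using b1 by linarith
  have "a\<^sup>2 \<le> (pi * \<sigma>)\<^sup>2" using a0 a1 by (intro power_mono) auto
  then have ab: "a\<^sup>2 + 2 * b \<le> 18 * b" using b1 by simp
  have "1 / (18 * pi * \<sigma>) \<le> 1 / (18 * a)"
    using a0 a1 by (intro frac_le) auto
  also have "\<dots> = b * 1 / (a * (18 * b))" using b0 by simp
  also have "\<dots> \<le> b * (1 + r) / (a * (a\<^sup>2 + 2 * b))"
    using a0 b0 r ab by (intro frac_le mult_left_mono mult_pos_pos) (auto intro: add_nonneg_pos)
  also have "\<dots> = r / (1 - r) - Re (q / (1 - q))"
    using geometric_deficit[of q] r by (simp only: nq a_def b_def)
  finally have "1 / (72 * pi * \<sigma>) \<le> (r / (1 - r) - Re (q / (1 - q))) / 4" by simp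
  then have "overpartition_gf r * exp (- ((r / (1 - r) - Re (q / (1 - q))) / 4)) \<le> overpartition_gf r * exp (- (1 / (72 * pi * \<sigma>)))"
    using overpartition_gf_ge_1[of r] r by (intro mult_left_mono) auto
  moreover have "norm (overpartition_gf q) \<le> overpartition_gf r * exp (- ((r / (1 - r) - Re (q / (1 - q))) / 4))"
    using norm_overpartition_gf_le[of q] r by (simp add: nq)
  ultimately show ?thesis unfolding q_def r_def by linarith
qed

section \<open>The modular transformation in the half plane\<close>

text \<open>Since (2k+1)^2 = 8 k(k+1)/2 + 1, the dual theta series is exp(-\<pi>/(4s)) times a
  series in triangular powers of exp(-2\<pi>/s). Writing it as a power series with coefficients 0
  and 1 makes holomorphy immediate.\<close>

definition triangular_series :: "complex \<Rightarrow> complex" where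
  "triangular_series w = (\<Sum>n. of_bool (n \<in> range (\<lambda>k. k * (k + 1) div 2)) * w ^ n)"

lemma summable_triangular_series:
  fixes w :: complex
  assumes "norm w < 1"
  shows "summable (\<lambda>n. norm (of_bool (n \<in> A) * w ^ n))"
  by (rule summable_comparison_test'[of "\<lambda>n. norm w ^ n" 0])
     (use assms in \<open>auto simp: norm_mult norm_power intro: summable_geometric\<close>)

lemma triangular_series_holomorphic: "triangular_series holomorphic_on ball 0 1"
proof (rule power_series_holomorphic)
  fix w :: complex assume "w \<in> ball 0 1"
  then have "norm w < 1" by simp
  from summable_sums[OF summable_norm_cancel[OF summable_triangular_series[OF this]]]
  show "(\<lambda>n. of_bool (n \<in> range (\<lambda>k. k * (k + 1) div 2)) * (w - 0) ^ n) sums triangular_series w"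
    by (simp only: triangular_series_def diff_zero)
qed

lemma triangular_series_sums:
  assumes "norm w < 1"
  shows "(\<lambda>k. w ^ (k * (k + 1) div 2)) sums triangular_series w"
proof -
  define f where "f = (\<lambda>n. of_bool (n \<in> range (\<lambda>k. k * (k + 1) div 2)) * w ^ n)"
  have "f sums triangular_series w"
    using summable_sums[OF summable_norm_cancel[OF summable_triangular_series[OF assms]]]
    by (simp only: triangular_series_def f_def)
  moreover have "strict_mono (\<lambda>k::nat. k * (k + 1) div 2)"
    by (rule strict_monoI_Suc) simp
  ultimately have "(\<lambda>k. f (k * (k + 1) div 2)) sums triangular_series w"
    by (subst sums_mono_reindex) (auto simp: f_def)
  then show ?thesis by (simp add: f_def)
qed

text \<open>The constant coefficient is 1 and the others are at most 1, so the rest is dominated by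
  |w|/(1 - |w|).\<close>

lemma norm_triangular_series_minus_1_le:
  assumes "norm w \<le> 1 / 2"
  shows "norm (triangular_series w - 1) \<le> 2 * norm w"
proof -
  define f where "f = (\<lambda>n. of_bool (n \<in> range (\<lambda>k. k * (k + 1) div 2)) * w ^ n)"
  have w: "norm w < 1" using assms by simp
  have sf: "summable (\<lambda>n. norm (f n))" unfolding f_def by (rule summable_triangular_series[OF w])
  have "0 \<in> range (\<lambda>k::nat. k * (k + 1) div 2)" by (rule range_eqI[of _ _ 0]) simp
  then have f0: "f 0 = 1" by (simp add: f_def)
  have "triangular_series w = suminf f" by (simp only: triangular_series_def f_def)
  then have "triangular_series w - 1 = (\<Sum>n. f (Suc n))"
    using suminf_split_head[OF summable_norm_cancel[OF sf]] by (simp add: f0)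
  also have "norm \<dots> \<le> (\<Sum>n. norm (f (Suc n)))"
    using sf by (intro summable_norm) (simp add: summable_Suc_iff[of "\<lambda>n. norm (f n)"])
  also have "\<dots> \<le> (\<Sum>n. norm w * norm w ^ n)"
  proof (rule suminf_le)
    show "norm (f (Suc n)) \<le> norm w * norm w ^ n" for n
      by (simp add: f_def norm_mult norm_power)
    show "summable (\<lambda>n. norm (f (Suc n)))" using sf by (simp add: summable_Suc_iff[of "\<lambda>n. norm (f n)"])
    show "summable (\<lambda>n. norm w * norm w ^ n)" using w by (intro summable_mult summable_geometric) auto
  qed
  also have "\<dots> = norm w * (1 / (1 - norm w))"
    using w by (subst suminf_mult) (auto simp: suminf_geometric intro: summable_geometric)
  also have "\<dots> \<le> norm w * (1 / (1 / 2))"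
    using assms by (intro mult_left_mono frac_le) auto
  finally show ?thesis by simp
qed

section \<open>Analytic continuation to the right half plane\<close>

lemma overpartition_gf_holomorphic: "(overpartition_gf :: complex \<Rightarrow> complex) holomorphic_on ball 0 1"
proof (rule power_series_holomorphic)
  fix q :: complex assume "q \<in> ball 0 1"
  then have "norm q < 1" by simp
  from summable_sums[OF summable_norm_cancel[OF summable_overpartition_count[OF this]]]
  show "(\<lambda>n. of_nat (overpartition_count n) * (q - 0) ^ n) sums overpartition_gf q"
    by (simp only: overpartition_gf_def diff_zero)
qed

lemma overpartition_gf_of_real:
  fixes r :: real
  assumes "0 \<le> r" "r < 1"
  shows "overpartition_gf (complex_of_real r) = complex_of_real (overpartition_gf r)"
  unfolding overpartition_gf_def using summable_overpartition_count_real[OF assms]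
  by (subst suminf_of_real) auto

text \<open>\<open>gauss_theta_identity\<close> and \<open>theta4_modular_transformation\<close>
  evaluate the same alternating series at q = exp(-\<pi>s); comparing the two sums gives the
  claim.\<close>

lemma overpartition_gf_modular_real:
  fixes s :: real
  assumes s: "0 < s"
  shows "overpartition_gf (exp (- (pi * s))) * (2 * (\<Sum>k. exp (- (pi * (2 * real k + 1)\<^sup>2 / (4 * s))))) = sqrt s"
proof -
  define q where "q = exp (- (pi * s))"
  have q: "0 < q" "q < 1" using s by (auto simp: q_def)
  have "(-1) ^ Suc j * q ^ (Suc j)\<^sup>2 = (-1) ^ Suc j * exp (- (pi * s * (real (Suc j))\<^sup>2))" for j
    by (simp add: q_def exp_of_nat_mult[symmetric] mult_ac)
  then have "(\<lambda>j. (-1) ^ Suc j * exp (- (pi * s * (real (Suc j))\<^sup>2))) sums ((1 / overpartition_gf q - 1) / 2)"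
    using gauss_theta_identity[OF q] by (simp only:)
  from sums_unique2[OF this theta4_modular_transformation[OF s]]
  have "1 / overpartition_gf q = 2 / sqrt s * (\<Sum>k. exp (- (pi * (2 * real k + 1)\<^sup>2 / (4 * s))))"
    by simp
  moreover have "overpartition_gf q \<noteq> 0" using overpartition_gf_ge_1[of q] q by simp
  ultimately show ?thesis using s by (simp add: q_def field_simps)
qed

text \<open>Both sides are holomorphic for Re s > 0, where Re(1/s) > 0 keeps exp(-2\<pi>/s) in the
  unit disc and \<open>csqrt\<close> avoids its cut. They agree on the positive reals, which
  accumulate at 1.\<close>

theorem overpartition_gf_modular:
  fixes s :: complex
  assumes "0 < Re s"
  shows "overpartition_gf (exp (- (of_real pi * s))) *
    (2 * exp (- (of_real pi / (4 * s))) * triangular_series (exp (- (2 * of_real pi / s)))) = csqrt s"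
proof -
  define S where "S = {s::complex. 0 < Re s}"
  define g where "g = (\<lambda>s::complex. overpartition_gf (exp (- (of_real pi * s))) *
    (2 * exp (- (of_real pi / (4 * s))) * triangular_series (exp (- (2 * of_real pi / s)))) - csqrt s)"
  have inv_pos: "0 < Re (1 / s)" if "0 < Re s" for s
    using that by (auto simp: Re_divide intro!: divide_pos_pos add_pos_nonneg)
  have w: "norm (exp (- (2 * complex_of_real pi / s))) < 1" if "0 < Re s" for s
  proof -
    have "Re (2 * complex_of_real pi / s) = 2 * pi * Re (1 / s)"
      by (simp add: Re_divide)
    then show ?thesis using inv_pos[OF that] by simp
  qed
  have "g holomorphic_on S"
    unfolding g_def
  proof (intro holomorphic_intros)
    show "(\<lambda>s. overpartition_gf (exp (- (complex_of_real pi * s)))) holomorphic_on S"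
      by (rule holomorphic_on_compose_gen[OF _ overpartition_gf_holomorphic, unfolded o_def])
         (auto intro!: holomorphic_intros simp: S_def)
    show "(\<lambda>s. triangular_series (exp (- (2 * complex_of_real pi / s)))) holomorphic_on S"
      by (rule holomorphic_on_compose_gen[OF _ triangular_series_holomorphic, unfolded o_def])
         (use w in \<open>auto intro!: holomorphic_intros simp: S_def\<close>)
  qed (auto simp: S_def complex_nonpos_Reals_iff)
  moreover have "open S" unfolding S_def by (rule open_halfspace_Re_gt)
  moreover have "connected S" unfolding S_def by (intro convex_connected convex_halfspace_Re_gt)
  moreover have "of_real ` {0<..} \<subseteq> S" by (auto simp: S_def)
  moreover have "1 \<in> S" by (simp add: S_def)
  moreover have "(1::complex) islimpt of_real ` {0<..}"
    unfolding islimpt_approachable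
  proof (intro allI impI)
    fix e :: real assume "0 < e"
    then show "\<exists>x'\<in>of_real ` {0<..}. x' \<noteq> (1::complex) \<and> dist x' 1 < e"
      by (intro bexI[OF _ imageI[of "1 + e / 2"]]) (auto simp: dist_norm)
  qed
  moreover have "g z = 0" if "z \<in> of_real ` {0<..}" for z
  proof -
    from that obtain x where x: "z = of_real x" "0 < x" by auto
    define w where "w = complex_of_real (exp (- (2 * pi / x)))"
    have w1: "norm w < 1" using x by (simp add: w_def)
    have ex: "complex_of_real (exp (- (pi * (2 * real k + 1)\<^sup>2 / (4 * x)))) = of_real (exp (- (pi / (4 * x)))) * w ^ (k * (k + 1) div 2)" for k
    proof -
      have "real (k * (k + 1) div 2) = real k * (real k + 1) / 2"
        by (subst real_of_nat_div) (auto simp: algebra_simps)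
      then have "- (pi * (2 * real k + 1)\<^sup>2 / (4 * x)) = - (pi / (4 * x)) + real (k * (k + 1) div 2) * (- (2 * pi / x))"
        using x by (simp add: field_simps power2_eq_square)
      then have "exp (- (pi * (2 * real k + 1)\<^sup>2 / (4 * x))) = exp (- (pi / (4 * x))) * exp (- (2 * pi / x)) ^ (k * (k + 1) div 2)"
        by (simp only: exp_add exp_of_nat_mult)
      then show ?thesis by (simp only: w_def of_real_mult of_real_power)
    qed
    have sm: "summable (\<lambda>k. exp (- (pi * (2 * real k + 1)\<^sup>2 / (4 * x))))"
      using summable_gaussian[of "pi / (4 * x)" "\<lambda>k. 2 * real k + 1"] x by simp
    have "complex_of_real (\<Sum>k. exp (- (pi * (2 * real k + 1)\<^sup>2 / (4 * x)))) = of_real (exp (- (pi / (4 * x)))) * triangular_series w"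
      unfolding suminf_of_real[OF sm] ex
      using triangular_series_sums[OF w1] by (subst suminf_mult) (auto simp: sums_iff)
    moreover have "complex_of_real (overpartition_gf (exp (- (pi * x))) * (2 * (\<Sum>k. exp (- (pi * (2 * real k + 1)\<^sup>2 / (4 * x)))))) = of_real (sqrt x)"
      by (simp only: overpartition_gf_modular_real[OF x(2)])
    ultimately have "overpartition_gf (of_real (exp (- (pi * x)))) * (2 * (of_real (exp (- (pi / (4 * x)))) * triangular_series w)) = of_real (sqrt x)"
      using x by (simp add: overpartition_gf_of_real)
    moreover have "csqrt z = of_real (sqrt x)" using x by simp
    moreover have "exp (- (complex_of_real pi * z)) = of_real (exp (- (pi * x)))"
      "exp (- (complex_of_real pi / (4 * z))) = of_real (exp (- (pi / (4 * x))))"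
      "exp (- (2 * complex_of_real pi / z)) = w"
      by (simp_all add: x w_def exp_of_real[symmetric])
    ultimately show ?thesis by (simp only: g_def mult.assoc) simp
  qed
  ultimately have "g s = 0"
    using assms by (intro analytic_continuation[of g S "of_real ` {0<..}" 1 s]) (auto simp: S_def)
  then show ?thesis by (simp add: g_def)
qed

section \<open>The generating function on the major arc\<close>

lemma Re_inverse_bounds:
  fixes \<sigma> t :: real
  assumes "0 < \<sigma>"
  shows "Re (1 / Complex \<sigma> t) \<le> 1 / \<sigma>" "\<bar>t\<bar> \<le> \<sigma> \<Longrightarrow> 1 / (2 * \<sigma>) \<le> Re (1 / Complex \<sigma> t)"
proof -
  have e: "Re (1 / Complex \<sigma> t) = \<sigma> / (\<sigma>\<^sup>2 + t\<^sup>2)" by (simp add: Re_divide)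
  have "\<sigma> / (\<sigma>\<^sup>2 + t\<^sup>2) \<le> \<sigma> / \<sigma>\<^sup>2" using assms by (intro divide_left_mono) (auto intro!: mult_pos_pos add_pos_nonneg)
  then show "Re (1 / Complex \<sigma> t) \<le> 1 / \<sigma>" using assms by (simp add: e power2_eq_square)
  assume "\<bar>t\<bar> \<le> \<sigma>"
  then have "t\<^sup>2 \<le> \<sigma>\<^sup>2" by (simp add: abs_le_square_iff[symmetric])
  then have "\<sigma> / (2 * \<sigma>\<^sup>2) \<le> \<sigma> / (\<sigma>\<^sup>2 + t\<^sup>2)"
    using assms by (intro divide_left_mono) (auto intro!: mult_pos_pos add_pos_nonneg)
  then show "1 / (2 * \<sigma>) \<le> Re (1 / Complex \<sigma> t)" using assms by (simp add: e power2_eq_square)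
qed

text \<open>The transformation gives the main term divided by P =
  \<open>triangular_series w\<close>, so the error is the main term times (1 - P)/P, where |(1 -
  P)/P| \<le> 4|w| \<le> 4 exp(-\<pi>/\<sigma>). Against |E| \<le> exp(\<pi>/(4\<sigma>)) this
  leaves exp(-3\<pi>/(4\<sigma>)).\<close>

lemma major_arc_approx:
  fixes \<sigma> t :: real
  assumes \<sigma>: "0 < \<sigma>" "\<sigma> \<le> 1" and t: "\<bar>t\<bar> \<le> \<sigma>"
  defines "s \<equiv> Complex \<sigma> t"
  shows "norm (overpartition_gf (exp (- (of_real pi * s))) - csqrt s / 2 * exp (of_real pi / (4 * s))) \<le>
    4 * exp (- (3 * pi / (4 * \<sigma>)))"
proof -
  define w where "w = exp (- (2 * complex_of_real pi / s))"
  define E where "E = exp (complex_of_real pi / (4 * s))"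
  have "Re (2 * complex_of_real pi / s) = 2 * pi * Re (1 / s)" by (simp add: Re_divide)
  moreover have "2 * pi * (1 / (2 * \<sigma>)) \<le> 2 * pi * Re (1 / s)"
    unfolding s_def using \<sigma> t by (intro mult_left_mono Re_inverse_bounds) auto
  ultimately have "pi / \<sigma> \<le> Re (2 * complex_of_real pi / s)" by simp
  then have w1: "norm w \<le> exp (- (pi / \<sigma>))" by (simp add: w_def)
  have "pi * 1 \<le> pi * (1 / \<sigma>)" using \<sigma> by (intro mult_left_mono) auto
  then have "exp (- (pi / \<sigma>)) \<le> exp (- pi)" by simp
  also have "\<dots> \<le> 1 / 4"
  proof -
    have "4 \<le> exp pi" using exp_ge_add_one_self[of pi] pi_gt3 by linarith
    then show ?thesis by (simp add: exp_minus field_simps)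
  qed
  finally have w2: "norm w \<le> 1 / 4" using w1 by linarith
  define P where "P = triangular_series w"
  have P1: "norm (P - 1) \<le> 2 * norm w" unfolding P_def using w2 by (intro norm_triangular_series_minus_1_le) auto
  have "1 \<le> norm P + norm (1 - P)" using norm_triangle_ineq[of P "1 - P"] by simp
  then have P2: "1 / 2 \<le> norm P" using P1 w2 by (simp add: norm_minus_commute)
  have "Re s > 0" using \<sigma> by (simp add: s_def)
  from overpartition_gf_modular[OF this]
  have "overpartition_gf (exp (- (of_real pi * s))) * (2 * inverse E * P) = csqrt s"
    by (simp add: w_def P_def E_def exp_minus)
  moreover have P0: "P \<noteq> 0" and "E \<noteq> 0" using P2 by (auto simp: E_def)
  ultimately have gf: "overpartition_gf (exp (- (of_real pi * s))) = csqrt s / 2 * E / P"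
    by (simp add: field_simps)
  have "overpartition_gf (exp (- (of_real pi * s))) - csqrt s / 2 * E = csqrt s / 2 * E * ((1 - P) / P)"
    unfolding gf using P0 by (simp add: field_simps)
  then have "norm (overpartition_gf (exp (- (of_real pi * s))) - csqrt s / 2 * E) = norm (csqrt s) / 2 * norm E * (norm (1 - P) / norm P)"
    by (simp add: norm_mult norm_divide)
  also have "\<dots> \<le> 2 / 2 * exp (pi / (4 * \<sigma>)) * (4 * exp (- (pi / \<sigma>)))"
  proof (intro mult_mono)
    have "norm s \<le> \<bar>Re s\<bar> + \<bar>Im s\<bar>" by (rule cmod_le)
    also have "\<dots> \<le> 2\<^sup>2" using \<sigma> t by (simp add: s_def)
    finally have "sqrt (norm s) \<le> 2" by (simp add: real_le_lsqrt)
    then show "norm (csqrt s) / 2 \<le> 2 / 2" by simp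
    have "Re (complex_of_real pi / (4 * s)) = pi / 4 * Re (1 / s)"
    proof -
      have "complex_of_real pi / (4 * s) = of_real (pi / 4) * (1 / s)" by simp
      then show ?thesis by (simp only: times_complex.sel Re_complex_of_real Im_complex_of_real)
    qed
    also have "\<dots> \<le> pi / 4 * (1 / \<sigma>)"
      unfolding s_def using \<sigma> by (intro mult_left_mono Re_inverse_bounds) auto
    finally show "norm E \<le> exp (pi / (4 * \<sigma>))" by (simp add: E_def)
    have "norm (1 - P) / norm P \<le> (2 * norm w) / (1 / 2)"
      using P1 P2 by (intro frac_le) (auto simp: norm_minus_commute)
    then show "norm (1 - P) / norm P \<le> 4 * exp (- (pi / \<sigma>))" using w1 by simp
  qed auto
  also have "2 / 2 * exp (pi / (4 * \<sigma>)) * (4 * exp (- (pi / \<sigma>))) = 4 * exp (- (3 * pi / (4 * \<sigma>)))"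
    by (simp add: exp_add[symmetric])
  finally show ?thesis unfolding E_def .
qed

text \<open>The reference size for the minor arc: the major-arc formula at t = 0, with sqrt
  \<sigma>/2 \<le> 1 from the main term and 4 from the error.\<close>

lemma overpartition_gf_real_le:
  fixes \<sigma> :: real
  assumes "0 < \<sigma>" "\<sigma> \<le> 1"
  shows "overpartition_gf (exp (- (pi * \<sigma>))) \<le> 5 * exp (pi / (4 * \<sigma>))"
proof -
  define G where "G = overpartition_gf (exp (- (pi * \<sigma>)))"
  have "norm (complex_of_real G - csqrt (of_real \<sigma>) / 2 * exp (of_real pi / (4 * of_real \<sigma>))) \<le> 4 * exp (- (3 * pi / (4 * \<sigma>)))"
    using major_arc_approx[of \<sigma> 0] assms overpartition_gf_of_real[of "exp (- (pi * \<sigma>))"]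
    by (simp add: G_def complex_of_real_def[symmetric] exp_of_real[symmetric])
  also have "complex_of_real G - csqrt (of_real \<sigma>) / 2 * exp (of_real pi / (4 * of_real \<sigma>)) = of_real (G - sqrt \<sigma> / 2 * exp (pi / (4 * \<sigma>)))"
    using assms by (simp add: exp_of_real[symmetric])
  finally have "G - sqrt \<sigma> / 2 * exp (pi / (4 * \<sigma>)) \<le> 4 * exp (- (3 * pi / (4 * \<sigma>)))"
    unfolding norm_of_real by linarith
  moreover have "exp (- (3 * pi / (4 * \<sigma>))) \<le> exp (pi / (4 * \<sigma>))"
    using assms by (simp add: field_simps)
  moreover have "sqrt \<sigma> / 2 * exp (pi / (4 * \<sigma>)) \<le> 1 * exp (pi / (4 * \<sigma>))"
  proof (intro mult_right_mono)
    have "sqrt \<sigma> \<le> 1" using assms by simp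
    then show "sqrt \<sigma> / 2 \<le> 1" by linarith
  qed auto
  ultimately show ?thesis unfolding G_def[symmetric] by linarith
qed

section \<open>The saddle-point integral\<close>

text \<open>An entire error function. On the imaginary axis exp(w^2/2) becomes the Gaussian, so the
  increment from -iX to iX is i times a real integral. Its limit \<kappa> is the Gaussian integral
  sqrt(2\<pi>), introduced here as a positive limit.\<close>

lemma gaussian_primitive:
  obtains F :: "complex \<Rightarrow> complex" and \<kappa> :: real
  where "\<And>w. (F has_field_derivative exp (w\<^sup>2 / 2)) (at w)" "0 < \<kappa>"
    "\<And>X. 1 \<le> X \<Longrightarrow> norm (F (\<i> * of_real X) - F (- (\<i> * of_real X)) - \<i> * of_real \<kappa>) \<le> 2 * exp (- (X\<^sup>2 / 2))"
proof -
  have "(\<lambda>w::complex. exp (w\<^sup>2 / 2)) holomorphic_on UNIV"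
    by (intro holomorphic_intros) auto
  then obtain F :: "complex \<Rightarrow> complex" where F: "\<And>w. (F has_field_derivative exp (w\<^sup>2 / 2)) (at w)"
    using holomorphic_convex_primitive'[OF convex_UNIV open_UNIV] by (metis UNIV_I)
  define f where "f = (\<lambda>x::real. F (\<i> * of_real x))"
  have f: "(f has_vector_derivative \<i> * of_real (exp (- (x\<^sup>2 / 2)))) (at x)" for x
  proof -
    have "((\<lambda>x. \<i> * complex_of_real x) has_vector_derivative \<i>) (at x)"
      by (auto intro!: derivative_eq_intros)
    from field_vector_diff_chain_at[OF this F]
    have "(f has_vector_derivative \<i> * exp ((\<i> * complex_of_real x)\<^sup>2 / 2)) (at x)"
      by (simp add: f_def o_def)
    moreover have "exp ((\<i> * complex_of_real x)\<^sup>2 / 2) = of_real (exp (- (x\<^sup>2 / 2)))"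
      by (simp add: power_mult_distrib exp_of_real[symmetric])
    ultimately show ?thesis by simp
  qed
  define h where "h = (\<lambda>x. Im (f x))"
  have h: "(h has_real_derivative exp (- (x\<^sup>2 / 2))) (at x)" for x
    using bounded_linear.has_vector_derivative[OF bounded_linear_Im f[of x]]
    by (simp add: h_def has_real_derivative_iff_has_vector_derivative)
  have "((\<lambda>x. Re (f x)) has_real_derivative 0) (at x)" for x
    using bounded_linear.has_vector_derivative[OF bounded_linear_Re f[of x]]
    by (simp add: has_real_derivative_iff_has_vector_derivative)
  then have Rec: "Re (f x) = Re (f y)" for x y
    by (intro DERIV_isconst_all[of "\<lambda>x. Re (f x)"]) auto
  define g where "g = (\<lambda>x. h x - h (- x))"
  have fg: "F (\<i> * of_real x) - F (- (\<i> * of_real x)) = \<i> * of_real (g x)" for x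
  proof -
    have "f x - f (- x) = \<i> * of_real (g x)"
      using Rec[of x "- x"] by (simp add: complex_eq_iff g_def h_def)
    then show ?thesis by (simp add: f_def)
  qed
  have g: "(g has_real_derivative 2 * exp (- (x\<^sup>2 / 2))) (at x)" for x
  proof -
    have "((\<lambda>x. h (- x)) has_real_derivative - exp (- (x\<^sup>2 / 2))) (at x)"
      using DERIV_chain2[OF h[of "- x"] DERIV_minus[OF DERIV_ident]] by simp
    from DERIV_diff[OF h[of x] this] show ?thesis by (simp add: g_def)
  qed
  have gmono: "g x \<le> g y" if "x \<le> y" for x y
    using that by (rule DERIV_nonneg_imp_nondecreasing) (meson g mult_nonneg_nonneg exp_ge_zero zero_le_numeral)
  have gpos: "0 < g 1"
  proof -
    have "g 0 < g 1" by (rule DERIV_pos_imp_increasing) (auto intro!: exI g)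
    then show ?thesis by (simp add: g_def)
  qed
  \<comment> \<open>For u \<ge> 1 the derivative 2 exp(-u^2/2) of g is at most 2u exp(-u^2/2), the
    derivative of -2 exp(-u^2/2).\<close>
  have tail: "g y \<le> g x + 2 * exp (- (x\<^sup>2 / 2))" if "1 \<le> x" "x \<le> y" for x y
  proof -
    have "- 2 * exp (- (x\<^sup>2 / 2)) - g x \<le> - 2 * exp (- (y\<^sup>2 / 2)) - g y"
      using that(2)
    proof (rule DERIV_nonneg_imp_nondecreasing)
      fix u assume "x \<le> u"
      have "((\<lambda>u. - 2 * exp (- (u\<^sup>2 / 2)) - g u) has_real_derivative 2 * (u - 1) * exp (- (u\<^sup>2 / 2))) (at u)"
        by (rule derivative_eq_intros g refl | simp add: algebra_simps)+
      moreover have "0 \<le> 2 * (u - 1) * exp (- (u\<^sup>2 / 2))" using \<open>x \<le> u\<close> that by simp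
      ultimately show "\<exists>d. ((\<lambda>u. - 2 * exp (- (u\<^sup>2 / 2)) - g u) has_real_derivative d) (at u) \<and> 0 \<le> d" by blast
    qed
    moreover have "0 < exp (- (y\<^sup>2 / 2))" by simp
    ultimately show ?thesis by linarith
  qed
  have inc: "incseq (\<lambda>n. g (real (Suc n)))" by (intro incseq_SucI gmono) simp
  moreover have "\<forall>n. g (real (Suc n)) \<le> g 1 + 2 * exp (- (1\<^sup>2 / 2))"
    by (intro allI tail) auto
  ultimately obtain \<kappa> where \<kappa>: "(\<lambda>n. g (real (Suc n))) \<longlonglongrightarrow> \<kappa>" and \<kappa>u: "\<And>n. g (real (Suc n)) \<le> \<kappa>"
    using incseq_convergent by metis
  have "norm (F (\<i> * of_real X) - F (- (\<i> * of_real X)) - \<i> * of_real \<kappa>) \<le> 2 * exp (- (X\<^sup>2 / 2))" if "1 \<le> X" for X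
  proof -
    obtain n where n: "X \<le> real (Suc n)" using real_arch_simple[of X] by (metis of_nat_Suc le_add_same_cancel2 order_trans zero_le_one add.commute)
    have "g X \<le> \<kappa>" using gmono[OF n] \<kappa>u[of n] by linarith
    moreover have "\<kappa> \<le> g X + 2 * exp (- (X\<^sup>2 / 2))"
    proof (rule LIMSEQ_le_const2[OF \<kappa>], intro exI[of _ n] allI impI)
      fix k assume "n \<le> k"
      then show "g (real (Suc k)) \<le> g X + 2 * exp (- (X\<^sup>2 / 2))"
        using n that by (intro tail) auto
    qed
    ultimately have "\<bar>g X - \<kappa>\<bar> \<le> 2 * exp (- (X\<^sup>2 / 2))" by linarith
    moreover have "F (\<i> * of_real X) - F (- (\<i> * of_real X)) - \<i> * of_real \<kappa> = \<i> * of_real (g X - \<kappa>)"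
      unfolding fg by (simp add: algebra_simps)
    ultimately show ?thesis by (simp only: norm_mult norm_ii norm_of_real mult_1)
  qed
  moreover have "0 < \<kappa>" using gpos \<kappa>u[of 0] by simp
  ultimately show ?thesis using that F by blast
qed

text \<open>With \<open>\<zeta> = csqrt z\<close> the saddle-point integrand \<open>csqrt z * exp (\<mu>/2 * (z + 1/z - 2)) dz\<close> becomes
  \<open>2 \<zeta>\<^sup>2 exp (\<mu>/2 * (\<zeta> - 1/\<zeta>)\<^sup>2) d\<zeta>\<close>, which has a primitive in terms of the error
  function at \<open>\<zeta> - 1/\<zeta>\<close> and at \<open>\<zeta> + 1/\<zeta>\<close>; this is why the final asymptotics has only the two terms \<open>1 - 1/\<mu>\<close>.\<close>

lemma saddle_primitive_derivative:
  fixes \<mu> :: real and F :: "complex \<Rightarrow> complex"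
  assumes F: "\<And>w. (F has_field_derivative exp (of_real \<mu> / 2 * w\<^sup>2)) (at w)"
    and \<mu>: "0 < \<mu>" and \<zeta>: "\<zeta> \<noteq> 0"
  shows "((\<lambda>\<zeta>. 2 / of_real \<mu> * (\<zeta> * exp (of_real \<mu> / 2 * (\<zeta> - 1 / \<zeta>)\<^sup>2)) + (1 - 1 / of_real \<mu>) * F (\<zeta> - 1 / \<zeta>)
      - (1 + 1 / of_real \<mu>) * (exp (- (2 * of_real \<mu>)) * F (\<zeta> + 1 / \<zeta>)))
    has_field_derivative 2 * \<zeta>\<^sup>2 * exp (of_real \<mu> / 2 * (\<zeta> - 1 / \<zeta>)\<^sup>2)) (at \<zeta>)"
proof -
  define m where "m = complex_of_real \<mu>"
  define e where "e = exp (m / 2 * (\<zeta> - 1 / \<zeta>)\<^sup>2)"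
  have m: "m \<noteq> 0" using \<mu> by (simp add: m_def)
  \<comment> \<open>(\<zeta> + 1/\<zeta>)^2 exceeds (\<zeta> - 1/\<zeta>)^2 by 4, so the factor
    exp(-2\<mu>) brings both Gaussians to the same value \<open>e\<close>.\<close>
  have "exp (- (2 * m)) * exp (m / 2 * (\<zeta> + 1 / \<zeta>)\<^sup>2) = e"
    using \<zeta> unfolding e_def exp_add[symmetric] by (intro arg_cong[where f = exp]) (simp add: field_simps power2_eq_square)
  then have e': "exp (- (2 * m)) * (exp (m / 2 * (\<zeta> + 1 / \<zeta>)\<^sup>2) * c) = e * c" for c
    by (simp add: mult.assoc[symmetric])
  have d1: "((\<lambda>\<zeta>. \<zeta> - 1 / \<zeta>) has_field_derivative 1 + 1 / \<zeta>\<^sup>2) (at \<zeta>)"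
    and d2: "((\<lambda>\<zeta>. \<zeta> + 1 / \<zeta>) has_field_derivative 1 - 1 / \<zeta>\<^sup>2) (at \<zeta>)"
    using \<zeta> by (auto intro!: derivative_eq_intros simp: power2_eq_square)
  have d3: "((\<lambda>\<zeta>. exp (m / 2 * (\<zeta> - 1 / \<zeta>)\<^sup>2)) has_field_derivative e * (m * (\<zeta> - 1 / \<zeta>) * (1 + 1 / \<zeta>\<^sup>2))) (at \<zeta>)"
    by (rule derivative_eq_intros d1 refl)+ (simp add: e_def)
  note F1 = DERIV_chain2[OF F d1] and F2 = DERIV_chain2[OF F d2]
  have "((\<lambda>\<zeta>. 2 / m * (\<zeta> * exp (m / 2 * (\<zeta> - 1 / \<zeta>)\<^sup>2)) + (1 - 1 / m) * F (\<zeta> - 1 / \<zeta>)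
      - (1 + 1 / m) * (exp (- (2 * m)) * F (\<zeta> + 1 / \<zeta>)))
    has_field_derivative (2 / m * (1 * e + e * (m * (\<zeta> - 1 / \<zeta>) * (1 + 1 / \<zeta>\<^sup>2)) * \<zeta>) + (1 - 1 / m) * (e * (1 + 1 / \<zeta>\<^sup>2))
      - (1 + 1 / m) * (e * (1 - 1 / \<zeta>\<^sup>2)))) (at \<zeta>)"
  proof (intro DERIV_diff DERIV_add DERIV_cmult)
    show "((\<lambda>\<zeta>. \<zeta> * exp (m / 2 * (\<zeta> - 1 / \<zeta>)\<^sup>2)) has_field_derivative 1 * e + e * (m * (\<zeta> - 1 / \<zeta>) * (1 + 1 / \<zeta>\<^sup>2)) * \<zeta>) (at \<zeta>)"
      using DERIV_mult[OF DERIV_ident d3] by (simp add: e_def)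
    show "((\<lambda>\<zeta>. F (\<zeta> - 1 / \<zeta>)) has_field_derivative e * (1 + 1 / \<zeta>\<^sup>2)) (at \<zeta>)"
      using F1 by (simp add: e_def m_def)
    show "((\<lambda>\<zeta>. exp (- (2 * m)) * F (\<zeta> + 1 / \<zeta>)) has_field_derivative e * (1 - 1 / \<zeta>\<^sup>2)) (at \<zeta>)"
      using DERIV_cmult[OF F2, of "exp (- (2 * m))"] unfolding m_def[symmetric] e' .
  qed
  \<comment> \<open>Up to the factor e, the product rule contributes 2/m + 2(\<zeta>^2 -
    1/\<zeta>^2), and the error functions with weights 1 - 1/m and 1 + 1/m contribute -2/m +
    2/\<zeta>^2; only 2\<zeta>^2 survives.\<close>
  also have "2 / m * (1 * e + e * (m * (\<zeta> - 1 / \<zeta>) * (1 + 1 / \<zeta>\<^sup>2)) * \<zeta>) + (1 - 1 / m) * (e * (1 + 1 / \<zeta>\<^sup>2))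
      - (1 + 1 / m) * (e * (1 - 1 / \<zeta>\<^sup>2)) = 2 * \<zeta>\<^sup>2 * e"
    using m \<zeta> by (simp add: divide_simps) (simp add: algebra_simps power2_eq_square)
  finally show ?thesis by (simp only: e_def m_def)
qed

text \<open>\<open>A\<close> is the root of the endpoint z = 1 + i, where z + 1/z - 2 = (-1 + i)/2
  and z + 1/z + 2 = (7 + i)/2 are the squares of A - 1/A and A + 1/A. The bounds on these two
  numbers follow by comparing real and imaginary parts. The first square gives the decay
  exp(-\<mu>/4); for the second, 15/4 < 4 is what lets exp(-2\<mu>) win.\<close>

lemma saddle_endpoint:
  fixes A :: complex
  assumes A2: "A\<^sup>2 = Complex 1 1" and ReA: "0 < Re A"
  shows "norm A \<le> 2" "norm (exp (of_real \<mu> / 2 * (A - 1 / A)\<^sup>2)) = exp (- (\<mu> / 4))"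
    "0 < Im (A - 1 / A)" "1 / 2 \<le> (Im (A - 1 / A))\<^sup>2" "\<bar>Re (A - 1 / A)\<bar> \<le> 1"
    "(Im (A - 1 / A))\<^sup>2 - (Re (A - 1 / A))\<^sup>2 = 1 / 2"
    "(Re (A + 1 / A))\<^sup>2 \<le> 15 / 4" "\<bar>Im (A + 1 / A)\<bar> \<le> 1"
proof -
  have A0: "A \<noteq> 0" using ReA by auto
  have inv: "1 / A\<^sup>2 = Complex (1 / 2) (- (1 / 2))"
    by (simp add: A2 complex_eq_iff Re_divide Im_divide)
  have w2: "(A - 1 / A)\<^sup>2 = Complex (- (1 / 2)) (1 / 2)"
  proof -
    have "(A - 1 / A)\<^sup>2 = A\<^sup>2 + 1 / A\<^sup>2 - 2" using A0 by (simp add: power2_eq_square field_simps)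
    then show ?thesis unfolding inv unfolding A2 by (simp add: complex_eq_iff)
  qed
  have y2: "(A + 1 / A)\<^sup>2 = Complex (7 / 2) (1 / 2)"
  proof -
    have "(A + 1 / A)\<^sup>2 = A\<^sup>2 + 1 / A\<^sup>2 + 2" using A0 by (simp add: power2_eq_square field_simps)
    then show ?thesis unfolding inv unfolding A2 by (simp add: complex_eq_iff)
  qed
  have "(norm A)\<^sup>2 = norm (Complex 1 1)" unfolding A2[symmetric] by (simp add: norm_power)
  also have "\<dots> \<le> 2\<^sup>2" using cmod_le[of "Complex 1 1"] by simp
  finally show "norm A \<le> 2" by (rule power2_le_imp_le) simp
  show "norm (exp (of_real \<mu> / 2 * (A - 1 / A)\<^sup>2)) = exp (- (\<mu> / 4))"
    unfolding w2 by simp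
  have "Im (A\<^sup>2) = 1" by (simp add: A2)
  then have "0 < Re A * Im A" by (simp add: power2_eq_square mult.commute)
  then have ImA: "0 < Im A" using ReA by (rule zero_less_mult_pos)
  have "Im (1 / A) = - Im A / (norm A)\<^sup>2" by (simp add: Im_divide cmod_power2)
  then have "Im (1 / A) \<le> 0" using ImA by (simp add: divide_nonpos_nonneg)
  then show Imw: "0 < Im (A - 1 / A)" using ImA by simp
  define a b where "a = Re (A - 1 / A)" and "b = Im (A - 1 / A)"
  have "Re ((A - 1 / A)\<^sup>2) = - (1 / 2)" "Im ((A - 1 / A)\<^sup>2) = 1 / 2" unfolding w2 by simp_all
  then have ab: "a\<^sup>2 - b\<^sup>2 = - (1 / 2)" "2 * (a * b) = 1 / 2"
    by (simp_all add: a_def b_def power2_eq_square mult.commute)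
  then show "(Im (A - 1 / A))\<^sup>2 - (Re (A - 1 / A))\<^sup>2 = 1 / 2" by (simp add: a_def b_def)
  have b2: "1 / 2 \<le> b\<^sup>2" using ab(1) zero_le_power2[of a] by linarith
  then show "1 / 2 \<le> (Im (A - 1 / A))\<^sup>2" by (simp add: b_def)
  have ab2: "a\<^sup>2 * b\<^sup>2 = 1 / 16"
  proof -
    have "a * b = 1 / 4" using ab(2) by simp
    then have "(a * b)\<^sup>2 = (1 / 4)\<^sup>2" by simp
    then show ?thesis by (simp add: power_mult_distrib power_divide)
  qed
  have "a\<^sup>2 * (1 / 2) \<le> a\<^sup>2 * b\<^sup>2" using b2 by (intro mult_left_mono) auto
  then have "a\<^sup>2 \<le> 1" using ab2 by simp
  then show "\<bar>Re (A - 1 / A)\<bar> \<le> 1" by (simp add: a_def abs_square_le_1)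
  define c d where "c = Re (A + 1 / A)" and "d = Im (A + 1 / A)"
  have "Re ((A + 1 / A)\<^sup>2) = 7 / 2" "Im ((A + 1 / A)\<^sup>2) = 1 / 2" unfolding y2 by simp_all
  then have cd: "c\<^sup>2 - d\<^sup>2 = 7 / 2" "2 * (c * d) = 1 / 2"
    by (simp_all add: c_def d_def power2_eq_square mult.commute)
  have cd2: "c\<^sup>2 * d\<^sup>2 = 1 / 16"
  proof -
    have "c * d = 1 / 4" using cd(2) by simp
    then have "(c * d)\<^sup>2 = (1 / 4)\<^sup>2" by simp
    then show ?thesis by (simp add: power_mult_distrib power_divide)
  qed
  have "1 \<le> c\<^sup>2" using cd(1) zero_le_power2[of d] by linarith
  then have "1 * d\<^sup>2 \<le> c\<^sup>2 * d\<^sup>2" by (intro mult_right_mono) auto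
  then have d2: "d\<^sup>2 \<le> 1 / 16" using cd2 by simp
  then show "(Re (A + 1 / A))\<^sup>2 \<le> 15 / 4" using cd(1) unfolding c_def[symmetric] by linarith
  have "d\<^sup>2 \<le> 1" using d2 by simp
  then show "\<bar>Im (A + 1 / A)\<bar> \<le> 1" by (simp add: d_def abs_square_le_1)
qed

text \<open>The substitution \<zeta> = csqrt(1 + iu) reduces the integral to end values of the
  primitive at \<open>A\<close> and its conjugate. Only the first error function contributes more
  than exponentially small terms, namely \<kappa>/sqrt \<mu> with its weight 1 - 1/\<mu>.\<close>

lemma saddle_integral:
  "\<exists>\<kappa> K. 0 < \<kappa> \<and> (\<forall>\<mu>\<ge>2. norm (integral {-1..1} (\<lambda>u. csqrt (Complex 1 u) *
      exp (of_real \<mu> / 2 * (csqrt (Complex 1 u) - 1 / csqrt (Complex 1 u))\<^sup>2)) -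
      of_real (\<kappa> / sqrt \<mu> * (1 - 1 / \<mu>))) \<le> K * exp (- (\<mu> / 8)))"
proof -
  obtain F1 :: "complex \<Rightarrow> complex" and \<kappa> :: real
    where F1: "\<And>w. (F1 has_field_derivative exp (w\<^sup>2 / 2)) (at w)" and \<kappa>: "0 < \<kappa>"
    and lim: "\<And>X. 1 \<le> X \<Longrightarrow> norm (F1 (\<i> * of_real X) - F1 (- (\<i> * of_real X)) - \<i> * of_real \<kappa>) \<le> 2 * exp (- (X\<^sup>2 / 2))"
    using gaussian_primitive by blast
  have "norm (integral {-1..1} (\<lambda>u. csqrt (Complex 1 u) *
      exp (of_real \<mu> / 2 * (csqrt (Complex 1 u) - 1 / csqrt (Complex 1 u))\<^sup>2)) -
      of_real (\<kappa> / sqrt \<mu> * (1 - 1 / \<mu>))) \<le> 12 * exp (- (\<mu> / 8))" if \<mu>: "2 \<le> \<mu>" for \<mu>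
  proof -
    define m where "m = complex_of_real (sqrt \<mu>)"
    have m2: "m\<^sup>2 = of_real \<mu>" using \<mu> by (simp add: m_def flip: of_real_power)
    have m0: "m \<noteq> 0" using \<mu> by (simp add: m_def)
    have sq1: "1 \<le> sqrt \<mu>" using \<mu> by simp
    \<comment> \<open>Rescaling by sqrt \<mu> adapts the primitive to exp(\<mu> w^2/2) and is the
      origin of the factor 1/sqrt \<mu>.\<close>
    define F where "F = (\<lambda>w. F1 (m * w) / m)"
    have F: "(F has_field_derivative exp (of_real \<mu> / 2 * w\<^sup>2)) (at w)" for w
    proof -
      have "((\<lambda>w. m * w) has_field_derivative m) (at w)" by (auto intro!: derivative_eq_intros)
      from DERIV_cdivide[OF DERIV_chain2[OF F1 this], of m]
      show ?thesis using m0 by (simp add: F_def power_mult_distrib m2)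
    qed
    define \<Psi> where "\<Psi> = (\<lambda>\<zeta>. 2 / of_real \<mu> * (\<zeta> * exp (of_real \<mu> / 2 * (\<zeta> - 1 / \<zeta>)\<^sup>2)) + (1 - 1 / of_real \<mu>) * F (\<zeta> - 1 / \<zeta>)
      - (1 + 1 / of_real \<mu>) * (exp (- (2 * of_real \<mu>)) * F (\<zeta> + 1 / \<zeta>)))"
    define A where "A = csqrt (Complex 1 1)"
    have A2: "A\<^sup>2 = Complex 1 1" by (simp add: A_def)
    have ReA: "0 < Re A"
    proof -
      have "0 \<le> Re A" unfolding A_def using csqrt_principal[of "Complex 1 1"] by auto
      moreover have "Re A \<noteq> 0" using arg_cong[OF A2, of Im] by (auto simp: power2_eq_square)
      ultimately show ?thesis by simp
    qed
    have A': "csqrt (Complex 1 (-1)) = cnj A"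
    proof (rule csqrt_unique)
      show "(cnj A)\<^sup>2 = Complex 1 (- 1)" unfolding complex_cnj_power[symmetric] A2 by (simp add: complex_eq_iff)
    qed (use ReA in auto)
    note endp = saddle_endpoint[OF A2 ReA]
    have int: "((\<lambda>u. csqrt (Complex 1 u) * exp (of_real \<mu> / 2 * (csqrt (Complex 1 u) - 1 / csqrt (Complex 1 u))\<^sup>2)) has_integral
        (\<Psi> A / \<i> - \<Psi> (cnj A) / \<i>)) {-1..1}"
    proof -
      have "((\<lambda>u. \<Psi> (csqrt (Complex 1 u)) / \<i>) has_vector_derivative
          csqrt (Complex 1 u) * exp (of_real \<mu> / 2 * (csqrt (Complex 1 u) - 1 / csqrt (Complex 1 u))\<^sup>2)) (at u within {-1..1})" for u
      proof -
        have z: "Complex 1 u \<notin> \<real>\<^sub>\<le>\<^sub>0" "Complex 1 u \<noteq> 0" by (auto simp: complex_nonpos_Reals_iff complex_eq_iff)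
        then have z0: "csqrt (Complex 1 u) \<noteq> 0" by simp
        have d: "((\<lambda>z. \<Psi> (csqrt z) / \<i>) has_field_derivative
           2 * (csqrt (Complex 1 u))\<^sup>2 * exp (of_real \<mu> / 2 * (csqrt (Complex 1 u) - 1 / csqrt (Complex 1 u))\<^sup>2) * inverse (2 * csqrt (Complex 1 u)) / \<i>) (at (Complex 1 u))"
          unfolding \<Psi>_def using \<mu>
          by (intro DERIV_cdivide DERIV_chain2[OF saddle_primitive_derivative[OF F _ z0] has_field_derivative_csqrt[OF z(1)]]) auto
        have v: "((\<lambda>u. Complex 1 u) has_vector_derivative \<i>) (at u within {-1..1})"
          unfolding Complex_eq by (auto intro!: derivative_eq_intros)
        have "((\<lambda>u. \<Psi> (csqrt (Complex 1 u)) / \<i>) has_vector_derivative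
           \<i> * (2 * (csqrt (Complex 1 u))\<^sup>2 * exp (of_real \<mu> / 2 * (csqrt (Complex 1 u) - 1 / csqrt (Complex 1 u))\<^sup>2) * inverse (2 * csqrt (Complex 1 u)) / \<i>)) (at u within {-1..1})"
          using field_vector_diff_chain_within[OF v has_field_derivative_at_within[OF d]]
          by (simp only: o_def)
        moreover have eq: "\<i> * (2 * c\<^sup>2 * e * inverse (2 * c) / \<i>) = c * e" if "c \<noteq> 0" for c e :: complex
          using that by (simp add: field_simps power2_eq_square)
        ultimately show ?thesis by (simp only: eq[OF z0])
      qed
      from fundamental_theorem_of_calculus[OF _ this]
      have "((\<lambda>u. csqrt (Complex 1 u) * exp (of_real \<mu> / 2 * (csqrt (Complex 1 u) - 1 / csqrt (Complex 1 u))\<^sup>2)) has_integral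
        (\<Psi> (csqrt (Complex 1 1)) / \<i> - \<Psi> (csqrt (Complex 1 (-1))) / \<i>)) {-1..1}" by simp
      then show ?thesis unfolding A' A_def[symmetric] .
    qed
    define w y where "w = A - 1 / A" and "y = A + 1 / A"
    have cw: "cnj A - 1 / cnj A = cnj w" and cy: "cnj A + 1 / cnj A = cnj y" by (simp_all add: w_def y_def)
    define b where "b = Im w"
    define E where "E = exp (- (\<mu> / 8))"
    have E4: "exp (- (\<mu> / 4)) \<le> E" using \<mu> by (simp add: E_def)
    have T1: "norm (A * exp (of_real \<mu> / 2 * w\<^sup>2) - cnj A * exp (of_real \<mu> / 2 * (cnj w)\<^sup>2)) \<le> 4 * E"
    proof -
      have "norm (A * exp (of_real \<mu> / 2 * w\<^sup>2)) \<le> 2 * E"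
        unfolding norm_mult w_def endp(2) using endp(1) E4 by (intro mult_mono) auto
      moreover have c: "cnj A * exp (of_real \<mu> / 2 * (cnj w)\<^sup>2) = cnj (A * exp (of_real \<mu> / 2 * w\<^sup>2))"
        by (simp add: exp_cnj)
      ultimately show ?thesis
        using norm_triangle_ineq4[of "A * exp (of_real \<mu> / 2 * w\<^sup>2)" "cnj (A * exp (of_real \<mu> / 2 * w\<^sup>2))"]
        unfolding c complex_mod_cnj by linarith
    qed
    \<comment> \<open>The end value is moved horizontally to the imaginary axis; on that segment
      Re(z^2) \<le> (Re w)^2 - b^2 = -1/2, so the derivative of F stays below exp(-\<mu>/4).\<close>
    have segF: "norm (F (Complex (Re w) v) - F (Complex 0 v)) \<le> E" if v: "v\<^sup>2 = b\<^sup>2" for v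
    proof -
      define S where "S = {z. Im z = v \<and> \<bar>Re z\<bar> \<le> \<bar>Re w\<bar>}"
      have "S = {z. Im z \<le> v} \<inter> {z. Im z \<ge> v} \<inter> {z. Re z \<le> \<bar>Re w\<bar>} \<inter> {z. Re z \<ge> - \<bar>Re w\<bar>}" by (auto simp: S_def)
      then have "convex S"
        by (simp add: convex_Int convex_halfspace_Re_le convex_halfspace_Re_ge convex_halfspace_Im_le convex_halfspace_Im_ge)
      then have "norm (F (Complex (Re w) v) - F (Complex 0 v)) \<le> E * norm (Complex (Re w) v - Complex 0 v)"
      proof (rule field_differentiable_bound)
        fix z assume z: "z \<in> S"
        show "(F has_field_derivative exp (of_real \<mu> / 2 * z\<^sup>2)) (at z within S)"
          by (rule has_field_derivative_at_within[OF F])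
        have "Re (z\<^sup>2) = (Re z)\<^sup>2 - b\<^sup>2" using z v by (simp add: S_def power2_eq_square)
        also have "(Re z)\<^sup>2 \<le> (Re w)\<^sup>2" using z by (simp add: S_def abs_le_square_iff)
        finally have "Re (z\<^sup>2) \<le> - (1 / 2)" using endp(6) by (simp add: b_def w_def)
        then have "\<mu> / 2 * Re (z\<^sup>2) \<le> \<mu> / 2 * - (1 / 2)" using \<mu> by (intro mult_left_mono) auto
        then have "norm (exp (of_real \<mu> / 2 * z\<^sup>2)) \<le> exp (- (\<mu> / 4))" by simp
        then show "norm (exp (of_real \<mu> / 2 * z\<^sup>2)) \<le> E" using E4 by linarith
      qed (auto simp: S_def)
      also have "norm (Complex (Re w) v - Complex 0 v) = \<bar>Re w\<bar>" by (simp add: cmod_def)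
      also have "E * \<bar>Re w\<bar> \<le> E * 1" using endp(5) by (intro mult_left_mono) (auto simp: E_def w_def)
      finally show ?thesis by simp
    qed
    \<comment> \<open>In rescaled units the points are \<plusminus>iX with X = b sqrt \<mu>; b^2
      \<ge> 1/2 and \<mu> \<ge> 2 give X \<ge> 1, as the tail bound requires.\<close>
    have mid: "norm (F (Complex 0 b) - F (Complex 0 (- b)) - \<i> * of_real (\<kappa> / sqrt \<mu>)) \<le> 2 * E"
    proof -
      have b: "0 < b" "1 / 2 \<le> b\<^sup>2" using endp(3,4) by (simp_all add: b_def w_def)
      define X where "X = b * sqrt \<mu>"
      have X2: "X\<^sup>2 = b\<^sup>2 * \<mu>" using \<mu> by (simp add: X_def power_mult_distrib)
      have X3: "\<mu> / 2 \<le> X\<^sup>2" unfolding X2 using mult_right_mono[OF b(2), of \<mu>] \<mu> by simp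
      have "1\<^sup>2 \<le> X\<^sup>2" using X3 \<mu> by simp
      then have X: "1 \<le> X" by (rule power2_le_imp_le) (use b \<mu> in \<open>simp add: X_def\<close>)
      have e: "m * Complex 0 b = \<i> * of_real X" "m * Complex 0 (- b) = - (\<i> * of_real X)"
        by (simp_all add: m_def X_def complex_eq_iff)
      have "F (Complex 0 b) - F (Complex 0 (- b)) - \<i> * of_real (\<kappa> / sqrt \<mu>) =
         (F1 (\<i> * of_real X) - F1 (- (\<i> * of_real X)) - \<i> * of_real \<kappa>) / m"
        unfolding F_def e by (simp add: m_def diff_divide_distrib)
      also have "norm \<dots> \<le> (2 * exp (- (X\<^sup>2 / 2))) / 1"
        unfolding norm_divide using lim[OF X] sq1 by (intro frac_le) (auto simp: m_def)
      also have "exp (- (X\<^sup>2 / 2)) \<le> exp (- (\<mu> / 4))" using X3 by simp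
      finally show ?thesis using E4 by simp
    qed
    have T2: "norm (F w - F (cnj w) - \<i> * of_real (\<kappa> / sqrt \<mu>)) \<le> 4 * E"
    proof -
      have "w = Complex (Re w) b" "cnj w = Complex (Re w) (- b)" by (simp_all add: b_def complex_eq_iff)
      then have "F w - F (cnj w) - \<i> * of_real (\<kappa> / sqrt \<mu>) =
        (F (Complex (Re w) b) - F (Complex 0 b)) - (F (Complex (Re w) (- b)) - F (Complex 0 (- b)))
        + (F (Complex 0 b) - F (Complex 0 (- b)) - \<i> * of_real (\<kappa> / sqrt \<mu>))" by simp
      also have "norm \<dots> \<le> (E + E) + 2 * E"
        by (intro norm_triangle_le add_mono norm_triangle_le_diff segF mid) auto
      finally show ?thesis by simp
    qed
    \<comment> \<open>The second error function is compared along the vertical line through y, where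
      Re(z^2) \<le> 15/4. The surviving exp(-2\<mu> + 15\<mu>/8) = exp(-\<mu>/8) fixes the error
      exponent of the lemma.\<close>
    have T3: "norm (exp (- (2 * of_real \<mu>)) * F y - exp (- (2 * of_real \<mu>)) * F (cnj y)) \<le> 2 * E"
    proof -
      define S where "S = {z. Re z = Re y}"
      have "S = {z. Re z \<le> Re y} \<inter> {z. Re z \<ge> Re y}" by (auto simp: S_def)
      then have "convex S" by (simp add: convex_Int convex_halfspace_Re_le convex_halfspace_Re_ge)
      then have "norm (exp (- (2 * of_real \<mu>)) * F y - exp (- (2 * of_real \<mu>)) * F (cnj y)) \<le> E * norm (y - cnj y)"
      proof (rule field_differentiable_bound)
        fix z assume z: "z \<in> S"
        show "((\<lambda>z. exp (- (2 * of_real \<mu>)) * F z) has_field_derivative exp (- (2 * of_real \<mu>)) * exp (of_real \<mu> / 2 * z\<^sup>2)) (at z within S)"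
          by (intro DERIV_cmult has_field_derivative_at_within[OF F])
        have "Re (z\<^sup>2) = (Re y)\<^sup>2 - (Im z)\<^sup>2" using z by (simp add: S_def power2_eq_square)
        then have "Re (z\<^sup>2) \<le> 15 / 4" using endp(7)[folded y_def] zero_le_power2[of "Im z"] by linarith
        then have "\<mu> / 2 * Re (z\<^sup>2) \<le> \<mu> / 2 * (15 / 4)" using \<mu> by (intro mult_left_mono) auto
        then have "- (2 * \<mu>) + \<mu> / 2 * Re (z\<^sup>2) \<le> - (\<mu> / 8)" by simp
        then show "norm (exp (- (2 * complex_of_real \<mu>)) * exp (of_real \<mu> / 2 * z\<^sup>2)) \<le> E"
          by (simp add: exp_add[symmetric] E_def)
      qed (auto simp: S_def)
      also have "norm (y - cnj y) = 2 * \<bar>Im y\<bar>" by (simp add: complex_diff_cnj norm_mult)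
      also have "E * (2 * \<bar>Im y\<bar>) \<le> E * (2 * 1)" using endp(8) by (intro mult_left_mono) (auto simp: E_def y_def)
      finally show ?thesis by simp
    qed
    define T where "T = 2 / of_real \<mu> * (A * exp (of_real \<mu> / 2 * w\<^sup>2) - cnj A * exp (of_real \<mu> / 2 * (cnj w)\<^sup>2))
        + (1 - 1 / of_real \<mu>) * (F w - F (cnj w) - \<i> * of_real (\<kappa> / sqrt \<mu>))
        - (1 + 1 / of_real \<mu>) * (exp (- (2 * of_real \<mu>)) * F y - exp (- (2 * of_real \<mu>)) * F (cnj y))"
    have "(\<Psi> A / \<i> - \<Psi> (cnj A) / \<i>) - of_real (\<kappa> / sqrt \<mu> * (1 - 1 / \<mu>)) = T / \<i>"
    proof -
      have alg: "(p * a + q * f - r * g) / \<i> - (p * a' + q * f' - r * g') / \<i> - k * q =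
          (p * (a - a') + q * (f - f' - \<i> * k) - r * (g - g')) / \<i>" for p q r a a' f f' g g' k :: complex
        by (simp add: field_simps)
      have "complex_of_real (\<kappa> / sqrt \<mu> * (1 - 1 / \<mu>)) = of_real (\<kappa> / sqrt \<mu>) * (1 - 1 / of_real \<mu>)" by simp
      then show ?thesis
        unfolding \<Psi>_def T_def cw cy w_def[symmetric] y_def[symmetric] by (simp only: alg)
    qed
    moreover have "norm T \<le> (1 * (4 * E) + 1 * (4 * E)) + 2 * (2 * E)"
      unfolding T_def
    proof (intro norm_triangle_le_diff norm_triangle_le add_mono)
      have "norm (2 / complex_of_real \<mu>) \<le> 1" using \<mu> by (simp add: norm_divide)
      then show "norm (2 / of_real \<mu> * (A * exp (of_real \<mu> / 2 * w\<^sup>2) - cnj A * exp (of_real \<mu> / 2 * (cnj w)\<^sup>2))) \<le> 1 * (4 * E)"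
        unfolding norm_mult[of "2 / complex_of_real \<mu>"] by (intro mult_mono T1) auto
      have "1 - 1 / complex_of_real \<mu> = of_real (1 - 1 / \<mu>)" by simp
      then have "norm (1 - 1 / complex_of_real \<mu>) \<le> 1" using \<mu> by (simp only: norm_of_real) simp
      then show "norm ((1 - 1 / of_real \<mu>) * (F w - F (cnj w) - \<i> * of_real (\<kappa> / sqrt \<mu>))) \<le> 1 * (4 * E)"
        unfolding norm_mult[of "1 - 1 / complex_of_real \<mu>"] by (intro mult_mono T2) auto
      have "1 + 1 / complex_of_real \<mu> = of_real (1 + 1 / \<mu>)" by simp
      then have "norm (1 + 1 / complex_of_real \<mu>) \<le> 2" using \<mu> by (simp only: norm_of_real) simp
      then show "norm ((1 + 1 / of_real \<mu>) * (exp (- (2 * of_real \<mu>)) * F y - exp (- (2 * of_real \<mu>)) * F (cnj y))) \<le> 2 * (2 * E)"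
        unfolding norm_mult[of "1 + 1 / complex_of_real \<mu>"] by (intro mult_mono T3) auto
    qed
    ultimately have "norm ((\<Psi> A / \<i> - \<Psi> (cnj A) / \<i>) - of_real (\<kappa> / sqrt \<mu> * (1 - 1 / \<mu>))) \<le> 12 * E"
      by (simp add: norm_divide norm_mult)
    then show ?thesis using int by (simp add: integral_unique E_def)
  qed
  then show ?thesis using \<kappa> by blast
qed

section \<open>Asymptotics of the number of overpartitions\<close>

lemma has_integral_character:
  fixes \<sigma> :: real and j :: int
  shows "((\<lambda>t. exp (of_real pi * of_int j * Complex \<sigma> t)) has_integral (if j = 0 then 2 else 0)) {-1..1}"
proof (cases "j = 0")
  case True
  then show ?thesis using has_integral_const_real[of "1::complex" "-1" 1]
    by (simp add: scaleR_conv_of_real)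
next
  case False
  define c where "c = complex_of_real pi * of_int j"
  have c0: "c \<noteq> 0" using False by (simp add: c_def)
  have "((\<lambda>t. exp (c * Complex \<sigma> t) / (c * \<i>)) has_vector_derivative exp (c * Complex \<sigma> t)) (at t within {-1..1})" for t
  proof -
    have d: "((\<lambda>z. exp (c * z) / (c * \<i>)) has_field_derivative exp (c * Complex \<sigma> t) * c / (c * \<i>)) (at (Complex \<sigma> t))"
      by (auto intro!: derivative_eq_intros)
    have v: "((\<lambda>t. Complex \<sigma> t) has_vector_derivative \<i>) (at t within {-1..1})"
      unfolding Complex_eq by (auto intro!: derivative_eq_intros)
    have "((\<lambda>t. exp (c * Complex \<sigma> t) / (c * \<i>)) has_vector_derivative \<i> * (exp (c * Complex \<sigma> t) * c / (c * \<i>))) (at t within {-1..1})"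
      using field_vector_diff_chain_within[OF v has_field_derivative_at_within[OF d]] by (simp only: o_def)
    moreover have "\<i> * (e * c / (c * \<i>)) = e" for e using c0 by (simp add: field_simps)
    ultimately show ?thesis by (simp only:)
  qed
  from fundamental_theorem_of_calculus[OF _ this]
  have "((\<lambda>t. exp (c * Complex \<sigma> t)) has_integral exp (c * Complex \<sigma> 1) / (c * \<i>) - exp (c * Complex \<sigma> (-1)) / (c * \<i>)) {-1..1}"
    by simp
  \<comment> \<open>The endpoints differ by 2i, hence the exponents by the period multiple
    2\<pi>ij.\<close>
  moreover have "exp (c * Complex \<sigma> 1) = exp (c * Complex \<sigma> (-1))"
    unfolding exp_eq by (rule exI[of _ j]) (simp add: c_def complex_eq_iff)
  ultimately show ?thesis using False by (simp add: c_def)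
qed

text \<open>The series converges uniformly on the circle |q| = exp(-\<pi>\<sigma>), so it may be
  integrated term by term against the characters. The factor 2 is the length of the period in
  t.\<close>

lemma overpartition_count_integral:
  fixes \<sigma> :: real
  assumes \<sigma>: "0 < \<sigma>"
  shows "((\<lambda>t. overpartition_gf (exp (- (of_real pi * Complex \<sigma> t))) * exp (of_real pi * of_nat n * Complex \<sigma> t))
    has_integral of_real (2 * real (overpartition_count n))) {-1..1}"
proof -
  define r where "r = exp (- (pi * \<sigma>))"
  have r: "0 < r" "r < 1" using \<sigma> by (auto simp: r_def)
  define f where "f = (\<lambda>k t. of_nat (overpartition_count k) * exp (- (complex_of_real pi * Complex \<sigma> t)) ^ k * exp (of_real pi * of_nat n * Complex \<sigma> t))"
  define g where "g = (\<lambda>t. overpartition_gf (exp (- (complex_of_real pi * Complex \<sigma> t))) * exp (of_real pi * of_nat n * Complex \<sigma> t))"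
  have f_eq: "f k t = of_nat (overpartition_count k) * exp (of_real pi * of_int (int n - int k) * Complex \<sigma> t)" for k t
    unfolding f_def mult.assoc exp_of_nat_mult[symmetric] exp_add[symmetric] by (simp add: algebra_simps)
  have nq: "norm (exp (- (complex_of_real pi * Complex \<sigma> t))) = r" for t by (simp add: r_def)
  have "uniform_limit {-1..1} (\<lambda>N t. \<Sum>k<N. f k t) (\<lambda>t. \<Sum>k. f k t) sequentially"
  proof (rule Weierstrass_m_test)
    show "norm (f k t) \<le> real (overpartition_count k) * r ^ k * exp (pi * real n * \<sigma>)" for k t
      by (simp add: f_def norm_mult norm_power r_def)
    show "summable (\<lambda>k. real (overpartition_count k) * r ^ k * exp (pi * real n * \<sigma>))"
      using r by (intro summable_mult2 summable_overpartition_count_real) auto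
  qed
  moreover have "(\<Sum>k. f k t) = g t" for t
    unfolding f_def g_def overpartition_gf_def
    using summable_norm_cancel[OF summable_overpartition_count[of "exp (- (complex_of_real pi * Complex \<sigma> t))"]]
    unfolding nq using r by (intro suminf_mult2[symmetric]) simp
  ultimately have ul: "uniform_limit {-1..1} (\<lambda>N t. \<Sum>k<N. f k t) g sequentially" by simp
  have cont: "continuous_on {-1..1} (\<lambda>t. \<Sum>k<N. f k t)" for N
    unfolding f_def Complex_eq by (intro continuous_intros)
  obtain I J where I: "\<And>N. ((\<lambda>t. \<Sum>k<N. f k t) has_integral I N) {-1..1}"
    and J: "(g has_integral J) {-1..1}" and lim: "I \<longlonglongrightarrow> J"
    by (rule uniform_limit_integral[OF ul cont]) auto
  have "I N = (\<Sum>k<N. of_nat (overpartition_count k) * (if int n - int k = 0 then 2 else 0))" for N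
  proof (rule has_integral_unique[OF I])
    show "((\<lambda>t. \<Sum>k<N. f k t) has_integral (\<Sum>k<N. of_nat (overpartition_count k) * (if int n - int k = 0 then 2 else 0))) {-1..1}"
      unfolding f_eq by (intro has_integral_sum has_integral_mult_right has_integral_character) auto
  qed
  also have "(\<Sum>k<N. of_nat (overpartition_count k) * (if int n - int k = 0 then 2 else 0)) =
     (\<Sum>k<N. if k = n then of_nat (overpartition_count k) * 2 else (0::complex))" for N
    by (intro sum.cong) auto
  finally have IN: "I N = (if n < N then of_nat (overpartition_count n) * 2 else 0)" for N by simp
  have "I \<longlonglongrightarrow> of_nat (overpartition_count n) * 2"
    by (rule tendsto_eventually, rule eventually_sequentiallyI[of "Suc n"]) (simp add: IN)
  with lim have "J = of_nat (overpartition_count n) * 2" by (rule LIMSEQ_unique)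
  then show ?thesis using J by (simp add: g_def mult.commute)
qed

lemma csqrt_scale:
  fixes z :: complex
  assumes "0 < \<sigma>" "0 < Re z"
  shows "csqrt (of_real \<sigma> * z) = of_real (sqrt \<sigma>) * csqrt z"
proof (rule csqrt_unique)
  show "(of_real (sqrt \<sigma>) * csqrt z)\<^sup>2 = of_real \<sigma> * z"
    using assms by (simp add: power_mult_distrib flip: of_real_power)
  have "0 \<le> Re (csqrt z)" using csqrt_principal[of z] by auto
  moreover have "Re (csqrt z) \<noteq> 0"
  proof
    assume "Re (csqrt z) = 0"
    then have "Re ((csqrt z)\<^sup>2) \<le> 0" by (simp only: power2_eq_square times_complex.sel) simp
    then show False using assms by simp
  qed
  ultimately have "0 < Re (csqrt z)" by simp
  then show "0 < Re (of_real (sqrt \<sigma>) * csqrt z) \<or> Re (of_real (sqrt \<sigma>) * csqrt z) = 0 \<and> 0 \<le> Im (of_real (sqrt \<sigma>) * csqrt z)"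
    using assms by (simp del: csqrt.sel)
qed

text \<open>From n \<ge> 16 one gets \<mu> \<ge> 4\<pi>, i.e. \<sigma> = \<pi>/(2\<mu>) \<le> 1/8 as
  the minor arc requires. The minor-arc saving 1/(72\<pi>\<sigma>) is \<mu>/(36\<pi>^2), and \<pi>^2
  \<le> 10 gives 360. With \<kappa> = sqrt(2\<pi>) the constant is c = \<pi>^2/8, so the leading
  term is the classical exp(\<pi> sqrt n)/(8n).\<close>

theorem overpartition_count_asymptotics:
  "\<exists>c K. 0 < c \<and> (\<forall>n\<ge>16. \<bar>real (overpartition_count n) - c * (1 - 1 / mu_hat n) / (mu_hat n)\<^sup>2 * exp (mu_hat n)\<bar>
      \<le> K * exp (mu_hat n - mu_hat n / 360))"
proof -
  obtain \<kappa> K where \<kappa>: "0 < \<kappa>" and K: "\<And>\<mu>. 2 \<le> \<mu> \<Longrightarrow> norm (integral {-1..1} (\<lambda>u. csqrt (Complex 1 u) *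
      exp (of_real \<mu> / 2 * (csqrt (Complex 1 u) - 1 / csqrt (Complex 1 u))\<^sup>2)) -
      of_real (\<kappa> / sqrt \<mu> * (1 - 1 / \<mu>))) \<le> K * exp (- (\<mu> / 8))"
    using saddle_integral by blast
  define c where "c = (pi / 2 * sqrt (pi / 2)) * \<kappa> / 4"
  have c: "0 < c" using \<kappa> by (simp add: c_def)
  have "\<bar>real (overpartition_count n) - c * (1 - 1 / mu_hat n) / (mu_hat n)\<^sup>2 * exp (mu_hat n)\<bar>
      \<le> (9 + \<bar>K\<bar>) * exp (mu_hat n - mu_hat n / 360)" if n: "16 \<le> n" for n
  proof -
    define \<mu> where "\<mu> = mu_hat n"
    \<comment> \<open>The minimum of \<pi>/(4\<sigma>) + \<pi>n\<sigma>, at which both summands are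
      \<mu>/2.\<close>
    define \<sigma> where "\<sigma> = pi / (2 * \<mu>)"
    define B where "B = exp (\<mu> - \<mu> / 360)"
    have "sqrt 16 \<le> sqrt (real n)" using n by (intro real_sqrt_le_mono) simp
    moreover have "sqrt 16 = (4::real)" by simp
    ultimately have sn: "4 \<le> sqrt (real n)" by simp
    have \<mu>4: "4 * pi \<le> \<mu>" using mult_left_mono[OF sn, of pi] by (simp add: \<mu>_def mu_hat_def mult.commute)
    then have \<mu>: "12 \<le> \<mu>" using pi_gt3 by linarith
    have \<mu>2: "\<mu>\<^sup>2 = pi\<^sup>2 * real n" by (simp add: \<mu>_def mu_hat_def power_mult_distrib)
    have \<sigma>: "0 < \<sigma>" "\<sigma> \<le> 1 / 8"
      using \<mu>4 \<mu> by (simp_all add: \<sigma>_def field_simps)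
    have e1: "pi / (4 * \<sigma>) = \<mu> / 2" using \<mu> by (simp add: \<sigma>_def)
    have e2: "pi * real n * \<sigma> = \<mu> / 2"
    proof -
      have "pi * real n * \<sigma> = (pi\<^sup>2 * real n) / (2 * \<mu>)" by (simp add: \<sigma>_def power2_eq_square)
      then show ?thesis unfolding \<mu>2[symmetric] using \<mu> by (simp add: power2_eq_square)
    qed
    have e3: "\<mu> / 360 \<le> 1 / (72 * pi * \<sigma>)"
    proof -
      have "pi\<^sup>2 \<le> 3.15\<^sup>2" using pi_approx by (intro power_mono) auto
      then have "pi\<^sup>2 \<le> 10" by (simp add: power2_eq_square)
      then have "\<mu> / 360 \<le> \<mu> / (36 * pi\<^sup>2)" using \<mu> by (intro divide_left_mono) auto
      also have "\<dots> = 1 / (72 * pi * \<sigma>)" by (simp add: \<sigma>_def power2_eq_square)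
      finally show ?thesis .
    qed
    define h where "h = (\<lambda>t. overpartition_gf (exp (- (of_real pi * Complex \<sigma> t))) * exp (of_real pi * of_nat n * Complex \<sigma> t))"
    have hint: "(h has_integral of_real (2 * real (overpartition_count n))) {-1..1}"
      unfolding h_def by (rule overpartition_count_integral[OF \<sigma>(1)])
    then have hi: "h integrable_on {-1..1}" by blast
    have nexp: "norm (exp (of_real pi * of_nat n * Complex \<sigma> t)) = exp (\<mu> / 2)" for t
      by (simp add: e2)
    have sub: "h integrable_on {a..b}" if "-1 \<le> a" "b \<le> 1" for a b
      by (rule integrable_subinterval_real[OF hi]) (use that in auto)
    have split: "integral {-1..-\<sigma>} h + integral {-\<sigma>..\<sigma>} h + integral {\<sigma>..1} h = of_real (2 * real (overpartition_count n))"
    proof -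
      have "integral {-1..-\<sigma>} h + integral {-\<sigma>..\<sigma>} h = integral {-1..\<sigma>} h"
        using \<sigma> by (intro Henstock_Kurzweil_Integration.integral_combine sub) auto
      moreover have "integral {-1..\<sigma>} h + integral {\<sigma>..1} h = integral {-1..1} h"
        using \<sigma> by (intro Henstock_Kurzweil_Integration.integral_combine sub) auto
      ultimately show ?thesis using integral_unique[OF hint] by simp
    qed
    have minor: "norm (h t) \<le> 5 * B" if "\<sigma> \<le> \<bar>t\<bar>" "\<bar>t\<bar> \<le> 1" for t
    proof -
      have "norm (h t) = norm (overpartition_gf (exp (- (of_real pi * Complex \<sigma> t)))) * exp (\<mu> / 2)"
        unfolding h_def norm_mult nexp ..
      also have "\<dots> \<le> (overpartition_gf (exp (- (pi * \<sigma>))) * exp (- (1 / (72 * pi * \<sigma>)))) * exp (\<mu> / 2)"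
        using minor_arc_bound[OF \<sigma> that] by (intro mult_right_mono) auto
      also have "\<dots> \<le> (5 * exp (\<mu> / 2) * exp (- (\<mu> / 360))) * exp (\<mu> / 2)"
        using overpartition_gf_real_le[of \<sigma>] \<sigma> e3 by (intro mult_right_mono mult_mono) (auto simp: e1)
      also have "\<dots> = 5 * B" by (simp add: B_def exp_add[symmetric] mult.assoc)
      finally show ?thesis .
    qed
    have B0: "0 < B" by (simp add: B_def)
    have int_bound: "norm (integral {a..b} f) \<le> 5 * B" if "f integrable_on {a..b}" "a \<le> b" "b \<le> a + 1" "\<And>t. t \<in> {a..b} \<Longrightarrow> norm (f t) \<le> 5 * B"
      for a b and f :: "real \<Rightarrow> complex"
    proof -
      have "norm (integral {a..b} f) \<le> 5 * B * measure lborel (cbox a b)"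
        using that B0 by (intro has_integral_bound[of _ f]) (auto simp: has_integral_integral[symmetric])
      also have "\<dots> \<le> 5 * B * 1" using that B0 by (intro mult_left_mono) auto
      finally show ?thesis by simp
    qed
    have min1: "norm (integral {-1..-\<sigma>} h) \<le> 5 * B" "norm (integral {\<sigma>..1} h) \<le> 5 * B"
      using \<sigma> by (auto intro!: int_bound sub minor)
    \<comment> \<open>\<open>M\<close> is \<open>h\<close> with the generating function replaced by
      its major-arc approximation. At s = \<sigma>z the exponents add up to \<mu>/2 (z + 1/z), so t
      = \<sigma>u leads to the integrand \<open>g\<close> of \<open>saddle_integral\<close>.\<close>
    define M where "M = (\<lambda>t. csqrt (Complex \<sigma> t) / 2 * exp (of_real pi / (4 * Complex \<sigma> t)) * exp (of_real pi * of_nat n * Complex \<sigma> t))"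
    define g where "g = (\<lambda>u. csqrt (Complex 1 u) * exp (of_real \<mu> / 2 * (csqrt (Complex 1 u) - 1 / csqrt (Complex 1 u))\<^sup>2))"
    have Mg: "M (\<sigma> * u) = of_real (sqrt \<sigma> / 2 * exp \<mu>) * g u" for u
    proof -
      define z where "z = Complex 1 u"
      have z0: "z \<noteq> 0" "Re z = 1" by (auto simp: z_def complex_eq_iff)
      then have cz: "csqrt z \<noteq> 0" by simp
      have s: "Complex \<sigma> (\<sigma> * u) = of_real \<sigma> * z" by (simp add: z_def complex_eq_iff)
      have "of_real pi / (4 * (of_real \<sigma> * z)) = complex_of_real (pi / (4 * \<sigma>)) * (1 / z)" by simp
      then have x1: "of_real pi / (4 * (of_real \<sigma> * z)) = of_real (\<mu> / 2) * (1 / z)" unfolding e1 .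
      have "of_real pi * of_nat n * (of_real \<sigma> * z) = complex_of_real (pi * real n * \<sigma>) * z" by simp
      then have x2: "of_real pi * of_nat n * (of_real \<sigma> * z) = of_real (\<mu> / 2) * z" unfolding e2 .
      have "(csqrt z - 1 / csqrt z)\<^sup>2 = (csqrt z)\<^sup>2 + 1 / (csqrt z)\<^sup>2 - 2" using cz by (simp add: power2_eq_square field_simps)
      then have x3: "(csqrt z - 1 / csqrt z)\<^sup>2 = z + 1 / z - 2" by simp
      have "exp (of_real (\<mu> / 2) * (1 / z)) * exp (of_real (\<mu> / 2) * z) = of_real (exp \<mu>) * exp (of_real \<mu> / 2 * (csqrt z - 1 / csqrt z)\<^sup>2)"
        unfolding x3 exp_of_real[symmetric] exp_add[symmetric] by (intro arg_cong[where f = exp]) (simp add: algebra_simps)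
      then show ?thesis
        unfolding M_def g_def s x1 x2 csqrt_scale[OF \<sigma>(1), of z, unfolded z0(2), OF zero_less_one] z_def[symmetric]
        by (simp add: mult.assoc)
    qed
    have gint: "g integrable_on {-1..1}"
    proof (rule integrable_continuous_interval)
      show "continuous_on {-1..1} g"
      proof -
        have "continuous_on {-1..1} (\<lambda>u. csqrt (Complex 1 u))"
        proof (rule continuous_on_compose2[OF holomorphic_on_imp_continuous_on[OF holomorphic_on_csqrt]])
          show "continuous_on {-1..1} (\<lambda>u. Complex 1 u)" unfolding Complex_eq by (intro continuous_intros)
        qed (auto simp: complex_nonpos_Reals_iff)
        moreover have "csqrt (Complex 1 u) \<noteq> 0" for u
          unfolding csqrt_eq_0 by (simp add: complex_eq_iff)
        ultimately show ?thesis unfolding g_def by (intro continuous_intros) auto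
      qed
    qed
    have Mint: "(M has_integral of_real (\<sigma> * (sqrt \<sigma> / 2 * exp \<mu>)) * integral {-1..1} g) {-\<sigma>..\<sigma>}"
    proof -
      have "((\<lambda>u. M (\<sigma> * u)) has_integral of_real (sqrt \<sigma> / 2 * exp \<mu>) * integral {-1..1} g) {-1..1}"
        unfolding Mg by (intro has_integral_mult_right integrable_integral gint)
      from has_integral_stretch_real[OF this, of "1 / \<sigma>"]
      have "(M has_integral \<sigma> *\<^sub>R (of_real (sqrt \<sigma> / 2 * exp \<mu>) * integral {-1..1} g)) ((\<lambda>x. x / (1 / \<sigma>)) ` {-1..1})"
        using \<sigma> by simp
      moreover have "(\<lambda>x. x / (1 / \<sigma>)) ` {-1..1} = {-\<sigma>..\<sigma>}"
        using image_mult_atLeastAtMost[OF \<sigma>(1), of "-1" 1] by (simp add: mult.commute)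
      ultimately show ?thesis by (simp add: scaleR_conv_of_real mult.assoc)
    qed
    have major: "norm (integral {-\<sigma>..\<sigma>} h - integral {-\<sigma>..\<sigma>} M) \<le> 5 * B"
    proof -
      have "integral {-\<sigma>..\<sigma>} h - integral {-\<sigma>..\<sigma>} M = integral {-\<sigma>..\<sigma>} (\<lambda>t. h t - M t)"
        using \<sigma> Mint by (intro integral_diff[symmetric] sub) auto
      moreover have "norm (integral {-\<sigma>..\<sigma>} (\<lambda>t. h t - M t)) \<le> 5 * B"
      proof (rule int_bound)
        show "(\<lambda>t. h t - M t) integrable_on {-\<sigma>..\<sigma>}" using \<sigma> Mint by (intro integrable_diff sub) auto
        fix t assume t: "t \<in> {-\<sigma>..\<sigma>}"
        have "h t - M t = (overpartition_gf (exp (- (of_real pi * Complex \<sigma> t))) - csqrt (Complex \<sigma> t) / 2 * exp (of_real pi / (4 * Complex \<sigma> t))) *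
           exp (of_real pi * of_nat n * Complex \<sigma> t)"
          by (simp add: h_def M_def algebra_simps)
        then have "norm (h t - M t) = norm (overpartition_gf (exp (- (of_real pi * Complex \<sigma> t))) - csqrt (Complex \<sigma> t) / 2 * exp (of_real pi / (4 * Complex \<sigma> t))) * exp (\<mu> / 2)"
          by (simp only: norm_mult nexp)
        also have "\<dots> \<le> 4 * exp (- (3 * pi / (4 * \<sigma>))) * exp (\<mu> / 2)"
          using major_arc_approx[of \<sigma> t] \<sigma> t by (intro mult_right_mono) auto
        also have "\<dots> \<le> 4 * exp (\<mu> / 2 - \<mu> / 360) * exp (\<mu> / 2)"
        proof (intro mult_right_mono mult_left_mono)
          have "3 * pi / (4 * \<sigma>) > 0" using \<sigma> by simp
          then show "exp (- (3 * pi / (4 * \<sigma>))) \<le> exp (\<mu> / 2 - \<mu> / 360)" using \<mu> by simp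
        qed auto
        also have "\<dots> = 4 * B" by (simp add: B_def exp_add[symmetric] mult.assoc)
        also have "\<dots> \<le> 5 * B" using B0 by simp
        finally show "norm (h t - M t) \<le> 5 * B" .
      qed (use \<sigma> in auto)
      ultimately show ?thesis by simp
    qed
    define I where "I = integral {-1..1} g"
    define J where "J = complex_of_real (\<kappa> / sqrt \<mu> * (1 - 1 / \<mu>))"
    have IJ: "norm (I - J) \<le> K * exp (- (\<mu> / 8))"
      unfolding I_def J_def g_def using K[of \<mu>] \<mu> by simp
    define C where "C = \<sigma> * (sqrt \<sigma> / 2 * exp \<mu>)"
    have C0: "0 \<le> C" "C \<le> exp \<mu>"
    proof -
      show "0 \<le> C" using \<sigma> by (simp add: C_def)
      have "sqrt \<sigma> \<le> 1" using \<sigma> by simp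
      then have "sqrt \<sigma> / 2 \<le> 1" by linarith
      then have "\<sigma> * (sqrt \<sigma> / 2 * exp \<mu>) \<le> 1 * (1 * exp \<mu>)"
        using \<sigma> by (intro mult_mono) auto
      then show "C \<le> exp \<mu>" by (simp add: C_def)
    qed
    have fin: "norm (of_real C * I - of_real C * J) \<le> \<bar>K\<bar> * B"
    proof -
      have "norm (of_real C * I - of_real C * J) = C * norm (I - J)"
        using C0 by (simp add: right_diff_distrib[symmetric] norm_mult)
      also have "\<dots> \<le> exp \<mu> * (\<bar>K\<bar> * exp (- (\<mu> / 360)))"
      proof (intro mult_mono C0)
        have "K * exp (- (\<mu> / 8)) \<le> \<bar>K\<bar> * exp (- (\<mu> / 360))" using \<mu> by (intro mult_mono) auto
        then show "norm (I - J) \<le> \<bar>K\<bar> * exp (- (\<mu> / 360))" using IJ by linarith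
      qed auto
      also have "\<dots> = \<bar>K\<bar> * B" unfolding B_def diff_conv_add_uminus exp_add by simp
      finally show ?thesis .
    qed
    have CJ: "of_real C * J = complex_of_real (2 * (c * (1 - 1 / \<mu>) / \<mu>\<^sup>2 * exp \<mu>))"
    proof -
      have alg: "(p / u) * ((k / r) / 2 * e) * (l / r * d) = 2 * ((p * k) * l / 4 * d * e) / (u * (r * r))" for p u k r e l d :: real
        by (simp add: mult_ac)
      have "sqrt \<sigma> = sqrt (pi / 2) / sqrt \<mu>" by (simp add: \<sigma>_def real_sqrt_divide real_sqrt_mult)
      moreover have "\<sigma> = (pi / 2) / \<mu>" by (simp add: \<sigma>_def)
      ultimately have "C * (\<kappa> / sqrt \<mu> * (1 - 1 / \<mu>)) = ((pi / 2) / \<mu>) * ((sqrt (pi / 2) / sqrt \<mu>) / 2 * exp \<mu>) * (\<kappa> / sqrt \<mu> * (1 - 1 / \<mu>))"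
        by (simp only: C_def)
      also have "\<dots> = 2 * (c * (1 - 1 / \<mu>) * exp \<mu>) / (\<mu> * (sqrt \<mu> * sqrt \<mu>))"
        unfolding c_def by (rule alg)
      also have "sqrt \<mu> * sqrt \<mu> = \<mu>" using \<mu> by simp
      finally have "C * (\<kappa> / sqrt \<mu> * (1 - 1 / \<mu>)) = 2 * (c * (1 - 1 / \<mu>) / \<mu>\<^sup>2 * exp \<mu>)"
        by (simp add: power2_eq_square)
      then show ?thesis unfolding J_def of_real_mult[symmetric] by (simp only:)
    qed
    have "integral {-\<sigma>..\<sigma>} M = of_real C * I" using Mint unfolding C_def I_def by (rule integral_unique)
    \<comment> \<open>Twice the error splits into the two minor arcs, the major-arc error and the
      saddle error: 5 + 5 + 5 + |K| times B.\<close>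
    then have "complex_of_real (2 * (real (overpartition_count n) - c * (1 - 1 / \<mu>) / \<mu>\<^sup>2 * exp \<mu>)) =
      (integral {-1..-\<sigma>} h + integral {\<sigma>..1} h) + ((integral {-\<sigma>..\<sigma>} h - integral {-\<sigma>..\<sigma>} M) + (of_real C * I - of_real C * J))"
      unfolding CJ right_diff_distrib of_real_diff split[symmetric] by simp
    also have "norm \<dots> \<le> (5 * B + 5 * B) + (5 * B + \<bar>K\<bar> * B)"
      by (intro norm_triangle_le add_mono min1 major fin)
    finally have "2 * \<bar>real (overpartition_count n) - c * (1 - 1 / \<mu>) / \<mu>\<^sup>2 * exp \<mu>\<bar> \<le> (15 + \<bar>K\<bar>) * B"
      unfolding norm_of_real abs_mult by (simp add: algebra_simps)
    moreover have "(15 + \<bar>K\<bar>) * B \<le> 2 * ((9 + \<bar>K\<bar>) * B)"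
      using B0 by (simp add: algebra_simps)
    ultimately have "2 * \<bar>real (overpartition_count n) - c * (1 - 1 / \<mu>) / \<mu>\<^sup>2 * exp \<mu>\<bar> \<le> 2 * ((9 + \<bar>K\<bar>) * B)"
      by (rule order_trans)
    then show ?thesis unfolding \<mu>_def[symmetric] B_def[symmetric] by (simp only: mult_le_cancel_left_pos zero_less_numeral)
  qed
  then show ?thesis using c by blast
qed

section \<open>Quotients of consecutive values\<close>

text \<open>On the closed disc of half the radius the derivative of order m + 1 is bounded by
  compactness. Real parts of the Taylor coefficients serve at real points.\<close>

lemma holomorphic_real_Taylor:
  fixes f :: "complex \<Rightarrow> complex"
  assumes f: "f holomorphic_on ball 0 r" and r: "0 < r"
  shows "\<exists>a C. 0 \<le> C \<and> (\<forall>x. 0 \<le> x \<and> x \<le> r / 2 \<longrightarrow> \<bar>Re (f (of_real x)) - (\<Sum>k=0..m. a k * x ^ k)\<bar> \<le> C * x ^ Suc m)"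
proof -
  define D where "D = (\<lambda>i. (deriv ^^ i) f)"
  have D: "D i holomorphic_on ball 0 r" for i
    unfolding D_def by (intro holomorphic_higher_deriv f) auto
  have "compact (D (Suc m) ` cball 0 (r / 2))"
    using r by (intro compact_continuous_image holomorphic_on_imp_continuous_on holomorphic_on_subset[OF D]) auto
  then obtain B where B: "\<And>x. x \<in> cball 0 (r / 2) \<Longrightarrow> norm (D (Suc m) x) \<le> B"
    by (meson bounded_iff compact_imp_bounded imageI)
  have B0: "0 \<le> B" using B[of 0] r norm_ge_zero order_trans by (metis centre_in_cball half_gt_zero less_imp_le)
  have T: "norm (D 0 z - (\<Sum>i\<le>m. D i 0 * (z - 0) ^ i / fact i)) \<le> B * norm (z - 0) ^ Suc m / fact m" if "z \<in> cball 0 (r / 2)" for z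
  proof (rule complex_Taylor[of "cball 0 (r / 2)"])
    fix i and x :: complex assume "x \<in> cball 0 (r / 2)"
    then have "x \<in> ball 0 r" using r by simp
    then have "(D i has_field_derivative D (Suc i) x) (at x)"
      unfolding D_def by (intro has_field_derivative_higher_deriv[OF f]) auto
    then show "(D i has_field_derivative D (Suc i) x) (at x within cball 0 (r / 2))"
      by (rule has_field_derivative_at_within)
  qed (use that B r in auto)
  have "\<bar>Re (f (of_real x)) - (\<Sum>k=0..m. Re (D k 0 / fact k) * x ^ k)\<bar> \<le> B / fact m * x ^ Suc m" if x: "0 \<le> x" "x \<le> r / 2" for x
  proof -
    have "Re (\<Sum>i\<le>m. D i 0 * (of_real x - 0) ^ i / fact i) = (\<Sum>k=0..m. Re (D k 0 / fact k) * x ^ k)"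
      unfolding Re_sum atLeast0AtMost
    proof (rule sum.cong[OF refl])
      fix i
      have "D i 0 * (complex_of_real x - 0) ^ i / fact i = of_real (x ^ i) * (D i 0 / fact i)" by simp
      then show "Re (D i 0 * (complex_of_real x - 0) ^ i / fact i) = Re (D i 0 / fact i) * x ^ i"
        by (simp only: times_complex.sel Re_complex_of_real Im_complex_of_real mult.commute)
    qed
    then have "Re (f (of_real x)) - (\<Sum>k=0..m. Re (D k 0 / fact k) * x ^ k) = Re (D 0 (of_real x) - (\<Sum>i\<le>m. D i 0 * (of_real x - 0) ^ i / fact i))"
      by (simp add: D_def)
    then have "\<bar>Re (f (of_real x)) - (\<Sum>k=0..m. Re (D k 0 / fact k) * x ^ k)\<bar> \<le> norm (D 0 (of_real x) - (\<Sum>i\<le>m. D i 0 * (of_real x - 0) ^ i / fact i))"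
      by (simp only: abs_Re_le_cmod)
    also have "\<dots> \<le> B * norm (complex_of_real x - 0) ^ Suc m / fact m" using x by (intro T) simp
    also have "\<dots> = B / fact m * x ^ Suc m" using x by simp
    finally show ?thesis .
  qed
  then show ?thesis using B0 by (intro exI[of _ "\<lambda>k. Re (D k 0 / fact k)"] exI[of _ "B / fact m"]) auto
qed

definition overpartition_main_term :: "real \<Rightarrow> real" where
  "overpartition_main_term \<mu> = (1 - 1 / \<mu>) / \<mu>\<^sup>2 * exp \<mu>"

text \<open>If \<mu> belongs to n, then sqrt(\<mu>^2 + \<pi>^2) belongs to n + 1. The quotient is a
  function \<phi> of z = 1/\<mu>, in which R z stands for the quotient of the two values.\<close>

lemma main_term_ratio_Taylor:
  "\<exists>a C. 0 \<le> C \<and> (\<forall>\<mu>\<ge>16. \<bar>overpartition_main_term (sqrt (\<mu>\<^sup>2 + pi\<^sup>2)) / overpartition_main_term \<mu> -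
     (\<Sum>k=0..m. a k * (1 / \<mu>) ^ k)\<bar> \<le> C * (1 / \<mu>) ^ Suc m)"
proof -
  define R where "R = (\<lambda>z::complex. csqrt (1 + of_real (pi\<^sup>2) * z\<^sup>2))"
  \<comment> \<open>The increment of the exponent, (R z - 1)/z, is rationalised to \<pi>^2 z/(1 + R
    z), which is visibly holomorphic at z = 0.\<close>
  define \<phi> where "\<phi> = (\<lambda>z::complex. exp (of_real (pi\<^sup>2) * z / (1 + R z)) * (1 - z / R z) / ((1 + of_real (pi\<^sup>2) * z\<^sup>2) * (1 - z)))"
  have pi2: "pi\<^sup>2 \<le> 10"
  proof -
    have "pi\<^sup>2 \<le> 3.15\<^sup>2" using pi_approx by (intro power_mono) auto
    then show ?thesis by (simp add: power2_eq_square)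
  qed
  \<comment> \<open>The radius 1/8 keeps \<pi>^2 |z|^2 below 1, hence the radicand off the cut; half
    of it, 1/16, is the origin of \<mu> \<ge> 16.\<close>
  have pos: "0 < Re (1 + of_real (pi\<^sup>2) * z\<^sup>2)" if "norm z < 1 / 8" for z :: complex
  proof -
    have "norm (of_real (pi\<^sup>2) * z\<^sup>2) = pi\<^sup>2 * (norm z)\<^sup>2" by (simp add: norm_mult norm_power)
    also have "\<dots> \<le> 10 * (1 / 8)\<^sup>2" using pi2 that by (intro mult_mono power_mono) auto
    also have "\<dots> < 1" by (simp add: power2_eq_square)
    finally have "\<bar>Re (of_real (pi\<^sup>2) * z\<^sup>2)\<bar> < 1" using abs_Re_le_cmod le_less_trans by blast
    then show ?thesis unfolding plus_complex.sel one_complex.sel by linarith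
  qed
  have nonpos: "1 + of_real (pi\<^sup>2) * z\<^sup>2 \<notin> \<real>\<^sub>\<le>\<^sub>0" "1 + of_real (pi\<^sup>2) * z\<^sup>2 \<noteq> 0" "R z \<noteq> 0" "1 + R z \<noteq> 0" "1 - z \<noteq> 0" if "norm z < 1 / 8" for z :: complex
  proof -
    show "1 + of_real (pi\<^sup>2) * z\<^sup>2 \<notin> \<real>\<^sub>\<le>\<^sub>0" using pos[OF that] by (auto simp only: complex_nonpos_Reals_iff)
    show nz: "1 + of_real (pi\<^sup>2) * z\<^sup>2 \<noteq> 0"
    proof
      assume h: "1 + of_real (pi\<^sup>2) * z\<^sup>2 = 0"
      from pos[OF that, unfolded h] show False by simp
    qed
    then show "R z \<noteq> 0" by (simp only: R_def csqrt_eq_0) simp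
    have "0 \<le> Re (R z)" unfolding R_def using csqrt_principal[of "1 + of_real (pi\<^sup>2) * z\<^sup>2"] by linarith
    then show "1 + R z \<noteq> 0" by (auto simp: complex_eq_iff)
    show "1 - z \<noteq> 0" using that by auto
  qed
  have "\<phi> holomorphic_on ball 0 (1 / 8)"
    unfolding \<phi>_def
  proof (intro holomorphic_intros)
    show "R holomorphic_on ball 0 (1 / 8)" unfolding R_def
      by (intro holomorphic_intros) (use nonpos in auto)
    show "R holomorphic_on ball 0 (1 / 8)" unfolding R_def
      by (intro holomorphic_intros) (use nonpos in auto)
  qed (use nonpos in \<open>auto simp del: of_real_power\<close>)
  from holomorphic_real_Taylor[OF this] obtain a C where C: "0 \<le> C" and
    T: "\<And>x. 0 \<le> x \<Longrightarrow> x \<le> 1 / 16 \<Longrightarrow> \<bar>Re (\<phi> (of_real x)) - (\<Sum>k=0..m. a k * x ^ k)\<bar> \<le> C * x ^ Suc m"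
    by fastforce
  have "Re (\<phi> (of_real (1 / \<mu>))) = overpartition_main_term (sqrt (\<mu>\<^sup>2 + pi\<^sup>2)) / overpartition_main_term \<mu>" if \<mu>: "16 \<le> \<mu>" for \<mu>
  proof -
    define \<nu> where "\<nu> = sqrt (\<mu>\<^sup>2 + pi\<^sup>2)"
    have \<nu>2: "\<nu>\<^sup>2 = \<mu>\<^sup>2 + pi\<^sup>2" by (simp add: \<nu>_def)
    have "sqrt (\<mu>\<^sup>2) \<le> \<nu>" unfolding \<nu>_def by (intro real_sqrt_le_mono) simp
    then have \<nu>: "\<mu> \<le> \<nu>" using \<mu> by simp
    have e1: "1 + pi\<^sup>2 * (1 / \<mu>)\<^sup>2 = (\<nu> / \<mu>)\<^sup>2"
      unfolding power_divide \<nu>2 using \<mu> by (simp add: field_simps)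
    have "1 + of_real (pi\<^sup>2) * (complex_of_real (1 / \<mu>))\<^sup>2 = of_real (1 + pi\<^sup>2 * (1 / \<mu>)\<^sup>2)" by simp
    then have e2: "1 + of_real (pi\<^sup>2) * (complex_of_real (1 / \<mu>))\<^sup>2 = of_real ((\<nu> / \<mu>)\<^sup>2)" unfolding e1 .
    have e3: "R (of_real (1 / \<mu>)) = of_real (\<nu> / \<mu>)"
      unfolding R_def e2 using \<mu> \<nu> by (subst csqrt_of_real) auto
    have e4: "pi\<^sup>2 * (1 / \<mu>) / (1 + \<nu> / \<mu>) = \<nu> - \<mu>"
    proof -
      have "pi\<^sup>2 = (\<nu> - \<mu>) * (\<nu> + \<mu>)" using \<nu>2 by (simp add: power2_eq_square algebra_simps)
      then show ?thesis using \<mu> \<nu> by (simp add: field_simps)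
    qed
    have "\<phi> (of_real (1 / \<mu>)) = of_real (exp (pi\<^sup>2 * (1 / \<mu>) / (1 + \<nu> / \<mu>)) * (1 - (1 / \<mu>) / (\<nu> / \<mu>)) / ((\<nu> / \<mu>)\<^sup>2 * (1 - 1 / \<mu>)))"
      unfolding \<phi>_def e2 e3 by (simp add: exp_of_real[symmetric])
    then have "Re (\<phi> (of_real (1 / \<mu>))) = exp (\<nu> - \<mu>) * (1 - (1 / \<mu>) / (\<nu> / \<mu>)) / ((\<nu> / \<mu>)\<^sup>2 * (1 - 1 / \<mu>))"
      unfolding e4 by simp
    also have "\<dots> = overpartition_main_term \<nu> / overpartition_main_term \<mu>"
      using \<mu> \<nu> by (simp add: overpartition_main_term_def exp_diff power_divide mult_ac)
    finally show ?thesis unfolding \<nu>_def .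
  qed
  then have "\<bar>overpartition_main_term (sqrt (\<mu>\<^sup>2 + pi\<^sup>2)) / overpartition_main_term \<mu> -
     (\<Sum>k=0..m. a k * (1 / \<mu>) ^ k)\<bar> \<le> C * (1 / \<mu>) ^ Suc m" if "16 \<le> \<mu>" for \<mu>
    using T[of "1 / \<mu>"] that by (simp add: frac_le)
  then show ?thesis using C by blast
qed

text \<open>The main term is at least c exp(\<mu>)/(2\<mu>^2), so the relative error is O(\<mu>^2
  exp(-\<mu>/360)). One constant c serves all powers m.\<close>

lemma overpartition_relative_error:
  "\<exists>c. 0 < c \<and> (\<forall>m. (\<lambda>n. mu_hat n ^ m * (real (overpartition_count n) / (c * overpartition_main_term (mu_hat n)) - 1)) \<longlonglongrightarrow> 0)"
proof -
  obtain c K where c: "0 < c" and K: "\<And>n. 16 \<le> n \<Longrightarrow> \<bar>real (overpartition_count n) - c * (1 - 1 / mu_hat n) / (mu_hat n)\<^sup>2 * exp (mu_hat n)\<bar>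
      \<le> K * exp (mu_hat n - mu_hat n / 360)"
    using overpartition_count_asymptotics by blast
  have "(\<lambda>n. mu_hat n ^ m * (real (overpartition_count n) / (c * overpartition_main_term (mu_hat n)) - 1)) \<longlonglongrightarrow> 0" for m
  proof (rule Lim_null_comparison)
    \<comment> \<open>In the variable x = \<mu>/360 the bound has the form x^k/exp x; the power of
      360 undoes the scaling.\<close>
    have "((\<lambda>x::real. (2 * K / c * 360 ^ (m + 2)) * (x ^ (m + 2) / exp x)) \<longlongrightarrow> (2 * K / c * 360 ^ (m + 2)) * 0) at_top"
      by (intro tendsto_mult tendsto_const tendsto_power_div_exp_0)
    moreover have "filterlim (\<lambda>n. mu_hat n / 360) at_top sequentially"
      unfolding mu_hat_def by real_asymp
    ultimately have "(\<lambda>n. (2 * K / c * 360 ^ (m + 2)) * ((mu_hat n / 360) ^ (m + 2) / exp (mu_hat n / 360))) \<longlonglongrightarrow> (2 * K / c * 360 ^ (m + 2)) * 0"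
      by (rule filterlim_compose)
    then show "(\<lambda>n. (2 * K / c * 360 ^ (m + 2)) * ((mu_hat n / 360) ^ (m + 2) / exp (mu_hat n / 360))) \<longlonglongrightarrow> 0"
      by (simp only: mult_zero_right)
    show "\<forall>\<^sub>F n in sequentially. norm (mu_hat n ^ m * (real (overpartition_count n) / (c * overpartition_main_term (mu_hat n)) - 1)) \<le>
       (2 * K / c * 360 ^ (m + 2)) * ((mu_hat n / 360) ^ (m + 2) / exp (mu_hat n / 360))"
      using eventually_ge_at_top[of 16]
    proof eventually_elim
      case (elim n)
      define \<mu> where "\<mu> = mu_hat n"
      define P where "P = real (overpartition_count n)"
      have "sqrt 16 \<le> sqrt (real n)" using elim by (intro real_sqrt_le_mono) simp
      moreover have "sqrt 16 = (4::real)" by simp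
      ultimately have "3 * 4 \<le> pi * sqrt (real n)" using pi_gt3 by (intro mult_mono) auto
      then have \<mu>: "12 \<le> \<mu>" by (simp add: \<mu>_def mu_hat_def)
      define M where "M = c * overpartition_main_term \<mu>"
      have M: "M = c * (1 - 1 / \<mu>) / \<mu>\<^sup>2 * exp \<mu>" by (simp add: M_def overpartition_main_term_def)
      have "1 / \<mu> \<le> 1 / 2" using \<mu> by (simp add: field_simps)
      then have "c * (1 / 2) / \<mu>\<^sup>2 * exp \<mu> \<le> M" unfolding M using c
        by (intro mult_right_mono divide_right_mono mult_left_mono) auto
      then have M2: "c / (2 * \<mu>\<^sup>2) * exp \<mu> \<le> M" by simp
      have "0 < c / (2 * \<mu>\<^sup>2) * exp \<mu>" using c \<mu> by simp
      then have M0: "0 < M" using M2 by linarith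
      have PM: "\<bar>P - M\<bar> \<le> K * exp (\<mu> - \<mu> / 360)" using K[OF elim] by (simp add: P_def M \<mu>_def)
      have "norm (\<mu> ^ m * (P / M - 1)) = \<mu> ^ m * (\<bar>P - M\<bar> / M)"
      proof -
        have "P / M - 1 = (P - M) / M" using M0 by (simp add: field_simps)
        then show ?thesis using M0 \<mu> by (simp add: abs_mult)
      qed
      also have "\<dots> \<le> \<mu> ^ m * (K * exp (\<mu> - \<mu> / 360) / (c / (2 * \<mu>\<^sup>2) * exp \<mu>))"
        using PM M2 \<mu> c by (intro mult_left_mono frac_le) auto
      also have "\<dots> = 2 * K / c * (\<mu> ^ (m + 2) / exp (\<mu> / 360))"
        unfolding exp_diff using \<mu> by (simp add: power2_eq_square mult_ac)
      also have "\<dots> = (2 * K / c * 360 ^ (m + 2)) * ((\<mu> / 360) ^ (m + 2) / exp (\<mu> / 360))"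
        by (simp add: power_divide)
      finally show ?case unfolding \<mu>_def P_def M_def .
    qed
  qed
  then show ?thesis using c by blast
qed

theorem theorem2p4:
  fixes m :: nat
  assumes "0 < m"
  shows "\<exists>(N::nat) (a::nat \<Rightarrow> real) (C1::real) (C2::real). 0 < C1 \<and> 0 < C2 \<and>
    (\<forall>n\<ge>N.
      (\<Sum>k=0..m. a k * mu_hat n powi (- int k)) - C1 * mu_hat n powi (- int m - 1)
        < real (overpartition_count (n + 1)) / real (overpartition_count n) \<and>
      real (overpartition_count (n + 1)) / real (overpartition_count n)
        < (\<Sum>k=0..m. a k * mu_hat n powi (- int k)) + C2 * mu_hat n powi (- int m - 1))"
proof -
  obtain a C where C: "0 \<le> C" and T: "\<And>\<mu>. 16 \<le> \<mu> \<Longrightarrow> \<bar>overpartition_main_term (sqrt (\<mu>\<^sup>2 + pi\<^sup>2)) / overpartition_main_term \<mu> -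
     (\<Sum>k=0..m. a k * (1 / \<mu>) ^ k)\<bar> \<le> C * (1 / \<mu>) ^ Suc m"
    using main_term_ratio_Taylor by blast
  obtain c where c: "0 < c" and rel: "\<And>m. (\<lambda>n. mu_hat n ^ m * (real (overpartition_count n) / (c * overpartition_main_term (mu_hat n)) - 1)) \<longlonglongrightarrow> 0"
    using overpartition_relative_error by blast
  define M where "M = (\<lambda>n. c * overpartition_main_term (mu_hat n))"
  define \<epsilon> where "\<epsilon> = (\<lambda>n. real (overpartition_count n) / M n - 1)"
  \<comment> \<open>That t tends to 0 means that the relative errors are eventually below
    \<mu>^(-m-1), the order of the allowed remainder.\<close>
  define t where "t = (\<lambda>n. mu_hat n ^ Suc m * \<epsilon> n)"
  have t: "t \<longlonglongrightarrow> 0" unfolding t_def \<epsilon>_def M_def by (rule rel)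
  have \<epsilon>: "\<epsilon> \<longlonglongrightarrow> 0" using rel[of 0] unfolding \<epsilon>_def M_def by simp
  \<comment> \<open>Bounds the quotient q of main terms: |S| is at most the sum of the |a k|, and |q
    - S| \<le> C X \<le> C.\<close>
  define \<Phi> where "\<Phi> = (\<Sum>k=0..m. \<bar>a k\<bar>) + C"
  have \<Phi>: "0 \<le> \<Phi>" using C by (simp add: \<Phi>_def sum_nonneg)
  \<comment> \<open>The quotient of counts differs from q by q(\<epsilon>' - \<epsilon>)/(1 +
    \<epsilon>), where \<epsilon>' belongs to n + 1. With q \<le> \<Phi>, |\<epsilon>' - \<epsilon>|
    \<le> 2X and 1 + \<epsilon> \<ge> 1/2 this is at most 4\<Phi>X. C bounds the Taylor error and
    the 1 makes the inequality strict; the same D serves for \<open>C1\<close> and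
    \<open>C2\<close>.\<close>
  define D where "D = C + 4 * \<Phi> + 1"
  have D: "0 < D" using C \<Phi> by (simp add: D_def)
  have "filterlim mu_hat at_top sequentially" unfolding mu_hat_def by real_asymp
  then have "\<forall>\<^sub>F n in sequentially. 16 \<le> mu_hat n" by (simp add: filterlim_at_top)
  moreover have "\<forall>\<^sub>F n in sequentially. \<bar>t n\<bar> < 1" "\<forall>\<^sub>F n in sequentially. \<bar>\<epsilon> n\<bar> < 1 / 2"
    using tendstoD[OF t, of 1] tendstoD[OF \<epsilon>, of "1 / 2"] by simp_all
  moreover have "\<forall>\<^sub>F n in sequentially. \<bar>t (Suc n)\<bar> < 1"
    using tendstoD[OF LIMSEQ_Suc[OF t], of 1] by simp
  ultimately have "\<forall>\<^sub>F n in sequentially. \<bar>real (overpartition_count (n + 1)) / real (overpartition_count n) -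
      (\<Sum>k=0..m. a k * (1 / mu_hat n) ^ k)\<bar> < D * (1 / mu_hat n) ^ Suc m"
  proof eventually_elim
    case (elim n)
    define \<mu> where "\<mu> = mu_hat n"
    define \<nu> where "\<nu> = mu_hat (Suc n)"
    define q where "q = overpartition_main_term \<nu> / overpartition_main_term \<mu>"
    define S where "S = (\<Sum>k=0..m. a k * (1 / \<mu>) ^ k)"
    define X where "X = (1 / \<mu>) ^ Suc m"
    have \<mu>: "16 \<le> \<mu>" using elim by (simp add: \<mu>_def)
    have X0: "0 < X" using \<mu> by (simp add: X_def)
    have X1: "X \<le> 1" unfolding X_def using \<mu> by (intro power_le_one) auto
    have \<mu>\<nu>: "\<mu> \<le> \<nu>" by (simp add: \<mu>_def \<nu>_def mu_hat_def)
    have "\<nu> = sqrt (\<mu>\<^sup>2 + pi\<^sup>2)"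
    proof -
      have "\<mu>\<^sup>2 + pi\<^sup>2 = pi\<^sup>2 * (real n + 1)" by (simp add: \<mu>_def mu_hat_def power_mult_distrib algebra_simps)
      then show ?thesis by (simp add: \<nu>_def mu_hat_def real_sqrt_mult add.commute)
    qed
    then have qS: "\<bar>q - S\<bar> \<le> C * X" using T[OF \<mu>] by (simp only: q_def S_def X_def)
    have mpos: "0 < overpartition_main_term x" if "16 \<le> x" for x
      using that by (simp add: overpartition_main_term_def)
    have M0: "0 < M n" "0 < M (Suc n)"
      using mpos[of \<mu>] mpos[of \<nu>] \<mu> \<mu>\<nu> c by (simp_all add: M_def \<mu>_def \<nu>_def)
    have q0: "0 < q" using mpos[of \<mu>] mpos[of \<nu>] \<mu> \<mu>\<nu> by (simp add: q_def)
    have "\<bar>S\<bar> \<le> (\<Sum>k=0..m. \<bar>a k * (1 / \<mu>) ^ k\<bar>)" unfolding S_def by (rule sum_abs)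
    also have "\<dots> \<le> (\<Sum>k=0..m. \<bar>a k\<bar>)"
    proof (rule sum_mono)
      fix k
      have "(1 / \<mu>) ^ k \<le> 1" using \<mu> by (intro power_le_one) auto
      then show "\<bar>a k * (1 / \<mu>) ^ k\<bar> \<le> \<bar>a k\<bar>" using \<mu> by (simp add: abs_mult mult_left_le)
    qed
    finally have "\<bar>S\<bar> \<le> (\<Sum>k=0..m. \<bar>a k\<bar>)" .
    moreover have "C * X \<le> C" using C X1 by (simp add: mult_left_le)
    ultimately have q\<Phi>: "q \<le> \<Phi>" using qS unfolding \<Phi>_def by linarith
    have p: "real (overpartition_count k) = M k * (1 + \<epsilon> k)" if "M k > 0" for k
      using that by (simp add: \<epsilon>_def field_simps)
    have e2: "1 / 2 \<le> 1 + \<epsilon> n" using elim by linarith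
    have "real (overpartition_count (n + 1)) / real (overpartition_count n) = (M (Suc n) / M n) * ((1 + \<epsilon> (Suc n)) / (1 + \<epsilon> n))"
      using p[OF M0(1)] p[OF M0(2)] by simp
    also have "M (Suc n) / M n = q" using c by (simp add: M_def q_def \<mu>_def \<nu>_def)
    finally have "real (overpartition_count (n + 1)) / real (overpartition_count n) = q * ((1 + \<epsilon> (Suc n)) / (1 + \<epsilon> n))" .
    then have "real (overpartition_count (n + 1)) / real (overpartition_count n) - q = q * ((\<epsilon> (Suc n) - \<epsilon> n) / (1 + \<epsilon> n))"
      using e2 by (simp add: field_simps)
    then have "\<bar>real (overpartition_count (n + 1)) / real (overpartition_count n) - q\<bar> = q * (\<bar>\<epsilon> (Suc n) - \<epsilon> n\<bar> / (1 + \<epsilon> n))"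
      using q0 e2 by (simp add: abs_mult)
    also have "\<dots> \<le> \<Phi> * (2 * X / (1 / 2))"
    proof (intro mult_mono frac_le)
      have bound: "\<bar>\<epsilon> k\<bar> \<le> X" if "\<bar>t k\<bar> < 1" "\<mu> \<le> mu_hat k" for k
      proof -
        have "\<mu> ^ Suc m * \<bar>\<epsilon> k\<bar> \<le> mu_hat k ^ Suc m * \<bar>\<epsilon> k\<bar>"
          using that \<mu> by (intro mult_right_mono power_mono) auto
        also have "\<dots> \<le> 1" using that \<mu> by (simp add: t_def abs_mult power_abs)
        finally show ?thesis using \<mu> by (simp add: X_def power_divide field_simps)
      qed
      show "\<bar>\<epsilon> (Suc n) - \<epsilon> n\<bar> \<le> 2 * X"
        using bound[of n] bound[of "Suc n"] elim \<mu>\<nu> by (simp add: \<mu>_def \<nu>_def)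
    qed (use q\<Phi> q0 e2 X0 \<Phi> in auto)
    also have "\<Phi> * (2 * X / (1 / 2)) = 4 * \<Phi> * X" by simp
    finally have "\<bar>real (overpartition_count (n + 1)) / real (overpartition_count n) - S\<bar> \<le> 4 * \<Phi> * X + C * X"
      using qS by linarith
    also have "\<dots> < D * X" using X0 by (simp add: D_def algebra_simps)
    finally show ?case by (simp only: S_def X_def \<mu>_def)
  qed
  then obtain N where N: "\<And>n. N \<le> n \<Longrightarrow> \<bar>real (overpartition_count (n + 1)) / real (overpartition_count n) -
      (\<Sum>k=0..m. a k * (1 / mu_hat n) ^ k)\<bar> < D * (1 / mu_hat n) ^ Suc m"
    by (auto simp: eventually_sequentially)
  have powi: "mu_hat n powi (- int k) = (1 / mu_hat n) ^ k" for n k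
    by (simp add: power_int_minus power_one_over inverse_eq_divide)
  have powi': "mu_hat n powi (- int m - 1) = (1 / mu_hat n) ^ Suc m" for n
  proof -
    have "- int m - 1 = - int (Suc m)" by simp
    then show ?thesis by (simp only: powi)
  qed
  show ?thesis
    unfolding powi powi'
  proof (intro exI[of _ N] exI[of _ a] exI[of _ D] conjI allI impI D)
    fix n assume "N \<le> n"
    from N[OF this] show "(\<Sum>k=0..m. a k * (1 / mu_hat n) ^ k) - D * (1 / mu_hat n) ^ Suc m < real (overpartition_count (n + 1)) / real (overpartition_count n)"
      "real (overpartition_count (n + 1)) / real (overpartition_count n) < (\<Sum>k=0..m. a k * (1 / mu_hat n) ^ k) + D * (1 / mu_hat n) ^ Suc m"
      unfolding abs_less_iff by linarith+
  qed
qed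

end
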